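(* Let $n\ge2$, $1\le w\le n-1$ and $r=\min(w,n-w)$. The $W_t(j)$ coefficients for the quantum metric on the $w$th exterior power of the defining representation of $\mathfrak{su}(n)$ are given by $$W_t(j)=\frac{(n-2t+1)(r-j)!(n-r-t)!}{(r-t)!(n-r-j)!}\sum_{s=\max(0,t+j-r)}^{t}(-1)^s\frac{(n-r+t-j-s)!\,(s+r-t)!^2}{s!\,(s-(t+j-r))!\,(s+n-2t+1)!\,(t-s)!^2}$$ for $0\le t,j\le r$.
   Context: The $\mathfrak{su}(n)$ exterior power quantum metric: $\mathcal{H}=\bigwedge^w\mathbb{C}^n\subseteq(\mathbb{C}^n)^{\otimes w}$ is the $w$th exterior power of the defining representation of $\mathfrak{su}(n)$ with its $\mathrm{SU}(n)$-invariant inner product, $\phi:\mathfrak{su}(n)\to\mathcal{L}(\mathcal{H})$ is the action, $\mathcal{E}=\operatorname{span}_{\mathbb{C}}(I_{\mathcal{H}},\phi(\mathfrak{su}(n)))$, $\mathcal{E}_t=\mathbb{C}I_{\mathcal{H}}$ for $0\le t<1$ and $\mathcal{E}_t=\mathcal{E}^{\lfloor t\rfloor}$ (span of products of $\lfloor t\rfloor$ elements of $\mathcal{E}$) for $t\ge1$. Its diameter (smallest $r$ with $\mathcal{E}_r=\mathcal{L}(\mathcal{H})$) is $r=\min(w,n-w)$. On $\mathcal{L}(\mathcal{H})$ use the Hilbert–Schmidt inner product $\operatorname{tr}(E^*F)$; put $\mathcal{V}_0=\mathbb{C}I_{\mathcal{H}}$ and $\mathcal{V}_t=\mathcal{E}_t\cap\mathcal{E}_{t-1}^\perp$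 for $1\le t\le r$. $W_t(j)$ coefficients: for $\mathcal{B}_t$ any orthonormal basis of $\mathcal{V}_t$, let $\Phi_t(X)=\sum_{E\in\mathcal{B}_t}EXE^*$ and let $\Pi_t(X)=\sum_{E\in\mathcal{B}_t}\operatorname{tr}(E^*X)E$ (the orthogonal projection onto $\mathcal{V}_t$), as linear maps on the self-adjoint operators. The coefficients $W_t(j)\in\mathbb{R}$ are the unique numbers with $\Phi_t=\sum_{j=0}^{r}W_t(j)\Pi_j$ for $0\le t\le r$; equivalently $\Phi_t(X)=W_t(j)X$ for $X\in\mathcal{V}_j$ (such numbers exist for this metric). *)

theory Defs
  imports "HOL-Analysis.Analysis"
begin

(* The finite type 'n indexes the standard basis of C^n and the finite type 'w the tensor
   factors, so that n = CARD('n) and w = CARD('w). A tensor in (C^n)^(tensor w) is given by its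
   coordinates: v_1 tensor ... tensor v_w has the coordinate prod_k (v_k $ i k) at the
   multi-index i. *)

type_synonym ('n, 'w) tensor = "complex ^ ('w \<Rightarrow> 'n)"
type_synonym ('n, 'w) tensor_op = "complex ^ ('w \<Rightarrow> 'n) ^ ('w \<Rightarrow> 'n)"

definition adjoint_mat :: "complex ^ 'm ^ 'm \<Rightarrow> complex ^ 'm ^ 'm" where
  "adjoint_mat A = (\<chi> i j. cnj (A $ j $ i))"

definition su :: "(complex ^ 'n::finite ^ 'n) set" where
  "su = {A. adjoint_mat A = - A \<and> trace A = 0}"

definition tensor_inner :: "('n::finite, 'w::finite) tensor \<Rightarrow> ('n, 'w) tensor \<Rightarrow> complex" where
  "tensor_inner u v = (\<Sum>i\<in>UNIV. cnj (u $ i) * v $ i)"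

definition exterior_power :: "('n::finite, 'w::finite) tensor set" where
  "exterior_power =
     {u. \<forall>p. p permutes UNIV \<longrightarrow> (\<forall>i. u $ (i \<circ> p) = of_int (sign p) * u $ i)}"

definition antisymmetrizer :: "('n::finite, 'w::finite) tensor_op" where
  "antisymmetrizer = (\<chi> i k. (\<Sum>p | p permutes (UNIV :: 'w set).
      if k = i \<circ> p then of_int (sign p) else 0) / fact CARD('w))"

(* Linear operators on the exterior power H are represented by their extensions by zero to the
   orthogonal complement of H, i.e. by the matrices X with P X P = X for the orthogonal
   projection P onto H (see ext_op_iff below). The identity of H becomes P itself; composition,
   adjoint and trace become those of matrices. The inner product on H is the restriction of the
   standard one on (C^n)^(tensor w). *)

abbreviation ext_id :: "('n::finite, 'w::finite) tensor_op" where
  "ext_id \<equiv> antisymmetrizer"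

definition ext_ops :: "('n::finite, 'w::finite) tensor_op set" where
  "ext_ops = {X. ext_id ** X ** ext_id = X}"

definition selfadjoint_ext_ops :: "('n::finite, 'w::finite) tensor_op set" where
  "selfadjoint_ext_ops = {X \<in> ext_ops. adjoint_mat X = X}"

(* The action of A on (C^n)^(tensor w): the sum over k of the operators acting by A on the k-th
   factor and by the identity on all others. *)
definition tensor_action :: "complex ^ 'n ^ 'n \<Rightarrow> ('n::finite, 'w::finite) tensor_op" where
  "tensor_action A =
     (\<chi> i j. \<Sum>k\<in>UNIV. if \<forall>l. l \<noteq> k \<longrightarrow> i l = j l then A $ i k $ j k else 0)"

(* H is invariant under tensor_action A, so this is the restriction of the action to H. *)
definition ext_action :: "complex ^ 'n ^ 'n \<Rightarrow> ('n::finite, 'w::finite) tensor_op" where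
  "ext_action A = tensor_action A ** ext_id"

definition cscale :: "complex \<Rightarrow> complex ^ 'm ^ 'm \<Rightarrow> complex ^ 'm ^ 'm" where
  "cscale c X = (\<chi> i j. c * X $ i $ j)"

interpretation cmat: vector_space cscale
  by unfold_locales (simp_all add: cscale_def vec_eq_iff algebra_simps)

definition error_space :: "('n::finite, 'w::finite) tensor_op set" where
  "error_space = cmat.span (insert ext_id (ext_action ` su))"

definition products :: "nat \<Rightarrow> ('n::finite, 'w::finite) tensor_op set \<Rightarrow> ('n, 'w) tensor_op set" where
  "products m S = {foldr (**) Xs ext_id | Xs. length Xs = m \<and> set Xs \<subseteq> S}"

definition ext_metric :: "real \<Rightarrow> ('n::finite, 'w::finite) tensor_op set" where
  "ext_metric t = (if t < 1 then cmat.span {ext_id}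
                   else cmat.span (products (nat \<lfloor>t\<rfloor>) error_space))"

definition hs_inner :: "complex ^ 'm ^ 'm \<Rightarrow> complex ^ 'm ^ 'm \<Rightarrow> complex" where
  "hs_inner X Y = trace (adjoint_mat X ** Y)"

definition hs_complement :: "('n::finite, 'w::finite) tensor_op set \<Rightarrow> ('n, 'w) tensor_op set" where
  "hs_complement S = {X \<in> ext_ops. \<forall>Y\<in>S. hs_inner Y X = 0}"

definition metric_layer :: "nat \<Rightarrow> ('n::finite, 'w::finite) tensor_op set" where
  "metric_layer t = (if t = 0 then cmat.span {ext_id}
                     else ext_metric (real t) \<inter> hs_complement (ext_metric (real t - 1)))"

definition hs_orthonormal_basis :: "(complex ^ 'm ^ 'm) set \<Rightarrow> (complex ^ 'm ^ 'm) set \<Rightarrow> bool" where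
  "hs_orthonormal_basis B V \<longleftrightarrow> finite B \<and> cmat.span B = V \<and>
     (\<forall>E\<in>B. \<forall>F\<in>B. hs_inner E F = (if E = F then 1 else 0))"

definition Phi :: "(complex ^ 'm ^ 'm) set \<Rightarrow> complex ^ 'm ^ 'm \<Rightarrow> complex ^ 'm ^ 'm" where
  "Phi B X = (\<Sum>E\<in>B. E ** X ** adjoint_mat E)"

definition Pi_proj :: "(complex ^ 'm ^ 'm) set \<Rightarrow> complex ^ 'm ^ 'm \<Rightarrow> complex ^ 'm ^ 'm" where
  "Pi_proj B X = (\<Sum>E\<in>B. cscale (hs_inner E X) E)"

(* "W is the family of W_t(j) coefficients", for 0 <= t, j <= r; the values of W at other
   arguments are irrelevant. The type argument only fixes 'n and 'w. *)
definition is_W_coefficients ::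
    "('n::finite, 'w::finite) tensor_op itself \<Rightarrow> nat \<Rightarrow> (nat \<Rightarrow> nat \<Rightarrow> real) \<Rightarrow> bool" where
  "is_W_coefficients T r W \<longleftrightarrow>
     (\<forall>B :: nat \<Rightarrow> ('n, 'w) tensor_op set.
        (\<forall>t\<le>r. hs_orthonormal_basis (B t) (metric_layer t)) \<longrightarrow>
        (\<forall>t\<le>r. \<forall>X\<in>selfadjoint_ext_ops.
           Phi (B t) X = (\<Sum>j\<le>r. W t j *\<^sub>R Pi_proj (B j) X)))"

lemma antisymmetrizer_apply:
  fixes u :: "('n::finite, 'w::finite) tensor"
  shows "(antisymmetrizer *v u) $ i =
    (\<Sum>p | p permutes (UNIV :: 'w set). of_int (sign p) * u $ (i \<circ> p)) / fact CARD('w)"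
proof -
  have "(antisymmetrizer *v u) $ i = (\<Sum>k\<in>UNIV. \<Sum>p | p permutes (UNIV :: 'w set).
      (if k = i \<circ> p then of_int (sign p) * u $ k else 0)) / fact CARD('w)"
    by (simp add: antisymmetrizer_def matrix_vector_mult_def sum_divide_distrib
        sum_distrib_right if_distrib if_distribR cong: if_cong)
  also have "\<dots> = (\<Sum>p | p permutes (UNIV :: 'w set). \<Sum>k\<in>UNIV.
      (if k = i \<circ> p then of_int (sign p) * u $ k else 0)) / fact CARD('w)"
    by (subst sum.swap) simp
  finally show ?thesis by simp
qed

lemma antisymmetrizer_in: "antisymmetrizer *v u \<in> exterior_power"
  for u :: "('n::finite, 'w::finite) tensor"
  unfolding exterior_power_def
proof (intro CollectI allI impI)
  fix q :: "'w \<Rightarrow> 'w" and i :: "'w \<Rightarrow> 'n" assume q: "q permutes UNIV"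
  let ?S = "{p. p permutes (UNIV :: 'w set)}"
  have sgn: "sign (q \<circ> p) = sign q * sign p" if "p \<in> ?S" for p
    using that q by (simp add: sign_compose permutes_imp_permutation)
  have bij: "bij_betw ((\<circ>) q) ?S ?S"
  proof (rule bij_betwI[where g = "(\<circ>) (inv q)"])
    show "(\<circ>) q \<in> ?S \<rightarrow> ?S" "(\<circ>) (inv q) \<in> ?S \<rightarrow> ?S"
      using q by (auto simp: permutes_compose permutes_inv)
  qed (simp_all add: o_assoc permutes_inv_o[OF q])
  have "(\<Sum>p\<in>?S. of_int (sign p) * u $ (i \<circ> p)) =
        (\<Sum>p\<in>?S. of_int (sign (q \<circ> p)) * u $ (i \<circ> (q \<circ> p)))"
    by (rule sum.reindex_bij_betw[OF bij, symmetric])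
  also have "\<dots> = of_int (sign q) * (\<Sum>p\<in>?S. of_int (sign p) * u $ (i \<circ> q \<circ> p))"
    by (simp add: sgn sum_distrib_left o_assoc mult.assoc)
  finally have e: "(\<Sum>p\<in>?S. of_int (sign p) * u $ (i \<circ> p)) =
    of_int (sign q) * (\<Sum>p\<in>?S. of_int (sign p) * u $ (i \<circ> q \<circ> p))" .
  have "of_int (sign q) * of_int (sign q) = (1 :: complex)"
    by (simp add: sign_def)
  then show "(antisymmetrizer *v u) $ (i \<circ> q) = of_int (sign q) * (antisymmetrizer *v u) $ i"
    by (simp add: antisymmetrizer_apply e mult.assoc[symmetric])
qed

lemma antisymmetrizer_id:
  fixes u :: "('n::finite, 'w::finite) tensor"
  assumes "u \<in> exterior_power"
  shows "antisymmetrizer *v u = u"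
proof -
  have sq: "of_int (sign p) * (of_int (sign p) * c) = (c :: complex)" for p :: "'w \<Rightarrow> 'w" and c
    by (simp add: sign_def)
  have "(\<Sum>p | p permutes (UNIV :: 'w set). of_int (sign p) * u $ (i \<circ> p)) =
      (\<Sum>p | p permutes (UNIV :: 'w set). u $ i)" for i
    using assms by (intro sum.cong) (auto simp: exterior_power_def sq)
  then show ?thesis
    by (simp add: vec_eq_iff antisymmetrizer_apply card_permutations[OF refl])
qed

lemma adjoint_antisymmetrizer:
  "adjoint_mat antisymmetrizer = (antisymmetrizer :: ('n::finite, 'w::finite) tensor_op)"
proof -
  let ?S = "{p. p permutes (UNIV :: 'w set)}"
  have bij: "bij_betw inv ?S ?S"
    by (rule bij_betwI[where g = inv]) (auto simp: permutes_inv permutes_inv_inv)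
  have "(\<Sum>p | p permutes (UNIV :: 'w set). if i = k \<circ> p then of_int (sign p) else (0 :: complex)) =
        (\<Sum>p | p permutes (UNIV :: 'w set). if k = i \<circ> p then of_int (sign p) else 0)"
    for i k :: "'w \<Rightarrow> 'n"
  proof (subst sum.reindex_bij_betw[OF bij, symmetric], rule sum.cong[OF refl])
    fix p assume "p \<in> {p. p permutes (UNIV :: 'w set)}"
    then have p: "p permutes UNIV" by simp
    then have "i = k \<circ> inv p \<longleftrightarrow> k = i \<circ> p"
      by (metis comp_assoc comp_id permutes_inv_o(1) permutes_inv_o(2))
    moreover have "sign (inv p) = sign p"
      using p by (simp add: sign_inverse permutes_imp_permutation)
    ultimately show "(if i = k \<circ> inv p then of_int (sign (inv p)) else (0 :: complex)) =
        (if k = i \<circ> p then of_int (sign p) else 0)" by simp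
  qed
  then show ?thesis
    by (simp add: vec_eq_iff adjoint_mat_def antisymmetrizer_def if_distrib cong: if_cong)
qed

lemma tensor_inner_mult_right:
  "tensor_inner u (A *v v) = tensor_inner (adjoint_mat A *v u) v"
proof -
  have "(\<Sum>x\<in>UNIV. \<Sum>y\<in>UNIV. cnj (u $ x) * (A $ x $ y * v $ y)) =
        (\<Sum>y\<in>UNIV. \<Sum>x\<in>UNIV. cnj (u $ x) * (A $ x $ y * v $ y))"
    by (rule sum.swap)
  then show ?thesis
    by (simp add: tensor_inner_def adjoint_mat_def matrix_vector_mult_def sum_distrib_left
        sum_distrib_right mult_ac)
qed

lemma ext_op_iff:
  fixes X :: "('n::finite, 'w::finite) tensor_op"
  shows "X \<in> ext_ops \<longleftrightarrow>
    (\<forall>u. X *v u \<in> exterior_power) \<and>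
    (\<forall>u. (\<forall>v\<in>exterior_power. tensor_inner v u = 0) \<longrightarrow> X *v u = 0)"
    (is "_ \<longleftrightarrow> ?R \<and> ?K")
proof
  let ?P = "antisymmetrizer :: ('n, 'w) tensor_op"
  have ker: "?P *v u = 0" if "\<forall>v\<in>exterior_power. tensor_inner v u = 0" for u
  proof -
    have "tensor_inner (?P *v u) (?P *v u) = tensor_inner (?P *v (?P *v u)) u"
      by (simp add: tensor_inner_mult_right adjoint_antisymmetrizer)
    also have "\<dots> = 0" using that antisymmetrizer_in by blast
    finally have "(\<Sum>i\<in>UNIV. complex_of_real ((cmod ((?P *v u) $ i))\<^sup>2)) = 0"
      by (simp add: tensor_inner_def complex_norm_square mult.commute del: of_real_power)
    then have "(\<Sum>i\<in>UNIV. (cmod ((?P *v u) $ i))\<^sup>2) = 0"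
      by (metis of_real_sum of_real_eq_0_iff)
    then show ?thesis by (simp add: sum_nonneg_eq_0_iff vec_eq_iff)
  qed
  {
    assume "X \<in> ext_ops"
    then have X: "X *v u = ?P *v (X *v (?P *v u))" for u
      by (metis (mono_tags, lifting) ext_ops_def matrix_vector_mul_assoc mem_Collect_eq)
    then show "?R \<and> ?K"
      by (metis X antisymmetrizer_in ker matrix_vector_mult_0_right)
  next
    assume R: "?R \<and> ?K"
    have "(?P ** X ** ?P) *v u = X *v u" for u
    proof -
      have "tensor_inner v (u - ?P *v u) = 0" if "v \<in> exterior_power" for v
      proof -
        have "tensor_inner v (?P *v u) = tensor_inner v u"
          using that by (simp add: tensor_inner_mult_right adjoint_antisymmetrizer antisymmetrizer_id)
        then show ?thesis
          by (simp add: tensor_inner_def algebra_simps sum_subtractf)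
      qed
      then have "X *v (u - ?P *v u) = 0" using R by blast
      then have "X *v (?P *v u) = X *v u" by (simp add: matrix_vector_mult_diff_distrib)
      then show ?thesis
        using R by (simp add: matrix_vector_mul_assoc[symmetric] antisymmetrizer_id)
    qed
    then show "X \<in> ext_ops" by (simp add: ext_ops_def matrix_eq)
  }
qed

end

theory Submission
  imports Defs
begin

text \<open>
  Write \<open>H = \<Lambda>\<^sup>w\<complex>\<^sup>n\<close> as the \<open>w\<close>-particle sector of a fermionic Fock space with annihilation
  operators \<open>a\<^sub>i\<close>. On operators put \<open>D X = \<Sum> a\<^sub>i X a\<^sub>i\<^sup>*\<close> and \<open>U X = \<Sum> a\<^sub>i\<^sup>* X a\<^sub>i\<close>. Then
  \<open>D U - U D = n - 2k\<close> on the operators of the \<open>k\<close>-particle sector, an \<open>sl\<^sub>2\<close>-relation. The space \<open>\<E>\<^sub>t\<close> is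
  spanned by the \<open>a\<^sub>I\<^sup>* a\<^sub>J\<close> with \<open>|I| = |J| = t\<close>, hence is the image of \<open>U\<^sup>w\<^sup>-\<^sup>t\<close>, and the layer
  \<open>\<V>\<^sub>j\<close> consists of the elements of \<open>\<E>\<^sub>j\<close> killed by \<open>D\<^sup>w\<^sup>-\<^sup>j\<^sup>+\<^sup>1\<close>; so \<open>U\<^sup>b D\<^sup>b\<close> acts on it by an explicit
  scalar \<open>\<psi>\<^sub>b(j)\<close>. The map \<open>U\<^sup>t D\<^sup>t\<close> has the Kraus operators \<open>a\<^sub>I\<^sup>* a\<^sub>J\<close>, while \<open>\<Sum> tr((a\<^sub>I\<^sup>* a\<^sub>J)\<^sup>* Y) a\<^sub>I\<^sup>* a\<^sub>J\<close>
  is a multiple of \<open>U\<^sup>w\<^sup>-\<^sup>t D\<^sup>w\<^sup>-\<^sup>t\<close>. Comparing the two expansions gives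
  \<open>\<Sum>\<^sub>k (t! / (w-t)!)\<^sup>2 \<psi>\<^sub>w\<^sub>-\<^sub>t(k) \<Phi>\<^sub>k = \<Sum>\<^sub>j \<psi>\<^sub>t(j) \<Pi>\<^sub>j\<close>, a triangular system which is inverted by a
  finite-difference identity. This needs \<open>2w \<le> n\<close>; otherwise exchange \<open>a\<^sub>i\<close> with \<open>a\<^sub>i\<^sup>*\<close>.
\<close>

section \<open>Matrices and the Hilbert--Schmidt inner product\<close>

text \<open>A family of operators A enters both
  \<open>X \<mapsto> \<Sum> A X A\<^sup>\<dagger>\<close> and
  \<open>Y \<mapsto> \<Sum> tr(A\<^sup>\<dagger> Y) A\<close> only through one tensor. So a
  redundant, non-orthogonal family may be traded for suitably weighted orthonormal bases of the
  layers as soon as the second maps agree. This is how spectral knowledge about powers of U and D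
  becomes knowledge about \<open>Phi\<close>. The bound 2w \<le> n makes the weights n - 2k positive
  for k < w. As U is the Hilbert-Schmidt adjoint of D, the map U D is positive semidefinite, so D U
  = U D + (n - 2k) is invertible and raising loses nothing below sector w. This keeps every layer up
  to w nonzero. For 2w > n the layers beyond n - w vanish, while the n - w holes satisfy the bound.
  The claim is an equivalence. Besides the formula it needs that no other numbers work, hence
  orthonormal bases of all layers and a nonzero element in each.\<close>

definition hadj :: "complex ^ 'a ^ 'b \<Rightarrow> complex ^ 'b ^ 'a"  ("(_\<^sup>\<dagger>)" [1000] 999) where
  "A\<^sup>\<dagger> = (\<chi> i j. cnj (A $ j $ i))"

text \<open>\<open>adjoint_mat\<close> is confined to square matrices, whereas the embedding of Fock
  space into the tensors is rectangular; hence the separate \<open>hadj\<close>.\<close>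

lemma adjoint_mat_eq_hadj: "adjoint_mat A = A\<^sup>\<dagger>"
  by (simp add: adjoint_mat_def hadj_def)

lemma hadj_simps [simp]:
  "(A\<^sup>\<dagger>)\<^sup>\<dagger> = A" "(A + B)\<^sup>\<dagger> = A\<^sup>\<dagger> + B\<^sup>\<dagger>" "(A - B)\<^sup>\<dagger> = A\<^sup>\<dagger> - B\<^sup>\<dagger>" "(- A)\<^sup>\<dagger> = - A\<^sup>\<dagger>" "0\<^sup>\<dagger> = 0"
  "(c *\<^sub>R A)\<^sup>\<dagger> = c *\<^sub>R A\<^sup>\<dagger>" "(sum f S)\<^sup>\<dagger> = (\<Sum>i\<in>S. (f i)\<^sup>\<dagger>)"
  "(mat 1)\<^sup>\<dagger> = mat 1"
  by (auto simp: hadj_def vec_eq_iff mat_def)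

lemma hadj_cscale [simp]: "(cscale c A)\<^sup>\<dagger> = cscale (cnj c) (A\<^sup>\<dagger>)"
  by (simp add: hadj_def cscale_def vec_eq_iff)

lemma hadj_mult [simp]: "(A ** B)\<^sup>\<dagger> = B\<^sup>\<dagger> ** A\<^sup>\<dagger>"
  by (simp add: hadj_def vec_eq_iff matrix_matrix_mult_def mult.commute)

lemma matrix_mult_0 [simp]: "A ** 0 = 0" "0 ** A = 0"
  by (simp_all add: vec_eq_iff matrix_matrix_mult_def)

lemma matrix_mult_uminus [simp]:
  fixes A :: "complex ^ 'b ^ 'c" and B :: "complex ^ 'a ^ 'b"
  shows "A ** (- B) = - (A ** B)" "(- A) ** B = - (A ** B)"
  by (simp_all add: vec_eq_iff matrix_matrix_mult_def sum_negf)

lemma matrix_mult_scaleR [simp]: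
  fixes A :: "complex ^ 'b ^ 'c" and B :: "complex ^ 'a ^ 'b"
  shows "A ** (c *\<^sub>R B) = c *\<^sub>R (A ** B)" "(c *\<^sub>R A) ** B = c *\<^sub>R (A ** B)"
  by (simp_all add: vec_eq_iff matrix_matrix_mult_def scaleR_sum_right)

lemma matrix_mult_distrib:
  fixes A :: "complex ^ 'b ^ 'c" and B :: "complex ^ 'a ^ 'b"
  shows "A ** (B + B') = A ** B + A ** B'" "(A + A') ** B = A ** B + A' ** B"
   "A ** (B - B') = A ** B - A ** B'" "(A - A') ** B = A ** B - A' ** B"
  by (simp_all add: vec_eq_iff matrix_matrix_mult_def algebra_simps sum.distrib sum_subtractf)

lemma matrix_mult_cscale [simp]:
  fixes A B :: "complex ^ 'b ^ 'b"
  shows "A ** cscale c B = cscale c (A ** B)" "cscale c A ** B = cscale c (A ** B)"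
  by (simp_all add: vec_eq_iff matrix_matrix_mult_def cscale_def sum_distrib_left mult_ac)

lemma conj_cscale:
  fixes A :: "complex ^ 'b ^ 'c"
  shows "A ** cscale c B ** C = cscale c (A ** B ** C)"
  by (simp add: vec_eq_iff matrix_matrix_mult_def cscale_def sum_distrib_left sum_distrib_right mult_ac)

lemma matrix_mult_sum:
  fixes A :: "complex ^ 'b ^ 'c"
  shows "A ** sum f S = (\<Sum>i\<in>S. A ** f i)"
  by (induction S rule: infinite_finite_induct) (simp_all add: matrix_mult_distrib)

lemma matrix_sum_mult:
  fixes A :: "complex ^ 'a ^ 'b"
  shows "sum f S ** A = (\<Sum>i\<in>S. f i ** A)"
  by (induction S rule: infinite_finite_induct) (simp_all add: matrix_mult_distrib)

lemma matrix_mult_assoc: "(A ** B) ** C = A ** (B ** C)"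
  for A :: "complex ^ 'b ^ 'c"
  by (simp add: matrix_mul_assoc)

lemma cscale_sum: "cscale c (sum f S) = (\<Sum>i\<in>S. cscale c (f i))"
  by (rule cmat.scale_sum_right)

lemma scaleR_cscale: "r *\<^sub>R X = cscale (of_real r) X"
  by (simp add: vec_eq_iff cscale_def) (simp add: scaleR_conv_of_real)

lemma cscale_uminus [simp]: "cscale c (- X) = - cscale c X"
  by (rule cmat.scale_minus_right)

lemma cscale_scaleR [simp]: "cscale c (r *\<^sub>R X) = r *\<^sub>R cscale c X"
  by (simp add: scaleR_cscale mult.commute)

lemma trace_mult_comm: "trace (A ** B) = trace (B ** A)"
  for A :: "complex ^ 'b ^ 'c"
proof -
  have "(\<Sum>i\<in>UNIV. \<Sum>k\<in>UNIV. A $ i $ k * B $ k $ i) = (\<Sum>k\<in>UNIV. \<Sum>i\<in>UNIV. A $ i $ k * B $ k $ i)"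
    by (rule sum.swap)
  then show ?thesis
    by (simp add: trace_def matrix_matrix_mult_def mult.commute)
qed

lemma trace_simps:
  fixes A B :: "complex ^ 'a ^ 'a"
  shows "trace (0 :: complex ^ 'a ^ 'a) = 0" "trace (A + B) = trace A + trace B" "trace (A - B) = trace A - trace B"
    "trace (cscale c A) = c * trace A" "trace (r *\<^sub>R A) = of_real r * trace A"
    "trace (sum f S) = (\<Sum>i\<in>S. trace (f i :: complex ^ 'a ^ 'a))" "trace (A\<^sup>\<dagger>) = cnj (trace A)"
proof -
  show "trace (sum f S) = (\<Sum>i\<in>S. trace (f i :: complex ^ 'a ^ 'a))"
    by (simp add: trace_def sum.swap[of _ S])
qed (auto simp: trace_def sum.distrib sum_subtractf cscale_def sum_distrib_left hadj_def scaleR_cscale)+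

lemma hs_inner_eq: "hs_inner X Y = trace (X\<^sup>\<dagger> ** Y)"
  by (simp add: hs_inner_def adjoint_mat_eq_hadj)

lemma hs_inner_entries: "hs_inner X Y = (\<Sum>i\<in>UNIV. \<Sum>j\<in>UNIV. cnj (X $ i $ j) * Y $ i $ j)"
proof -
  have "hs_inner X Y = (\<Sum>j\<in>UNIV. \<Sum>i\<in>UNIV. cnj (X $ i $ j) * Y $ i $ j)"
    by (simp add: hs_inner_eq trace_def hadj_def matrix_matrix_mult_def)
  then show ?thesis by (subst sum.swap)
qed

lemma hs_inner_simps [simp]:
  "hs_inner X (Y + Z) = hs_inner X Y + hs_inner X Z"
  "hs_inner X (Y - Z) = hs_inner X Y - hs_inner X Z"
  "hs_inner X (cscale c Y) = c * hs_inner X Y"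
  "hs_inner X (r *\<^sub>R Y) = of_real r * hs_inner X Y"
  "hs_inner X 0 = 0"
  "hs_inner X (sum f S) = (\<Sum>i\<in>S. hs_inner X (f i))"
  "hs_inner (X + Z) Y = hs_inner X Y + hs_inner Z Y"
  "hs_inner (X - Z) Y = hs_inner X Y - hs_inner Z Y"
  "hs_inner (cscale c X) Y = cnj c * hs_inner X Y"
  "hs_inner (r *\<^sub>R X) Y = of_real r * hs_inner X Y"
  "hs_inner 0 Y = 0"
  "hs_inner (sum g S) Y = (\<Sum>i\<in>S. hs_inner (g i) Y)"
  by (simp_all add: hs_inner_eq matrix_mult_distrib matrix_mult_sum matrix_sum_mult trace_simps)

lemma hs_inner_commute: "hs_inner Y X = cnj (hs_inner X Y)"
  by (simp add: hs_inner_entries mult.commute)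

lemma hs_inner_self: "hs_inner X X = of_real ((norm X)\<^sup>2)"
proof -
  have "(norm X)\<^sup>2 = (\<Sum>i\<in>UNIV. \<Sum>j\<in>UNIV. (cmod (X $ i $ j))\<^sup>2)"
    by (simp add: norm_vec_def L2_set_def real_sqrt_pow2 sum_nonneg)
  then show ?thesis
    by (simp add: hs_inner_entries complex_norm_square mult.commute del: of_real_power)
qed

lemma hs_inner_self_eq_0 [simp]: "hs_inner X X = 0 \<longleftrightarrow> X = 0"
  by (simp add: hs_inner_self)

lemma Re_hs_inner: "Re (hs_inner X Y) = X \<bullet> Y"
  by (simp add: hs_inner_entries inner_vec_def inner_complex_def)

text \<open>Cyclicity of the trace. Applied summand by summand it makes \<open>up\<close> and
  \<open>down\<close> adjoint to each other.\<close>

lemma hs_inner_conj: "hs_inner (A ** X ** B) Y = hs_inner X (A\<^sup>\<dagger> ** Y ** B\<^sup>\<dagger>)"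
proof -
  have "trace (B\<^sup>\<dagger> ** (X\<^sup>\<dagger> ** (A\<^sup>\<dagger> ** Y))) = trace ((X\<^sup>\<dagger> ** (A\<^sup>\<dagger> ** Y)) ** B\<^sup>\<dagger>)"
    by (rule trace_mult_comm)
  then show ?thesis by (simp add: hs_inner_eq matrix_mult_assoc)
qed

lemma hs_inner_span_0:
  assumes "\<And>Y. Y \<in> S \<Longrightarrow> hs_inner Y X = 0" "Y \<in> cmat.span S"
  shows "hs_inner Y X = 0"
  using assms(2) by (induction rule: cmat.span_induct_alt) (simp_all add: assms(1))

section \<open>Canonical anticommutation relations\<close>

text \<open>\<open>a i\<close> is the annihilation operator of mode \<open>i\<close>, \<open>Q k\<close> the projection onto the \<open>k\<close>-particle sector.\<close>

locale fermions =
  fixes a :: "'n::finite \<Rightarrow> complex ^ 'm::finite ^ 'm" and Q :: "nat \<Rightarrow> complex ^ 'm ^ 'm"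
  assumes anticomm: "a i ** a j = - (a j ** a i)"
    and car: "a i ** (a j)\<^sup>\<dagger> = (if i = j then mat 1 else 0) - (a j)\<^sup>\<dagger> ** a i"
    and Q_hadj [simp]: "(Q k)\<^sup>\<dagger> = Q k"
    and Q_idem [simp]: "Q k ** Q k = Q k"
    and lower: "a i ** Q (Suc k) = Q k ** a i"
    and lower_0: "a i ** Q 0 = 0"
    and number: "(\<Sum>i\<in>UNIV. (a i)\<^sup>\<dagger> ** a i) ** Q k = real k *\<^sub>R Q k"
    and vacuum: "Q 0 ** X ** Q 0 = cscale (trace (Q 0 ** X)) (Q 0)"
    and vacuum_neq_0: "Q 0 \<noteq> 0"
begin

section \<open>Words of annihilation operators, the raising and lowering maps, and sectors\<close>

definition word :: "'n list \<Rightarrow> complex ^ 'm ^ 'm" where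
  "word I = foldr (\<lambda>i A. a i ** A) I (mat 1)"

definition words :: "nat \<Rightarrow> 'n list set" where
  "words t = {I. length I = t}"

definition up :: "complex ^ 'm ^ 'm \<Rightarrow> complex ^ 'm ^ 'm" where
  "up X = (\<Sum>i\<in>UNIV. (a i)\<^sup>\<dagger> ** X ** a i)"

definition down :: "complex ^ 'm ^ 'm \<Rightarrow> complex ^ 'm ^ 'm" where
  "down X = (\<Sum>i\<in>UNIV. a i ** X ** (a i)\<^sup>\<dagger>)"

text \<open>Operators on the k-particle sector are kept as matrices on all of Fock space, extended
  by zero, so that \<open>up\<close> and \<open>down\<close> change the sector but not the
  type.\<close>

definition sec :: "nat \<Rightarrow> (complex ^ 'm ^ 'm) set" where
  "sec k = {X. Q k ** X = X \<and> X ** Q k = X}"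

lemma word_simps [simp]: "word [] = mat 1" "word (i # I) = a i ** word I"
  by (simp_all add: word_def)

lemma word_append: "word (I @ J) = word I ** word J"
  by (induction I) (simp_all add: matrix_mult_assoc)

lemma finite_words [simp]: "finite (words t)"
  using finite_lists_length_eq[of "UNIV :: 'n set" t] by (simp add: words_def)

lemma words_0: "words 0 = {[]}"
  by (auto simp: words_def)

lemma sum_words_Suc: "(\<Sum>I\<in>words (Suc t). f I) = (\<Sum>i\<in>UNIV. \<Sum>I\<in>words t. f (i # I))"
proof -
  have "bij_betw (\<lambda>(i, I). i # I) (UNIV \<times> words t) (words (Suc t))"
    by (auto simp: bij_betw_def inj_on_def words_def length_Suc_conv)
  from sum.reindex_bij_betw[OF this, of f] show ?thesis
    by (simp add: sum.cartesian_product case_prod_beta')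
qed

lemma up_linear:
  "up (X + Y) = up X + up Y" "up (X - Y) = up X - up Y" "up (cscale c X) = cscale c (up X)"
  "up (r *\<^sub>R X) = r *\<^sub>R up X" "up 0 = 0"
  by (simp_all add: up_def matrix_mult_distrib sum.distrib sum_subtractf cscale_sum scaleR_sum_right)

lemma up_sum: "up (sum f S) = (\<Sum>i\<in>S. up (f i))"
  by (induction S rule: infinite_finite_induct) (simp_all add: up_linear)

lemma down_linear:
  "down (X + Y) = down X + down Y" "down (X - Y) = down X - down Y"
  "down (cscale c X) = cscale c (down X)"
  "down (r *\<^sub>R X) = r *\<^sub>R down X" "down 0 = 0"
  by (simp_all add: down_def matrix_mult_distrib sum.distrib sum_subtractf cscale_sum scaleR_sum_right)

lemma up_pow_linear:
  "(up ^^ b) (X + Y) = (up ^^ b) X + (up ^^ b) Y" "(up ^^ b) (X - Y) = (up ^^ b) X - (up ^^ b) Y"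
  "(up ^^ b) (cscale c X) = cscale c ((up ^^ b) X)" "(up ^^ b) (r *\<^sub>R X) = r *\<^sub>R (up ^^ b) X"
  "(up ^^ b) 0 = 0" "(up ^^ b) (sum f S) = (\<Sum>i\<in>S. (up ^^ b) (f i))"
  by (induction b) (simp_all add: up_linear up_sum)

lemma down_pow_linear:
  "(down ^^ b) (X + Y) = (down ^^ b) X + (down ^^ b) Y"
  "(down ^^ b) (X - Y) = (down ^^ b) X - (down ^^ b) Y"
  "(down ^^ b) (r *\<^sub>R X) = r *\<^sub>R (down ^^ b) X"
  "(down ^^ b) 0 = 0"
  by (induction b) (simp_all add: down_linear)

lemma hs_inner_up: "hs_inner (up X) Y = hs_inner X (down Y)"
  by (simp add: up_def down_def hs_inner_conj)

lemma hs_inner_up_pow: "hs_inner ((up ^^ b) X) Y = hs_inner X ((down ^^ b) Y)"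
  by (induction b arbitrary: X) (simp_all add: hs_inner_up funpow_swap1[of up] funpow_swap1[of down])

lemma up_pow_words: "(up ^^ t) X = (\<Sum>I\<in>words t. (word I)\<^sup>\<dagger> ** X ** word I)"
proof (induction t arbitrary: X)
  case (Suc t)
  have "(up ^^ Suc t) X = (up ^^ t) (up X)"
    by (simp add: funpow_swap1)
  also have "\<dots> = (\<Sum>i\<in>UNIV. \<Sum>I\<in>words t. (word I)\<^sup>\<dagger> ** ((a i)\<^sup>\<dagger> ** X ** a i) ** word I)"
    unfolding Suc.IH up_def by (simp add: matrix_mult_sum matrix_sum_mult sum.swap[of _ "words t"])
  finally show ?case by (simp add: sum_words_Suc matrix_mult_assoc)
qed (simp add: words_0)

lemma down_pow_words: "(down ^^ t) X = (\<Sum>I\<in>words t. word I ** X ** (word I)\<^sup>\<dagger>)"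
proof (induction t)
  case (Suc t)
  then show ?case
    by (simp add: down_def sum_words_Suc matrix_mult_sum matrix_sum_mult matrix_mult_assoc)
qed (simp add: words_0)

lemma raise: "(a i)\<^sup>\<dagger> ** Q k = Q (Suc k) ** (a i)\<^sup>\<dagger>"
  using arg_cong[OF lower, of hadj i k] by simp

lemma raise_0: "Q 0 ** (a i)\<^sup>\<dagger> = 0"
  using arg_cong[OF lower_0, of hadj i] by simp

lemma word_lower: "word I ** Q (k + length I) = Q k ** word I"
proof (induction I arbitrary: k)
  case (Cons i I)
  show ?case using Cons.IH[of "Suc k"] lower[of i k]
    by (simp add: matrix_mult_assoc) (simp add: matrix_mul_assoc)
qed simp

lemma word_raise: "(word I)\<^sup>\<dagger> ** Q k = Q (k + length I) ** (word I)\<^sup>\<dagger>"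
  using arg_cong[OF word_lower, of hadj I k] by simp

lemma Q_sec [simp]: "Q k \<in> sec k"
  by (simp add: sec_def)

lemma sec_absorb:
  assumes "X \<in> sec k"
  shows "Q k ** X = X" "X ** Q k = X" "Q k ** (X ** Y) = X ** Y" "X ** (Q k ** Y) = X ** Y"
  using assms by (simp_all add: sec_def matrix_mul_assoc)

lemma lower_assoc: "a i ** (Q (Suc k) ** Y) = Q k ** (a i ** Y)"
  by (simp add: matrix_mul_assoc lower)

lemma raise_assoc: "(a i)\<^sup>\<dagger> ** (Q k ** Y) = Q (Suc k) ** ((a i)\<^sup>\<dagger> ** Y)"
  by (simp add: matrix_mul_assoc raise)

lemma up_sec:
  assumes "X \<in> sec k"
  shows "up X \<in> sec (Suc k)"
  by (simp add: sec_def up_def matrix_mult_sum matrix_sum_mult matrix_mult_assoc lower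
      raise_assoc[symmetric] sec_absorb[OF assms])

lemma down_sec:
  assumes "X \<in> sec (Suc k)"
  shows "down X \<in> sec k"
  by (simp add: sec_def down_def matrix_mult_sum matrix_sum_mult matrix_mult_assoc raise
      lower_assoc[symmetric] sec_absorb[OF assms])

lemma down_sec_0:
  assumes "X \<in> sec 0"
  shows "down X = 0"
proof -
  have "a i ** X = 0" for i
    using sec_absorb(1)[OF assms] lower_0[of i] matrix_mul_assoc[of "a i" "Q 0" X] by simp
  then show ?thesis by (simp add: down_def)
qed

lemma up_pow_sec: "X \<in> sec k \<Longrightarrow> (up ^^ b) X \<in> sec (k + b)"
  by (induction b) (simp_all add: up_sec)

lemma down_pow_sec: "X \<in> sec (k + b) \<Longrightarrow> (down ^^ b) X \<in> sec k"
  by (induction b arbitrary: k) (auto intro!: down_sec)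

lemma down_pow_sec_0: "X \<in> sec k \<Longrightarrow> k < b \<Longrightarrow> (down ^^ b) X = 0"
proof (induction b)
  case (Suc b)
  then show ?case
    using down_pow_sec[of X 0 b] by (cases "k = b") (auto simp: down_sec_0 down_linear)
qed simp

lemma sec_closed: "X \<in> sec k \<Longrightarrow> Y \<in> sec k \<Longrightarrow> X + Y \<in> sec k"
  "X \<in> sec k \<Longrightarrow> Y \<in> sec k \<Longrightarrow> X - Y \<in> sec k"
  "X \<in> sec k \<Longrightarrow> r *\<^sub>R X \<in> sec k" "X \<in> sec k \<Longrightarrow> cscale c X \<in> sec k" "0 \<in> sec k"
  by (simp_all add: sec_def matrix_mult_distrib)

section \<open>The commutator of lowering and raising\<close>

lemma down_up_gen:
  "down (up X) = up (down X) + real CARD('n) *\<^sub>R X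
     - (\<Sum>i\<in>UNIV. (a i)\<^sup>\<dagger> ** a i) ** X - X ** (\<Sum>i\<in>UNIV. (a i)\<^sup>\<dagger> ** a i)"
proof -
  \<comment> \<open>The anticommutation relation is used once on each side of X. The two signs
    cancel in the exchanged term; the deltas contribute X and the two number terms, only for i =
    k.\<close>
  have e: "a i ** ((a k)\<^sup>\<dagger> ** X ** a k) ** (a i)\<^sup>\<dagger> =
      (if i = k then X else 0) - (if i = k then (a i)\<^sup>\<dagger> ** a i ** X else 0)
      - (if i = k then X ** ((a i)\<^sup>\<dagger> ** a i) else 0)
      + (a k)\<^sup>\<dagger> ** (a i ** X ** (a i)\<^sup>\<dagger>) ** a k" for i k
  proof -
    have "a i ** ((a k)\<^sup>\<dagger> ** X ** a k) ** (a i)\<^sup>\<dagger> = (a i ** (a k)\<^sup>\<dagger>) ** X ** (a k ** (a i)\<^sup>\<dagger>)"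
      by (simp add: matrix_mul_assoc)
    also have "\<dots> = ((if i = k then mat 1 else 0) - (a k)\<^sup>\<dagger> ** a i) ** X **
        ((if i = k then mat 1 else 0) - (a i)\<^sup>\<dagger> ** a k)"
      by (simp add: car[of i k] car[of k i] eq_commute[of k i])
    finally show ?thesis
      by (auto simp: matrix_mult_distrib matrix_mult_assoc)
  qed
  have "down (up X) = (\<Sum>i\<in>UNIV. \<Sum>k\<in>UNIV. a i ** ((a k)\<^sup>\<dagger> ** X ** a k) ** (a i)\<^sup>\<dagger>)"
    by (simp add: down_def up_def matrix_mult_sum matrix_sum_mult)
  also have "\<dots> = (\<Sum>i\<in>(UNIV :: 'n set). X) - (\<Sum>i\<in>UNIV. (a i)\<^sup>\<dagger> ** a i ** X) - (\<Sum>i\<in>UNIV. X ** ((a i)\<^sup>\<dagger> ** a i))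
      + (\<Sum>i\<in>UNIV. \<Sum>k\<in>UNIV. (a k)\<^sup>\<dagger> ** (a i ** X ** (a i)\<^sup>\<dagger>) ** a k)"
    by (simp add: e sum.distrib sum_subtractf)
  also have "(\<Sum>i\<in>UNIV. \<Sum>k\<in>UNIV. (a k)\<^sup>\<dagger> ** (a i ** X ** (a i)\<^sup>\<dagger>) ** a k) = up (down X)"
    by (subst sum.swap) (simp add: down_def up_def matrix_mult_sum matrix_sum_mult)
  also have "(\<Sum>i\<in>(UNIV :: 'n set). X) = real CARD('n) *\<^sub>R X"
    by (rule sum_constant_scaleR)
  finally show ?thesis
    by (simp add: matrix_mult_sum matrix_sum_mult)
qed

lemma down_up:
  assumes "X \<in> sec k"
  shows "down (up X) = up (down X) + (real CARD('n) - 2 * real k) *\<^sub>R X"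
proof -
  have X: "Q k ** X = X" "X ** Q k = X" using assms by (auto simp: sec_def)
  let ?n = "\<Sum>i\<in>UNIV. (a i)\<^sup>\<dagger> ** a i"
  have "?n ** X = real k *\<^sub>R X"
    using arg_cong[OF number[of k], of "\<lambda>Y. Y ** X"] by (simp only: matrix_mult_assoc X matrix_mult_scaleR)
  \<comment> \<open>The number operator is Hermitian, so the adjoint of \<open>number\<close>
    evaluates it on the right of X.\<close>
  moreover have "?n\<^sup>\<dagger> = ?n" by simp
  then have "Q k ** ?n = real k *\<^sub>R Q k"
    using arg_cong[OF number[of k], of hadj] by (simp del: hadj_simps(7))
  then have "X ** ?n = real k *\<^sub>R X"
    using arg_cong[of _ _ "\<lambda>Y. X ** Y"] by (metis X(2) matrix_mul_assoc matrix_mult_scaleR(1))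
  ultimately show ?thesis
    by (simp add: down_up_gen scaleR_diff_left scaleR_2 flip: scaleR_scaleR)
qed

section \<open>Resolution of the identity and expansion into words\<close>

lemma up_Q: "up (Q k) = real (Suc k) *\<^sub>R Q (Suc k)"
proof -
  have "up (Q k) = (\<Sum>i\<in>UNIV. (a i)\<^sup>\<dagger> ** a i) ** Q (Suc k)"
    unfolding up_def matrix_sum_mult
    by (intro sum.cong refl) (simp add: matrix_mult_assoc lower)
  then show ?thesis by (simp only: number)
qed

lemma up_pow_Q: "(up ^^ b) (Q 0) = fact b *\<^sub>R Q b"
  by (induction b) (simp_all add: up_Q up_linear)

text \<open>Completeness of the states created from the vacuum by words of length t; dividing by t!
  removes the orderings of each set of modes.\<close>

lemma vacuum_resolution: "Q t = (1 / fact t) *\<^sub>R (\<Sum>I\<in>words t. (word I)\<^sup>\<dagger> ** Q 0 ** word I)"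
  using up_pow_Q[of t] by (simp add: up_pow_words)

text \<open>Moving one creation operator past another on the left and one annihilation operator past
  another on the right costs a sign each; the signs cancel.\<close>

lemma up_conj: "up ((a i)\<^sup>\<dagger> ** Z ** a j) = (a i)\<^sup>\<dagger> ** up Z ** a j"
proof -
  have "(a k)\<^sup>\<dagger> ** (a i)\<^sup>\<dagger> = - ((a i)\<^sup>\<dagger> ** (a k)\<^sup>\<dagger>)" for k
    using arg_cong[OF anticomm, of hadj i k] by simp
  then have "(a k)\<^sup>\<dagger> ** ((a i)\<^sup>\<dagger> ** Z ** a j) ** a k = (a i)\<^sup>\<dagger> ** ((a k)\<^sup>\<dagger> ** Z ** a k) ** a j" for k
    using anticomm[of j k] by (simp add: matrix_mul_assoc) (simp add: matrix_mult_assoc)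
  then show ?thesis by (simp add: up_def matrix_mult_sum matrix_sum_mult)
qed

lemma up_pow_conj: "(up ^^ b) ((a i)\<^sup>\<dagger> ** Z ** a j) = (a i)\<^sup>\<dagger> ** (up ^^ b) Z ** a j"
  by (induction b) (simp_all add: up_conj)

lemma up_pow_word_conj:
  assumes "length I = length J"
  shows "(up ^^ b) ((word I)\<^sup>\<dagger> ** Z ** word J) = (word I)\<^sup>\<dagger> ** (up ^^ b) Z ** word J"
  using assms
proof (induction I J arbitrary: Z rule: list_induct2)
  case (Cons i I j J)
  show ?case using Cons.IH[of "(a i)\<^sup>\<dagger> ** Z ** a j"]
    by (simp add: matrix_mult_assoc up_pow_conj[unfolded matrix_mult_assoc])
qed simp

text \<open>The resolution of the identity is inserted on both sides of Z. The vacuum projection has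
  rank one (\<open>vacuum\<close>), so the operator between two copies of it collapses to a
  trace.\<close>

lemma sec_expand:
  assumes "Z \<in> sec t"
  shows "Z = (1 / (fact t)\<^sup>2) *\<^sub>R (\<Sum>I\<in>words t. \<Sum>J\<in>words t.
    cscale (hs_inner ((word I)\<^sup>\<dagger> ** Q 0 ** word J) Z) ((word I)\<^sup>\<dagger> ** Q 0 ** word J))"
proof -
  have e: "((word I)\<^sup>\<dagger> ** Q 0 ** word I) ** Z ** ((word J)\<^sup>\<dagger> ** Q 0 ** word J) =
      cscale (hs_inner ((word I)\<^sup>\<dagger> ** Q 0 ** word J) Z) ((word I)\<^sup>\<dagger> ** Q 0 ** word J)" for I J
  proof -
    have "hs_inner ((word I)\<^sup>\<dagger> ** Q 0 ** word J) Z = trace (Q 0 ** (word I ** Z ** (word J)\<^sup>\<dagger>))"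
      using trace_mult_comm[of "(word J)\<^sup>\<dagger>" "Q 0 ** (word I ** Z)"]
      by (simp add: hs_inner_eq matrix_mult_assoc)
    moreover have "((word I)\<^sup>\<dagger> ** Q 0 ** word I) ** Z ** ((word J)\<^sup>\<dagger> ** Q 0 ** word J) =
      (word I)\<^sup>\<dagger> ** (Q 0 ** (word I ** Z ** (word J)\<^sup>\<dagger>) ** Q 0) ** word J"
      by (simp add: matrix_mult_assoc)
    ultimately show ?thesis by (simp add: vacuum)
  qed
  have "Z = Q t ** Z ** Q t" using assms by (simp add: sec_def)
  also have "\<dots> = (1 / fact t) *\<^sub>R ((1 / fact t) *\<^sub>R (\<Sum>J\<in>words t. \<Sum>I\<in>words t.
      ((word I)\<^sup>\<dagger> ** Q 0 ** word I) ** Z ** ((word J)\<^sup>\<dagger> ** Q 0 ** word J)))"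
    unfolding vacuum_resolution[of t] by (simp only: matrix_mult_scaleR matrix_mult_sum matrix_sum_mult flip: scaleR_sum_right)
  also have "(\<Sum>J\<in>words t. \<Sum>I\<in>words t. ((word I)\<^sup>\<dagger> ** Q 0 ** word I) ** Z ** ((word J)\<^sup>\<dagger> ** Q 0 ** word J)) =
      (\<Sum>I\<in>words t. \<Sum>J\<in>words t. ((word I)\<^sup>\<dagger> ** Q 0 ** word I) ** Z ** ((word J)\<^sup>\<dagger> ** Q 0 ** word J))"
    by (rule sum.swap)
  finally show ?thesis by (simp add: e power2_eq_square)
qed

lemma word_Q_word:
  assumes "length J = t"
  shows "(word I)\<^sup>\<dagger> ** Q b ** word J = (word I)\<^sup>\<dagger> ** word J ** Q (b + t)"
  using word_lower[of J b] assms by (simp add: matrix_mult_assoc)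

text \<open>Raising the matrix unit built on the vacuum replaces \<open>Q 0\<close> by b! times
  \<open>Q b\<close>, that is, it gives b! times a t-body operator on the sector with t + b
  particles. Hence the image of raising consists of t-body operators.\<close>

lemma up_pow_expand:
  assumes "Z \<in> sec t"
  shows "(up ^^ b) Z = (fact b / (fact t)\<^sup>2) *\<^sub>R (\<Sum>I\<in>words t. \<Sum>J\<in>words t.
    cscale (hs_inner ((word I)\<^sup>\<dagger> ** Q 0 ** word J) Z) ((word I)\<^sup>\<dagger> ** word J ** Q (t + b)))"
proof -
  have e: "(up ^^ b) ((word I)\<^sup>\<dagger> ** Q 0 ** word J) = fact b *\<^sub>R ((word I)\<^sup>\<dagger> ** word J ** Q (t + b))"
    if "I \<in> words t" "J \<in> words t" for I J
    using that up_pow_word_conj[of I J b "Q 0"] word_Q_word[of J t I b]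
    by (simp add: words_def up_pow_Q add.commute)
  show ?thesis
    by (subst sec_expand[OF assms])
       (simp add: up_pow_linear e scaleR_sum_right cong: sum.cong)
qed

text \<open>The exchange of the roles of \<open>X\<close> and of the Kraus operators turns \<open>up\<^sup>t down\<^sup>t\<close>
  into a multiple of \<open>up\<^sup>b down\<^sup>b\<close> on the sector with \<open>t + b\<close> particles.\<close>

lemma up_down_pow_expand:
  assumes "Y \<in> sec (t + b)"
  shows "(up ^^ b) ((down ^^ b) Y) = (fact b / fact t)\<^sup>2 *\<^sub>R (\<Sum>I\<in>words t. \<Sum>J\<in>words t.
    cscale (hs_inner ((word I)\<^sup>\<dagger> ** word J ** Q (t + b)) Y) ((word I)\<^sup>\<dagger> ** word J ** Q (t + b)))"
proof -
  \<comment> \<open>Adjointness moves the lowering from Y to the matrix unit. This produces a second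
    b!, hence the square in the claim.\<close>
  have e: "hs_inner ((word I)\<^sup>\<dagger> ** Q 0 ** word J) ((down ^^ b) Y) =
      fact b * hs_inner ((word I)\<^sup>\<dagger> ** word J ** Q (t + b)) Y"
    if "I \<in> words t" "J \<in> words t" for I J
    using that up_pow_word_conj[of I J b "Q 0"] word_Q_word[of J t I b]
    unfolding hs_inner_up_pow[symmetric]
    by (simp add: words_def up_pow_Q add.commute)
  have e': "cscale (fact b * c) X = fact b *\<^sub>R cscale c X" for c and X :: "complex ^ 'm ^ 'm"
    by (simp add: scaleR_cscale)
  have "(down ^^ b) Y \<in> sec t" by (rule down_pow_sec[OF assms])
  from up_pow_expand[OF this, of b] show ?thesis
    by (simp add: e e' power2_eq_square flip: scaleR_sum_right cong: sum.cong)
qed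

section \<open>Ladder identities and the eigenvalues of U D\<close>

lemma down_pow_up:
  assumes "X \<in> sec k" "b \<le> k"
  shows "(down ^^ Suc b) (up X) = up ((down ^^ Suc b) X)
    + (real (Suc b) * (real CARD('n) - 2 * real k + real b)) *\<^sub>R (down ^^ b) X"
  using assms(2)
proof (induction b)
  case 0
  then show ?case using down_up[OF assms(1)] by simp
next
  case (Suc b)
  have "(down ^^ Suc b) X \<in> sec (k - Suc b)"
    using assms(1) Suc.prems by (intro down_pow_sec) simp
  note * = down_up[OF this]
  have "(down ^^ Suc (Suc b)) (up X) = down (up ((down ^^ Suc b) X))
     + (real (Suc b) * (real CARD('n) - 2 * real k + real b)) *\<^sub>R (down ^^ Suc b) X"
    using Suc by (simp add: down_linear)
  also have "\<dots> = up ((down ^^ Suc (Suc b)) X) + ((real CARD('n) - 2 * real (k - Suc b)) +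
      real (Suc b) * (real CARD('n) - 2 * real k + real b)) *\<^sub>R (down ^^ Suc b) X"
    by (simp only: * scaleR_add_left) simp
  \<comment> \<open>Summing the weights n - 2(k - i) over i = 0..b is an arithmetic
    progression.\<close>
  also have "(real CARD('n) - 2 * real (k - Suc b)) + real (Suc b) * (real CARD('n) - 2 * real k + real b) =
     real (Suc (Suc b)) * (real CARD('n) - 2 * real k + real (Suc b))"
    using Suc.prems by (simp add: of_nat_diff algebra_simps)
  finally show ?case .
qed

text \<open>Read as a recursion in b, this makes U^b D^b a polynomial in U D on the sector, so an
  eigenvector of U D is an eigenvector of each of them.\<close>

lemma up_down_pow_Suc:
  assumes "X \<in> sec k" "b \<le> k"
  shows "(up ^^ Suc b) ((down ^^ Suc b) X) = (up ^^ b) ((down ^^ b) (up (down X)))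
    - (real b * (real CARD('n) - 2 * real k + real b + 1)) *\<^sub>R (up ^^ b) ((down ^^ b) X)"
proof (cases b)
  case (Suc c)
  then obtain l where k: "k = Suc l" using assms(2) by (cases k) auto
  have "down X \<in> sec l" using assms(1) k by (auto intro: down_sec)
  from down_pow_up[OF this, of c] have "(down ^^ b) (up (down X)) = up ((down ^^ Suc b) X)
     + (real b * (real CARD('n) - 2 * real k + real b + 1)) *\<^sub>R (down ^^ b) X"
    using assms(2) Suc k by (simp add: funpow_swap1 algebra_simps)
  then show ?thesis by (simp add: up_pow_linear funpow_swap1 del: funpow.simps(2)) (simp add: funpow_swap1)
qed simp

text \<open>U D U = U (U D + c) with a scalar c on each sector, so the image of U^b is stable under
  U D.\<close>

lemma up_down_image:
  assumes "Z \<in> sec j"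
  shows "\<exists>Z'\<in>sec j. up (down ((up ^^ b) Z)) = (up ^^ b) Z'"
proof (induction b)
  case 0
  show ?case
  proof (cases j)
    case 0
    then show ?thesis using assms by (auto simp: down_sec_0 up_linear intro!: bexI[of _ 0] sec_closed)
  next
    case (Suc l)
    then show ?thesis using assms by (auto intro!: up_sec down_sec)
  qed
next
  case (Suc b)
  then obtain Z' where Z': "Z' \<in> sec j" "up (down ((up ^^ b) Z)) = (up ^^ b) Z'" by blast
  let ?c = "real CARD('n) - 2 * real (j + b)"
  have "up (down ((up ^^ Suc b) Z)) = up ((up ^^ b) Z' + ?c *\<^sub>R (up ^^ b) Z)"
    using down_up[OF up_pow_sec[OF assms, of b]] Z'(2) by simp
  also have "\<dots> = (up ^^ Suc b) (Z' + ?c *\<^sub>R Z)"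
    by (simp add: up_pow_linear)
  finally show ?case using Z'(1) assms by (blast intro: sec_closed)
qed

text \<open>The defect Y = U D X - c X lies in the image of U^b, and the commutator of D^b with U
  shows that D^b kills it for exactly this c. By adjointness Y is orthogonal to itself. Being in the
  image of a raising and killed by one lowering too many thus forces an eigenvector.\<close>

lemma up_down_eigen:
  assumes "Z \<in> sec j" "X = (up ^^ b) Z" "(down ^^ Suc b) X = 0"
  shows "up (down X) = (real b * (real CARD('n) - 2 * real j - real b + 1)) *\<^sub>R X"
proof -
  let ?l = "real b * (real CARD('n) - 2 * real j - real b + 1)"
  let ?Y = "up (down X) - ?l *\<^sub>R X"
  have X: "X \<in> sec (j + b)" using assms by (simp add: up_pow_sec)
  obtain Z' where Z': "Z' \<in> sec j" "up (down X) = (up ^^ b) Z'"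
    using up_down_image[OF assms(1), of b] assms(2) by auto
  have Y: "?Y = (up ^^ b) (Z' - ?l *\<^sub>R Z)"
    using Z'(2) assms(2) by (simp add: up_pow_linear)
  have "(down ^^ b) ?Y = 0"
  proof (cases b)
    case (Suc c)
    have "down X \<in> sec (j + c)" using X Suc by (auto intro: down_sec)
    from down_pow_up[OF this, of c] have "(down ^^ b) (up (down X)) = up ((down ^^ Suc b) X)
       + (real b * (real CARD('n) - 2 * real (j + c) + real c)) *\<^sub>R (down ^^ b) X"
      using Suc by (simp add: funpow_swap1)
    then show ?thesis using Suc assms(3) by (simp add: down_pow_linear up_linear algebra_simps del: funpow.simps)
  qed (use assms in \<open>simp add: up_linear\<close>)
  then have "hs_inner ?Y ?Y = 0"
    by (subst (1) Y) (simp only: hs_inner_up_pow hs_inner_simps(5))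
  then show ?thesis by (simp only: hs_inner_self_eq_0 eq_iff_diff_eq_0[symmetric])
qed

section \<open>Second quantization of one-particle matrices, and states created from the
  vacuum\<close>

definition second_quant :: "complex ^ 'n ^ 'n \<Rightarrow> complex ^ 'm ^ 'm" where
  "second_quant A = (\<Sum>i\<in>UNIV. \<Sum>k\<in>UNIV. cscale (A $ i $ k) ((a i)\<^sup>\<dagger> ** a k))"

lemma a_second_quant: "a j ** second_quant A = second_quant A ** a j + (\<Sum>c\<in>UNIV. cscale (A $ j $ c) (a c))"
proof -
  have e: "a j ** ((a i)\<^sup>\<dagger> ** a k) = (if i = j then a k else 0) + (a i)\<^sup>\<dagger> ** a k ** a j" for i k
  proof -
    have "a j ** ((a i)\<^sup>\<dagger> ** a k) = (a j ** (a i)\<^sup>\<dagger>) ** a k" by (simp add: matrix_mult_assoc)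
    also have "\<dots> = (if i = j then a k else 0) - (a i)\<^sup>\<dagger> ** (a j ** a k)"
      by (auto simp: car matrix_mult_distrib matrix_mult_assoc)
    finally show ?thesis by (subst (asm) anticomm) (simp add: matrix_mult_assoc)
  qed
  have e': "cscale (A $ i $ k) (a j ** ((a i)\<^sup>\<dagger> ** a k)) =
      (if i = j then cscale (A $ i $ k) (a k) else 0) + cscale (A $ i $ k) ((a i)\<^sup>\<dagger> ** a k ** a j)" for i k
    by (simp add: e cmat.scale_right_distrib)
  have "a j ** second_quant A = (\<Sum>i\<in>UNIV. \<Sum>k\<in>UNIV. (if i = j then cscale (A $ i $ k) (a k) else 0)) + second_quant A ** a j"
    by (simp add: second_quant_def matrix_mult_sum matrix_sum_mult e' sum.distrib)
  also have "(\<Sum>i\<in>UNIV. \<Sum>k\<in>UNIV. (if i = j then cscale (A $ i $ k) (a k) else 0)) =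
      (\<Sum>i\<in>UNIV. (if i = j then \<Sum>k\<in>UNIV. cscale (A $ i $ k) (a k) else 0))"
    by (intro sum.cong) auto
  finally show ?thesis by simp
qed

text \<open>Leibniz rule: the commutator acts on one letter at a time, which is the action of A on
  one tensor factor at a time.\<close>

lemma word_second_quant:
  "word I ** second_quant A = second_quant A ** word I
     + (\<Sum>l<length I. \<Sum>c\<in>UNIV. cscale (A $ (I ! l) $ c) (word (I[l := c])))"
proof (induction I)
  case (Cons i I)
  have "word (i # I) ** second_quant A = (a i ** second_quant A) ** word I
     + (\<Sum>l<length I. \<Sum>c\<in>UNIV. cscale (A $ (I ! l) $ c) (a i ** word (I[l := c])))"
    by (simp add: matrix_mult_assoc Cons.IH matrix_mult_distrib matrix_mult_sum)
  then show ?case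
    by (simp add: a_second_quant matrix_mult_distrib matrix_sum_mult matrix_mult_assoc sum.lessThan_Suc_shift
        del: sum.lessThan_Suc)
qed simp

lemma a_word_vacuum: "i \<notin> set I \<Longrightarrow> a i ** ((word I)\<^sup>\<dagger> ** Q 0) = 0"
proof (induction I rule: rev_induct)
  case (snoc j I)
  have "a i ** ((word (I @ [j]))\<^sup>\<dagger> ** Q 0) = (a i ** (a j)\<^sup>\<dagger>) ** ((word I)\<^sup>\<dagger> ** Q 0)"
    by (simp add: word_append matrix_mult_assoc)
  also have "\<dots> = 0" using snoc by (simp add: car matrix_mult_assoc)
  finally show ?case .
qed (simp add: lower_0)

lemma word_word_vacuum: "distinct I \<Longrightarrow> word I ** ((word I)\<^sup>\<dagger> ** Q 0) = Q 0"
proof (induction I rule: rev_induct)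
  case (snoc j I)
  have "word (I @ [j]) ** ((word (I @ [j]))\<^sup>\<dagger> ** Q 0) =
      word I ** ((a j ** (a j)\<^sup>\<dagger>) ** ((word I)\<^sup>\<dagger> ** Q 0))"
    by (simp add: word_append matrix_mult_assoc)
  also have "\<dots> = Q 0"
    using snoc by (simp add: car matrix_mult_distrib matrix_mult_assoc a_word_vacuum)
  finally show ?case .
qed simp

end

section \<open>The quantum metric in terms of fermions\<close>

lemma span_mult:
  assumes "X \<in> cmat.span A" "Y \<in> cmat.span B"
    and "\<And>x y. x \<in> A \<Longrightarrow> y \<in> B \<Longrightarrow> x ** y \<in> cmat.span C"
  shows "X ** Y \<in> cmat.span C"
proof -
  have 1: "x ** Y \<in> cmat.span C" if "x \<in> A" for x
    using assms(2)
    by (induction rule: cmat.span_induct_alt)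
       (auto simp: cmat.span_zero matrix_mult_distrib intro!: cmat.span_add cmat.span_scale assms(3)[OF that])
  show ?thesis using assms(1)
    by (induction rule: cmat.span_induct_alt)
       (auto simp: cmat.span_zero matrix_mult_distrib intro!: cmat.span_add cmat.span_scale 1)
qed

lemma products_0: "products 0 S = {ext_id}"
  by (auto simp: products_def)

lemma products_Suc: "products (Suc m) S = {X ** Y | X Y. X \<in> S \<and> Y \<in> products m S}"
proof -
  have "(\<exists>Xs. Z = foldr (**) Xs ext_id \<and> length Xs = Suc m \<and> set Xs \<subseteq> S) \<longleftrightarrow>
     (\<exists>X Xs. Z = X ** foldr (**) Xs ext_id \<and> X \<in> S \<and> length Xs = m \<and> set Xs \<subseteq> S)" for Z
    by (force simp: length_Suc_conv)
  then show ?thesis unfolding products_def by blast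
qed

lemma ext_metric_of_nat: "ext_metric (real t) = cmat.span (products t error_space)"
  by (cases t) (simp_all add: ext_metric_def products_0 del: of_nat_Suc)

lemma ext_ops_subspace: "cmat.subspace ext_ops"
  by (auto simp: cmat.subspace_def ext_ops_def matrix_mult_distrib)

lemma metric_layer_subspace: "cmat.subspace (metric_layer t)"
proof -
  have "cmat.subspace (hs_complement S)" for S :: "('n::finite, 'w::finite) tensor_op set"
    using ext_ops_subspace by (auto simp: cmat.subspace_def hs_complement_def)
  then show ?thesis
    by (auto simp: metric_layer_def ext_metric_def intro!: cmat.subspace_inter)
qed

lemma metric_layer_eq:
  assumes "j > 0"
  shows "metric_layer j = ext_metric (real j) \<inter> hs_complement (ext_metric (real (j - 1)))"
  using assms by (simp add: metric_layer_def of_nat_diff)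

text \<open>In the particle-hole dual instance \<open>w\<close> is not the number of tensor factors but \<open>n\<close> minus it;
  this is why it is a parameter independent of \<open>'v\<close>.\<close>

locale ext_fermions = fermions a Q
  for a :: "'n::finite \<Rightarrow> complex ^ 'm::finite ^ 'm" and Q :: "nat \<Rightarrow> complex ^ 'm ^ 'm" +
  fixes T :: "complex ^ 'm ^ ('v::finite \<Rightarrow> 'n)" and w :: nat
  assumes T_hadj: "T ** T\<^sup>\<dagger> = ext_id"
    and hadj_T: "T\<^sup>\<dagger> ** T = Q w"
    and T_Q: "T ** Q w = T"
    and error_space: "error_space = cmat.span (insert ext_id {T ** ((a i)\<^sup>\<dagger> ** a j) ** T\<^sup>\<dagger> | i j. True})"
    and w_pos: "1 \<le> w" and w_le: "2 * w \<le> CARD('n)"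
begin

section \<open>Transport between Fock space and the exterior power\<close>

definition lift :: "complex ^ 'm ^ 'm \<Rightarrow> ('n, 'v) tensor_op" where
  "lift X = T ** X ** T\<^sup>\<dagger>"

text \<open>The Hilbert-Schmidt adjoint of \<open>lift\<close>; the two are mutually inverse between
  \<open>sec w\<close> and \<open>ext_ops\<close>.\<close>

definition compress :: "('n, 'v) tensor_op \<Rightarrow> complex ^ 'm ^ 'm" where
  "compress X = T\<^sup>\<dagger> ** X ** T"

definition hop :: "'n list \<Rightarrow> 'n list \<Rightarrow> ('n, 'v) tensor_op" where
  "hop I J = lift ((word I)\<^sup>\<dagger> ** word J)"

definition hops :: "nat \<Rightarrow> ('n, 'v) tensor_op set" where
  "hops t = {hop I J | I J. I \<in> words t \<and> J \<in> words t}"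

definition raised :: "nat \<Rightarrow> ('n, 'v) tensor_op set" where
  "raised t = {lift ((up ^^ (w - t)) Z) | Z. Z \<in> sec t}"

lemma hop_in_hops: "length I = t \<Longrightarrow> length J = t \<Longrightarrow> hop I J \<in> hops t"
  by (auto simp: hops_def words_def)

lemma raisedI: "Z \<in> sec t \<Longrightarrow> lift ((up ^^ (w - t)) Z) \<in> raised t"
  by (auto simp: raised_def)

lemma Q_hadj_T: "Q w ** T\<^sup>\<dagger> = T\<^sup>\<dagger>"
  using arg_cong[OF T_Q, of hadj] by simp

lemma T_absorb: "T ** (Q w ** X) = T ** X" "Q w ** (T\<^sup>\<dagger> ** Y) = T\<^sup>\<dagger> ** Y" "T\<^sup>\<dagger> ** (T ** X) = Q w ** X"
  by (simp_all add: matrix_mul_assoc T_Q Q_hadj_T hadj_T)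

lemma compress_sec: "compress X \<in> sec w"
  by (simp add: compress_def sec_def matrix_mult_assoc T_absorb T_Q)

lemma lift_compress: "lift (compress X) = ext_id ** X ** ext_id"
  by (simp add: lift_def compress_def T_hadj[symmetric] matrix_mult_assoc)

lemma compress_lift: "compress (lift X) = Q w ** X ** Q w"
  by (simp add: lift_def compress_def hadj_T[symmetric] matrix_mult_assoc)

lemma compress_lift_sec: "X \<in> sec w \<Longrightarrow> compress (lift X) = X"
  by (simp add: compress_lift sec_def)

lemma ext_id_T: "ext_id ** T = T"
  by (simp add: T_hadj[symmetric] matrix_mult_assoc hadj_T T_Q)

lemma hadj_T_ext_id: "T\<^sup>\<dagger> ** ext_id = T\<^sup>\<dagger>"
  by (simp add: T_hadj[symmetric] T_absorb Q_hadj_T)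

lemma lift_ext_ops [simp]: "lift X \<in> ext_ops"
  by (simp add: ext_ops_def lift_def matrix_mult_assoc hadj_T_ext_id)
     (simp add: matrix_mul_assoc ext_id_T)

lemma lift_Q: "lift (Q w) = ext_id"
  by (simp add: lift_def T_Q T_hadj)

lemma lift_linear:
  "lift (X + Y) = lift X + lift Y" "lift (X - Y) = lift X - lift Y" "lift (r *\<^sub>R X) = r *\<^sub>R lift X"
  "lift (sum f S) = (\<Sum>i\<in>S. lift (f i))" "lift 0 = 0"
  by (simp_all add: lift_def matrix_mult_distrib matrix_mult_sum matrix_sum_mult)

lemma lift_cscale: "lift (cscale c X) = cscale c (lift X)"
  by (simp add: lift_def conj_cscale)

lemma compress_linear:
  "compress (X + Y) = compress X + compress Y" "compress (r *\<^sub>R X) = r *\<^sub>R compress X"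
  "compress (sum f S) = (\<Sum>i\<in>S. compress (f i))"
  by (simp_all add: compress_def matrix_mult_distrib matrix_mult_sum matrix_sum_mult)

lemma hs_inner_lift: "hs_inner (lift X) Y = hs_inner X (compress Y)"
  by (simp add: lift_def compress_def hs_inner_conj)

lemma lift_Q_right: "lift (X ** Q w) = lift X"
  by (simp add: lift_def matrix_mult_assoc Q_hadj_T)

text \<open>The product puts \<open>Q w\<close> between the two factors. A pair of words of equal
  length preserves the particle number, so this projection is absorbed by the outer
  \<open>T\<^sup>\<dagger>\<close>; words longer than w make both sides vanish.\<close>

lemma lift_mult:
  assumes "length I = length J"
  shows "lift X ** hop I J = lift (X ** ((word I)\<^sup>\<dagger> ** word J))"
proof (cases "length J \<le> w")
  case True
  have "Q w ** (word I)\<^sup>\<dagger> = (word I)\<^sup>\<dagger> ** Q (w - length J)"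
    using word_raise[of I "w - length J"] True assms by simp
  moreover have "Q (w - length J) ** word J = word J ** Q w"
    using word_lower[of J "w - length J"] True by simp
  ultimately have "Q w ** ((word I)\<^sup>\<dagger> ** word J) = (word I)\<^sup>\<dagger> ** word J ** Q w"
    by (metis matrix_mul_assoc)
  then have "Q w ** ((word I)\<^sup>\<dagger> ** (word J ** T\<^sup>\<dagger>)) = (word I)\<^sup>\<dagger> ** (word J ** T\<^sup>\<dagger>)"
    by (metis matrix_mul_assoc Q_hadj_T)
  then show ?thesis
    by (simp add: hop_def lift_def matrix_mult_assoc T_absorb)
next
  case False
  \<comment> \<open>The last w + 1 letters already annihilate sector w: w of them reach the vacuum
    and the remaining one kills it.\<close>
  have "word J ** T\<^sup>\<dagger> = 0"
  proof -
    obtain J1 J2 where J: "J = J1 @ J2" "length J2 = Suc w"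
      using False by (intro that[of "take (length J - Suc w) J" "drop (length J - Suc w) J"]) auto
    obtain j J3 where J2: "J2 = j # J3" "length J3 = w" using J(2) by (cases J2) auto
    have "word J2 ** Q w = 0"
      using word_lower[of J3 0] J2 by (simp add: matrix_mult_assoc) (simp add: matrix_mul_assoc lower_0)
    then show ?thesis
      by (subst Q_hadj_T[symmetric]) (simp add: J(1) word_append matrix_mult_assoc, simp add: matrix_mul_assoc)
  qed
  then show ?thesis by (simp add: hop_def lift_def matrix_mult_assoc)
qed

section \<open>The filtration by t-body operators\<close>

lemma raised_subspace: "cmat.subspace (raised t)"
  unfolding cmat.subspace_def
proof (intro conjI ballI allI)
  show "0 \<in> raised t"
    using raisedI[OF sec_closed(5)] by (simp add: up_pow_linear lift_linear)
next
  fix X Y assume "X \<in> raised t" "Y \<in> raised t"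
  then obtain Z Z' where "Z \<in> sec t" "Z' \<in> sec t" "X = lift ((up ^^ (w - t)) Z)" "Y = lift ((up ^^ (w - t)) Z')"
    by (auto simp: raised_def)
  then have "Z + Z' \<in> sec t" "X + Y = lift ((up ^^ (w - t)) (Z + Z'))"
    by (simp_all add: sec_closed up_pow_linear lift_linear)
  then show "X + Y \<in> raised t" by (auto simp: raised_def)
next
  fix c X assume "X \<in> raised t"
  then obtain Z where "Z \<in> sec t" "X = lift ((up ^^ (w - t)) Z)"
    by (auto simp: raised_def)
  then have "cscale c Z \<in> sec t" "cscale c X = lift ((up ^^ (w - t)) (cscale c Z))"
    by (simp_all add: sec_closed up_pow_linear lift_cscale)
  then show "cscale c X \<in> raised t" by (auto simp: raised_def)
qed

lemma word_vacuum_sec: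
  assumes "I \<in> words t" "J \<in> words t"
  shows "(word I)\<^sup>\<dagger> ** Q 0 ** word J \<in> sec t"
proof -
  have 1: "Q t ** (word I)\<^sup>\<dagger> = (word I)\<^sup>\<dagger> ** Q 0" and 2: "word J ** Q t = Q 0 ** word J"
    using assms word_raise[of I 0] word_lower[of J 0] by (simp_all add: words_def)
  have "Q t ** ((word I)\<^sup>\<dagger> ** Q 0 ** word J) = (Q t ** (word I)\<^sup>\<dagger>) ** Q 0 ** word J"
    by (simp only: matrix_mul_assoc)
  also have "\<dots> = (word I)\<^sup>\<dagger> ** (Q 0 ** Q 0) ** word J"
    unfolding 1 by (simp only: matrix_mul_assoc)
  finally show ?thesis by (simp add: sec_def matrix_mult_assoc 2) (simp add: matrix_mul_assoc)
qed

lemma hop_eq_raised: 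
  assumes "I \<in> words t" "J \<in> words t" "t \<le> w"
  shows "hop I J = lift ((up ^^ (w - t)) ((1 / fact (w - t)) *\<^sub>R ((word I)\<^sup>\<dagger> ** Q 0 ** word J)))"
  using assms up_pow_word_conj[of I J "w - t" "Q 0"] word_Q_word[of J t I "w - t"]
  by (simp add: words_def up_pow_linear up_pow_Q hop_def lift_linear lift_Q_right)

lemma span_hops:
  assumes "t \<le> w"
  shows "cmat.span (hops t) = raised t"
proof
  show "cmat.span (hops t) \<subseteq> raised t"
  proof (rule cmat.span_minimal[OF _ raised_subspace], rule subsetI)
    fix X assume "X \<in> hops t"
    then obtain I J where IJ: "I \<in> words t" "J \<in> words t" "X = hop I J" by (auto simp: hops_def)
    then show "X \<in> raised t"
      unfolding raised_def using hop_eq_raised[OF IJ(1,2) assms] sec_closed(3)[OF word_vacuum_sec[OF IJ(1,2)]]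
      by blast
  qed
  show "raised t \<subseteq> cmat.span (hops t)"
  proof
    fix X assume "X \<in> raised t"
    then obtain Z where Z: "Z \<in> sec t" "X = lift ((up ^^ (w - t)) Z)" by (auto simp: raised_def)
    have "X = cscale (of_real (fact (w - t) / (fact t)\<^sup>2)) (\<Sum>I\<in>words t. \<Sum>J\<in>words t.
      cscale (hs_inner ((word I)\<^sup>\<dagger> ** Q 0 ** word J) Z) (hop I J))"
      using up_pow_expand[OF Z(1), of "w - t"] assms
      by (simp add: Z(2) lift_linear lift_cscale lift_Q_right hop_def scaleR_cscale)
    also have "\<dots> \<in> cmat.span (hops t)"
      by (intro cmat.span_scale cmat.span_sum cmat.span_base) (auto simp: hops_def)
    finally show "X \<in> cmat.span (hops t)" .
  qed
qed

lemma raised_Suc: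
  assumes "t < w"
  shows "raised t \<subseteq> raised (Suc t)"
proof
  fix X assume "X \<in> raised t"
  then obtain Z where Z: "Z \<in> sec t" "X = lift ((up ^^ (w - t)) Z)" by (auto simp: raised_def)
  have "w - t = Suc (w - Suc t)" using assms by simp
  then have "X = lift ((up ^^ (w - Suc t)) (up Z))" using Z(2) by (simp add: funpow_swap1)
  then show "X \<in> raised (Suc t)" using up_sec[OF Z(1)] by (auto simp: raised_def)
qed

text \<open>Normal ordering: moving the pair past the creation operators of I leaves the operator
  with one more letter on each side, plus one contraction for every letter of I equal to k.\<close>

lemma hop_Cons:
  assumes "length I = length J"
  shows "lift ((a i)\<^sup>\<dagger> ** a k) ** hop I J = hop (i # I) (k # J)
     + (\<Sum>l<length I. if I ! l = k then hop (I[l := i]) J else 0)"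
proof -
  \<comment> \<open>The matrix unit has its indices swapped, so that \<open>second_quant A\<close>
    is the adjoint of the pair wanted; the Leibniz rule is used after taking adjoints.\<close>
  define A :: "complex ^ 'n ^ 'n" where "A = (\<chi> x y. if x = k \<and> y = i then 1 else 0)"
  have "second_quant A = (\<Sum>x\<in>UNIV. \<Sum>y\<in>UNIV. if x = k then if y = i then (a x)\<^sup>\<dagger> ** a y else 0 else 0)"
    unfolding second_quant_def A_def by (intro sum.cong refl) (auto simp: cmat.scale_zero_left)
  also have "\<dots> = (\<Sum>x\<in>UNIV. if x = k then \<Sum>y\<in>UNIV. if y = i then (a x)\<^sup>\<dagger> ** a y else 0 else 0)"
    by (intro sum.cong refl) auto
  finally have second_quant: "second_quant A = (a k)\<^sup>\<dagger> ** a i" by simp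
  have "(\<Sum>c\<in>UNIV. cscale (A $ (I ! l) $ c) (word (I[l := c]))) =
      (\<Sum>c\<in>UNIV. if c = i then if I ! l = k then word (I[l := c]) else 0 else 0)" for l
    unfolding A_def by (intro sum.cong refl) (auto simp: cmat.scale_zero_left)
  then have "word I ** ((a k)\<^sup>\<dagger> ** a i) = (a k)\<^sup>\<dagger> ** a i ** word I
     + (\<Sum>l<length I. if I ! l = k then word (I[l := i]) else 0)"
    using word_second_quant[of I A] by (simp add: second_quant)
  from arg_cong[OF this, of hadj] have e: "(a i)\<^sup>\<dagger> ** a k ** (word I)\<^sup>\<dagger> = (word I)\<^sup>\<dagger> ** ((a i)\<^sup>\<dagger> ** a k)
     + (\<Sum>l<length I. if I ! l = k then (word (I[l := i]))\<^sup>\<dagger> else 0)"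
    by (simp add: if_distrib cong: if_cong)
  have "lift ((a i)\<^sup>\<dagger> ** a k) ** hop I J = lift ((a i)\<^sup>\<dagger> ** a k ** (word I)\<^sup>\<dagger> ** word J)"
    by (simp add: lift_mult[OF assms] matrix_mult_assoc)
  also have "\<dots> = lift ((word I)\<^sup>\<dagger> ** ((a i)\<^sup>\<dagger> ** a k) ** word J) +
     (\<Sum>l<length I. lift ((if I ! l = k then (word (I[l := i]))\<^sup>\<dagger> else 0) ** word J))"
    unfolding e by (simp add: matrix_mult_distrib matrix_sum_mult lift_linear)
  also have "(\<Sum>l<length I. lift ((if I ! l = k then (word (I[l := i]))\<^sup>\<dagger> else 0) ** word J)) =
     (\<Sum>l<length I. if I ! l = k then hop (I[l := i]) J else 0)"
    by (intro sum.cong refl) (simp add: hop_def lift_linear)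
  finally show ?thesis by (simp add: hop_def matrix_mult_assoc)
qed

lemma error_space_ext_ops: "error_space \<subseteq> (ext_ops :: ('n, 'v) tensor_op set)"
proof -
  have "ext_id \<in> (ext_ops :: ('n, 'v) tensor_op set)"
    using lift_ext_ops[of "Q w"] by (simp only: lift_Q)
  then show ?thesis
    unfolding error_space using lift_ext_ops ext_ops_subspace by (intro cmat.span_minimal) (auto simp: lift_def)
qed

lemma ext_id_absorb:
  assumes "X \<in> ext_ops"
  shows "ext_id ** X = (X :: ('n, 'v) tensor_op)"
proof -
  have "ext_id ** (T ** T\<^sup>\<dagger>) = T ** T\<^sup>\<dagger>"
    by (simp only: matrix_mul_assoc ext_id_T)
  then have "ext_id ** (ext_id ** X ** ext_id) = ext_id ** X ** ext_id"
    by (simp add: T_hadj matrix_mul_assoc)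
  then show ?thesis using assms by (simp add: ext_ops_def)
qed

lemma ext_id_products:
  "Y \<in> products t error_space \<Longrightarrow> ext_id ** Y = (Y :: ('n, 'v) tensor_op)"
proof (cases t)
  case 0
  assume "Y \<in> products t error_space"
  moreover have "ext_id \<in> (ext_ops :: ('n, 'v) tensor_op set)"
    using lift_ext_ops[of "Q w"] by (simp only: lift_Q)
  ultimately show ?thesis using 0 by (simp add: products_0 ext_id_absorb)
next
  case (Suc s)
  assume "Y \<in> products t error_space"
  then obtain X Z where "X \<in> error_space" "Y = X ** Z" using Suc by (auto simp: products_Suc)
  then show ?thesis using error_space_ext_ops by (simp add: matrix_mul_assoc ext_id_absorb subsetD)
qed

text \<open>Both inclusions rest on \<open>hop_Cons\<close>: a generator times a t-body operator
  differs from a (t+1)-body operator by t-body operators, and these already belong to the span on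
  either side.\<close>

lemma span_products:
  assumes "t \<le> w"
  shows "cmat.span (products t error_space) = raised t"
  using assms
proof (induction t)
  case 0
  have "hops 0 = {ext_id}"
    by (simp add: hops_def words_0 hop_def lift_def T_hadj)
  then show ?case using span_hops[of 0] by (simp add: products_0)
next
  case (Suc t)
  let ?P = "\<lambda>t. products t error_space :: ('n, 'v) tensor_op set"
  have IH: "cmat.span (?P t) = cmat.span (hops t)"
    using Suc span_hops[of t] by simp
  have mono: "cmat.span (hops t) \<subseteq> cmat.span (hops (Suc t))"
    using raised_Suc[of t] Suc.prems by (simp add: span_hops)
  have lift_hop: "x ** y \<in> cmat.span (hops (Suc t))"
    if x: "x \<in> insert ext_id {T ** ((a i)\<^sup>\<dagger> ** a j) ** T\<^sup>\<dagger> | i j. True}" and "y \<in> hops t" for x y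
  proof -
    obtain I J where IJ: "I \<in> words t" "J \<in> words t" "y = hop I J" using \<open>y \<in> hops t\<close> by (auto simp: hops_def)
    have y: "y \<in> cmat.span (hops (Suc t))" using mono \<open>y \<in> hops t\<close> cmat.span_base by blast
    show ?thesis
    proof (cases "x = ext_id")
      case True
      then show ?thesis using y IJ by (simp add: ext_id_absorb hop_def)
    next
      case False
      then obtain i k where "x = lift ((a i)\<^sup>\<dagger> ** a k)" using x by (auto simp: lift_def)
      moreover have "hop (i # I) (k # J) \<in> cmat.span (hops (Suc t))"
        using IJ by (intro cmat.span_base hop_in_hops) (auto simp: words_def)
      moreover have "hop (I[l := i]) J \<in> cmat.span (hops (Suc t))" for l
        using IJ by (intro subsetD[OF mono] cmat.span_base hop_in_hops) (auto simp: words_def)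
      ultimately show ?thesis
        using IJ hop_Cons[of I J i k]
        by (auto simp: words_def intro!: cmat.span_add cmat.span_sum cmat.span_zero)
    qed
  qed
  have "?P (Suc t) \<subseteq> cmat.span (hops (Suc t))"
  proof
    fix Z assume "Z \<in> ?P (Suc t)"
    then obtain X Y where XY: "Z = X ** Y" "X \<in> error_space" "Y \<in> ?P t" by (auto simp: products_Suc)
    have "Y \<in> cmat.span (hops t)" using XY(3) IH cmat.span_base by blast
    then show "Z \<in> cmat.span (hops (Suc t))"
      unfolding XY(1) by (rule span_mult[OF XY(2)[unfolded error_space]]) (rule lift_hop)
  qed
  moreover have "hops (Suc t) \<subseteq> cmat.span (?P (Suc t))"
  proof
    fix Z assume "Z \<in> hops (Suc t)"
    then obtain i I k J where IJ: "I \<in> words t" "J \<in> words t" "Z = hop (i # I) (k # J)"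
      by (auto simp: hops_def words_def length_Suc_conv)
    \<comment> \<open>Since \<open>ext_id\<close> is an error, a product can be padded by one more
      factor.\<close>
    have monoP: "cmat.span (?P t) \<subseteq> cmat.span (?P (Suc t))"
    proof (rule cmat.span_mono, rule subsetI)
      fix Y assume Y: "Y \<in> ?P t"
      have "ext_id \<in> (error_space :: ('n, 'v) tensor_op set)"
        unfolding error_space by (intro cmat.span_base) simp
      then have "ext_id ** Y \<in> ?P (Suc t)" using Y unfolding products_Suc by blast
      then show "Y \<in> ?P (Suc t)" by (simp add: ext_id_products[OF Y])
    qed
    have G: "lift ((a i)\<^sup>\<dagger> ** a k) \<in> cmat.span error_space"
      unfolding error_space lift_def by (intro cmat.span_base) (auto intro: cmat.span_base)
    have "hop I J \<in> cmat.span (?P t)"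
      unfolding IH using IJ by (intro cmat.span_base hop_in_hops) (auto simp: words_def)
    then have 1: "lift ((a i)\<^sup>\<dagger> ** a k) ** hop I J \<in> cmat.span (?P (Suc t))"
      by (rule span_mult[OF G]) (auto simp: products_Suc intro!: cmat.span_base)
    have 2: "hop (I[l := i]) J \<in> cmat.span (?P (Suc t))" for l
      using IJ by (intro subsetD[OF monoP], unfold IH, intro cmat.span_base hop_in_hops) (auto simp: words_def)
    have "Z = lift ((a i)\<^sup>\<dagger> ** a k) ** hop I J - (\<Sum>l<length I. if I ! l = k then hop (I[l := i]) J else 0)"
      using hop_Cons[of I J i k] IJ by (simp add: words_def)
    also have "\<dots> \<in> cmat.span (?P (Suc t))"
      using 1 2 by (auto intro!: cmat.span_diff cmat.span_sum cmat.span_zero)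
    finally show "Z \<in> cmat.span (?P (Suc t))" .
  qed
  ultimately have "cmat.span (?P (Suc t)) = cmat.span (hops (Suc t))"
    by (metis cmat.span_span cmat.span_mono subset_antisym)
  then show ?case using span_hops[OF Suc.prems] by simp
qed

section \<open>The layers and the scalars by which U^b D^b acts on them\<close>

lemma ext_metric_raised: "t \<le> w \<Longrightarrow> ext_metric (real t) = raised t"
  by (simp add: ext_metric_of_nat span_products)

text \<open>The preceding space is the image of U^(w-j+1), so by adjointness orthogonality to it
  says that D^(w-j+1) gives an operator orthogonal to all of \<open>sec (j - 1)\<close>; as the
  result lies in that sector, it is zero.\<close>

lemma metric_layer_iff:
  assumes "j \<le> w"
  shows "X \<in> metric_layer j \<longleftrightarrow> X \<in> raised j \<and> (down ^^ Suc (w - j)) (compress X) = 0"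
proof (cases "j = 0")
  case True
  have "metric_layer 0 = raised 0"
    using ext_metric_raised[of 0] by (simp add: metric_layer_def ext_metric_def)
  \<comment> \<open>For j = 0 no earlier space exists, and the second condition is automatic: w
    particles cannot be lowered w + 1 times.\<close>
  moreover have "(down ^^ Suc w) (compress X) = 0" by (rule down_pow_sec_0[OF compress_sec]) simp
  ultimately show ?thesis using True by simp
next
  case False
  let ?D = "(down ^^ Suc (w - j)) (compress X)"
  have b: "w - (j - 1) = Suc (w - j)" using assms False by simp
  have D: "?D \<in> sec (j - 1)" using assms False compress_sec by (intro down_pow_sec) simp
  have h: "hs_inner (lift ((up ^^ (w - (j - 1))) Z)) X = hs_inner Z ?D" for Z
    unfolding b by (simp only: hs_inner_lift hs_inner_up_pow)
  have "(\<forall>Y\<in>raised (j - 1). hs_inner Y X = 0) \<longleftrightarrow> (\<forall>Z\<in>sec (j - 1). hs_inner Z ?D = 0)"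
    unfolding raised_def using h by auto
  also have "\<dots> \<longleftrightarrow> ?D = 0" using D hs_inner_self_eq_0 hs_inner_simps(5) by metis
  finally have *: "(\<forall>Y\<in>raised (j - 1). hs_inner Y X = 0) \<longleftrightarrow> ?D = 0" .
  have "j - 1 \<le> w" "j > 0" using assms False by simp_all
  then have "X \<in> metric_layer j \<longleftrightarrow> X \<in> raised j \<and> X \<in> ext_ops \<and> (\<forall>Y\<in>raised (j - 1). hs_inner Y X = 0)"
    by (simp only: metric_layer_eq ext_metric_raised[OF assms] ext_metric_raised[of "j - 1"]) (auto simp: hs_complement_def)
  moreover have "X \<in> raised j \<Longrightarrow> X \<in> ext_ops" by (auto simp: raised_def)
  ultimately show ?thesis using * by blast
qed

lemma raised_w: "raised w = ext_ops"
proof -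
  have "X \<in> raised w" if "X \<in> ext_ops" for X
  proof -
    have "X = lift (compress X)" using that by (simp add: lift_compress ext_ops_def)
    then show ?thesis using compress_sec[of X] by (auto simp: raised_def)
  qed
  then show ?thesis by (auto simp: raised_def)
qed

text \<open>Each factor is the eigenvalue (w - j)(n - w - j + 1) of U D on layer j minus the shift
  i(n - 2w + i + 1) from \<open>up_down_pow_Suc\<close>; the difference factors as
  displayed.\<close>

definition psi :: "nat \<Rightarrow> nat \<Rightarrow> real" where
  "psi b j = (\<Prod>i<b. (real w - real j - real i) * (real CARD('n) - real w - real j + 1 + real i))"

lemma layer_eigen:
  assumes "j \<le> w" "X \<in> metric_layer j" "b \<le> w"
  shows "(up ^^ b) ((down ^^ b) (compress X)) = psi b j *\<^sub>R compress X"
  using assms(3)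
proof (induction b)
  case 0
  then show ?case by (simp add: psi_def)
next
  case (Suc b)
  have X: "X \<in> raised j" "(down ^^ Suc (w - j)) (compress X) = 0"
    using assms by (simp_all add: metric_layer_iff)
  then obtain Z where Z: "Z \<in> sec j" "X = lift ((up ^^ (w - j)) Z)" by (auto simp: raised_def)
  then have dX: "compress X = (up ^^ (w - j)) Z"
    using up_pow_sec[OF Z(1), of "w - j"] assms(1) by (simp add: compress_lift_sec)
  let ?l = "real (w - j) * (real CARD('n) - 2 * real j - real (w - j) + 1)"
  let ?m = "real b * (real CARD('n) - 2 * real w + real b + 1)"
  have "up (down (compress X)) = ?l *\<^sub>R compress X"
    by (rule up_down_eigen[OF Z(1) dX X(2)])
  then have "(up ^^ Suc b) ((down ^^ Suc b) (compress X)) = (?l - ?m) *\<^sub>R (up ^^ b) ((down ^^ b) (compress X))"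
    using up_down_pow_Suc[OF compress_sec, of b X] Suc.prems
    by (simp add: up_pow_linear down_pow_linear scaleR_diff_left del: funpow.simps)
  also have "\<dots> = ((?l - ?m) * psi b j) *\<^sub>R compress X"
    using Suc by simp
  also have "(?l - ?m) * psi b j = psi (Suc b) j"
    using assms(1) by (simp add: psi_def of_nat_diff algebra_simps)
  finally show ?case .
qed

lemma kraus_hops:
  "(\<Sum>I\<in>words t. \<Sum>J\<in>words t. hop I J ** X ** (hop I J)\<^sup>\<dagger>) = lift ((up ^^ t) ((down ^^ t) (compress X)))"
  by (simp add: up_pow_words down_pow_words hop_def lift_def compress_def matrix_mult_sum matrix_sum_mult
      matrix_mult_assoc)

lemma project_hops:
  assumes "t + b = w"
  shows "(\<Sum>I\<in>words t. \<Sum>J\<in>words t. cscale (hs_inner (hop I J) Y) (hop I J)) =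
    (fact t / fact b)\<^sup>2 *\<^sub>R lift ((up ^^ b) ((down ^^ b) (compress Y)))"
proof -
  have "hs_inner ((word I)\<^sup>\<dagger> ** word J ** Q w) (compress Y) = hs_inner (hop I J) Y" for I J
    by (simp add: hop_def lift_Q_right flip: hs_inner_lift)
  then show ?thesis
    using up_down_pow_expand[of "compress Y" t b] compress_sec[of Y] assms
    by (simp add: lift_linear lift_cscale lift_Q_right hop_def[symmetric] power_divide)
qed

section \<open>Lowest weight vectors and nonvanishing of the layers\<close>

lemma down_up_pow_prim:
  assumes "Z \<in> sec j" "down Z = 0"
  shows "down ((up ^^ Suc b) Z) = (real (Suc b) * (real CARD('n) - 2 * real j - real b)) *\<^sub>R (up ^^ b) Z"
proof (induction b)
  case 0
  then show ?case using down_up[OF assms(1)] assms(2) by (simp add: up_linear)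
next
  case (Suc b)
  have "down ((up ^^ Suc (Suc b)) Z) = up (down ((up ^^ Suc b) Z))
      + (real CARD('n) - 2 * real (j + Suc b)) *\<^sub>R (up ^^ Suc b) Z"
    using down_up[OF up_pow_sec[OF assms(1), of "Suc b"]] by simp
  also have "\<dots> = (real (Suc b) * (real CARD('n) - 2 * real j - real b)
      + (real CARD('n) - 2 * real (j + Suc b))) *\<^sub>R (up ^^ Suc b) Z"
    unfolding Suc.IH by (simp add: up_linear scaleR_add_left)
  also have "real (Suc b) * (real CARD('n) - 2 * real j - real b)
      + (real CARD('n) - 2 * real (j + Suc b)) = real (Suc (Suc b)) * (real CARD('n) - 2 * real j - real (Suc b))"
    by (simp add: algebra_simps)
  finally show ?case .
qed

lemma down_pow_up_pow_prim:
  assumes "Z \<in> sec j" "down Z = 0"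
  shows "(down ^^ b) ((up ^^ b) Z) = (\<Prod>i<b. real (Suc i) * (real CARD('n) - 2 * real j - real i)) *\<^sub>R Z"
proof (induction b)
  case (Suc b)
  have "(down ^^ Suc b) ((up ^^ Suc b) Z) = (down ^^ b) (down ((up ^^ Suc b) Z))"
    by (simp add: funpow_swap1)
  then show ?case
    unfolding down_up_pow_prim[OF assms] by (simp add: down_pow_linear Suc mult.commute)
qed simp

text \<open>As 2j \<le> n there are two disjoint sets of j modes. The matrix unit between the states
  they create is killed by every summand of D, since any mode is missing from one of the two sets.
  Raised to sector w it stays nonzero, because lowering it back gives a nonzero multiple.\<close>

lemma metric_layer_nonzero:
  assumes "j \<le> w"
  shows "\<exists>X\<in>(metric_layer j :: ('n, 'v) tensor_op set). X \<noteq> 0"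
proof -
  obtain L :: "'n list" where L: "distinct L" "set L = UNIV"
    using finite_distinct_list[of "UNIV :: 'n set"] by auto
  have lenL: "length L = CARD('n)" using L distinct_card by fastforce
  define I where "I = take j L"
  define K where "K = take j (drop j L)"
  have len: "length I = j" "length K = j" using assms w_le lenL by (auto simp: I_def K_def)
  have dist: "distinct I" "distinct K" using L(1) by (simp_all add: I_def K_def)
  have disj: "set I \<inter> set K = {}"
    using L(1) set_take_disj_set_drop_if_distinct[of L j j] set_take_subset[of j "drop j L"]
    by (auto simp: I_def K_def)
  define Z where "Z = (word I)\<^sup>\<dagger> ** Q 0 ** word K"
  have Zsec: "Z \<in> sec j" unfolding Z_def using len by (intro word_vacuum_sec) (auto simp: words_def)
  have "a i ** Z ** (a i)\<^sup>\<dagger> = 0" for i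
  proof (cases "i \<in> set I")
    case True
    then have "a i ** ((word K)\<^sup>\<dagger> ** Q 0) = 0" using disj by (intro a_word_vacuum) auto
    from arg_cong[OF this, of hadj] have "Q 0 ** (word K ** (a i)\<^sup>\<dagger>) = 0"
      by (simp add: matrix_mult_assoc)
    then show ?thesis by (simp add: Z_def matrix_mult_assoc)
  next
    case False
    from a_word_vacuum[OF this] have "a i ** ((word I)\<^sup>\<dagger> ** Q 0) ** (word K ** (a i)\<^sup>\<dagger>) = 0" by simp
    then show ?thesis by (simp add: Z_def matrix_mult_assoc)
  qed
  then have Zdown: "down Z = 0" by (simp add: down_def)
  have "Z \<noteq> 0"
  proof
    assume "Z = 0"
    have K: "Q 0 ** (word K ** (word K)\<^sup>\<dagger>) = Q 0"
      using arg_cong[OF word_word_vacuum[OF dist(2)], of hadj] by (simp add: matrix_mult_assoc)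
    have "word I ** Z ** (word K)\<^sup>\<dagger> = word I ** ((word I)\<^sup>\<dagger> ** Q 0) ** (word K ** (word K)\<^sup>\<dagger>)"
      by (simp add: Z_def matrix_mult_assoc)
    also have "\<dots> = Q 0" by (simp add: word_word_vacuum dist K)
    finally show False using \<open>Z = 0\<close> vacuum_neq_0 by simp
  qed
  let ?c = "\<Prod>i<w - j. real (Suc i) * (real CARD('n) - 2 * real j - real i)"
  let ?X = "lift ((up ^^ (w - j)) Z)"
  \<comment> \<open>For i < w - j the bound 2w \<le> n gives n - 2j - i > 0.\<close>
  have "?c \<noteq> 0"
  proof -
    have "real CARD('n) - 2 * real j - real i \<noteq> 0" if "i < w - j" for i
      using that w_le assms by simp
    then show ?thesis by simp
  qed
  have dX: "compress ?X = (up ^^ (w - j)) Z"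
    using up_pow_sec[OF Zsec, of "w - j"] assms by (simp add: compress_lift_sec)
  have c: "(down ^^ (w - j)) (compress ?X) = ?c *\<^sub>R Z"
    unfolding dX by (rule down_pow_up_pow_prim[OF Zsec Zdown])
  then have "(down ^^ Suc (w - j)) (compress ?X) = 0" by (simp add: down_linear Zdown)
  then have X_layer: "?X \<in> metric_layer j" using raisedI[OF Zsec] assms by (simp add: metric_layer_iff)
  have X_nonzero: "?X \<noteq> 0"
  proof
    assume "?X = 0"
    then have "?c *\<^sub>R Z = 0" using c by (simp add: compress_def down_pow_linear)
    then show False using \<open>?c \<noteq> 0\<close> \<open>Z \<noteq> 0\<close> by simp
  qed
  show ?thesis using X_nonzero X_layer by blast
qed

end

section \<open>The coefficients\<close>

text \<open>An orthonormal subset of maximal size spans V, since a normalized residual would enlarge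
  it. Uniqueness of the coefficients depends on this: \<open>is_W_coefficients\<close> speaks about
  all families of bases and would be vacuous without one.\<close>

lemma hs_orthonormal_basis_exists:
  assumes "cmat.subspace V"
  shows "\<exists>B. hs_orthonormal_basis B V"
proof -
  define P where "P B \<longleftrightarrow> finite B \<and> B \<subseteq> V \<and>
     (\<forall>E\<in>B. \<forall>F\<in>B. hs_inner E F = (if E = F then 1 else 0))" for B :: "(complex ^ 'a ^ 'a) set"
  have bound: "card B < Suc (DIM(complex ^ 'a ^ 'a))" if "P B" for B
  proof -
    have o: "hs_inner E F = (if E = F then 1 else 0)" if "E \<in> B" "F \<in> B" for E F
      using that \<open>P B\<close> by (auto simp: P_def)
    \<comment> \<open>The real inner product is the real part of \<open>hs_inner\<close>, so the
      real dimension bounds the size of B.\<close>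
    have "pairwise orthogonal B"
      using o by (auto simp: pairwise_def orthogonal_def Re_hs_inner[symmetric])
    moreover have "0 \<notin> B" using o[of 0 0] by auto
    ultimately have "independent B" by (rule pairwise_orthogonal_independent)
    then show ?thesis using independent_bound by (metis less_Suc_eq_le)
  qed
  have "P {}" by (simp add: P_def)
  then have "\<exists>B. P B \<and> (\<forall>C. P C \<longrightarrow> card C \<le> card B)"
    using bound by (intro ex_has_greatest_nat[of P "{}" card "Suc (DIM(complex ^ 'a ^ 'a))"]) auto
  then obtain B where B: "P B" and max: "\<And>C. P C \<Longrightarrow> card C \<le> card B" by blast
  have sub: "cmat.span B \<subseteq> V" using B assms by (intro cmat.span_minimal) (auto simp: P_def)
  have "X \<in> cmat.span B" if "X \<in> V" for X
  proof -
    define S where "S = (\<Sum>E\<in>B. cscale (hs_inner E X) E)"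
    define Y where "Y = X - S"
    have S: "S \<in> cmat.span B"
      unfolding S_def by (intro cmat.span_sum cmat.span_scale cmat.span_base)
    have "Y \<in> V" unfolding Y_def using that S sub assms by (intro cmat.subspace_diff) auto
    have orth: "hs_inner E Y = 0" if "E \<in> B" for E
    proof -
      have "hs_inner E S = (\<Sum>F\<in>B. if E = F then hs_inner F X else 0)"
        unfolding S_def hs_inner_simps using B that by (intro sum.cong refl) (auto simp: P_def)
      also have "\<dots> = hs_inner E X" using B that by (simp add: P_def)
      finally show ?thesis by (simp add: Y_def)
    qed
    have "Y = 0"
    proof (rule ccontr)
      assume "Y \<noteq> 0"
      define F where "F = (1 / norm Y) *\<^sub>R Y"
      have FF: "hs_inner F F = 1"
        using \<open>Y \<noteq> 0\<close> by (simp add: F_def hs_inner_self power2_eq_square)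
      have FB: "hs_inner E F = 0" "hs_inner F E = 0" if "E \<in> B" for E
        using orth[OF that] hs_inner_commute[of E F] by (simp_all add: F_def)
      have "F \<notin> B" using FB FF by force
      have "F \<in> V" unfolding F_def scaleR_cscale using \<open>Y \<in> V\<close> assms by (rule cmat.subspace_scale[rotated])
      then have "P (insert F B)"
        using B FF FB by (auto simp: P_def)
      from max[OF this] show False using \<open>F \<notin> B\<close> B by (simp add: P_def)
    qed
    then show ?thesis using S by (simp add: Y_def)
  qed
  then have "cmat.span B = V" using sub by blast
  then show ?thesis using B by (auto simp: P_def hs_orthonormal_basis_def)
qed

lemma Pi_proj_id:
  assumes "hs_orthonormal_basis B V" "X \<in> V"
  shows "Pi_proj B X = X"
proof -
  have B: "finite B" "\<And>E F. E \<in> B \<Longrightarrow> F \<in> B \<Longrightarrow> hs_inner E F = (if E = F then 1 else 0)"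
    using assms(1) by (auto simp: hs_orthonormal_basis_def)
  have "X \<in> cmat.span B" using assms by (simp add: hs_orthonormal_basis_def)
  then show ?thesis
  proof (induction rule: cmat.span_induct_alt)
    case base
    then show ?case by (simp add: Pi_proj_def cmat.scale_zero_left)
  next
    case (step c E Y)
    have "Pi_proj B (cscale c E + Y) = cscale c (\<Sum>F\<in>B. cscale (hs_inner F E) F) + Pi_proj B Y"
      by (simp add: Pi_proj_def cmat.scale_left_distrib sum.distrib cscale_sum)
    also have "(\<Sum>F\<in>B. cscale (hs_inner F E) F) = (\<Sum>F\<in>B. if F = E then F else 0)"
      using B(2) step(1) by (intro sum.cong refl) (auto simp: cmat.scale_zero_left)
    also have "\<dots> = E" using B(1) step(1) by simp
    finally show ?case using step by simp
  qed
qed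

lemma Pi_proj_in:
  assumes "hs_orthonormal_basis B V"
  shows "Pi_proj B X \<in> V"
proof -
  have "Pi_proj B X \<in> cmat.span B"
    unfolding Pi_proj_def by (intro cmat.span_sum cmat.span_scale cmat.span_base)
  then show ?thesis using assms by (simp add: hs_orthonormal_basis_def)
qed

lemma Pi_proj_0:
  assumes "\<And>E. E \<in> B \<Longrightarrow> hs_inner E X = 0"
  shows "Pi_proj B X = 0"
  using assms by (simp add: Pi_proj_def cmat.scale_zero_left)

lemma Pi_proj_add: "Pi_proj B (X + Y) = Pi_proj B X + Pi_proj B Y"
  and Pi_proj_diff: "Pi_proj B (X - Y) = Pi_proj B X - Pi_proj B Y"
  and Pi_proj_cscale: "Pi_proj B (cscale c X) = cscale c (Pi_proj B X)"
  by (simp_all add: Pi_proj_def cmat.scale_left_distrib cmat.scale_left_diff_distrib sum.distrib sum_subtractf cscale_sum)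

text \<open>Two Kraus families whose associated rank-one sums \<open>Y \<mapsto> \<Sum> tr(A\<^sup>* Y) A\<close> agree also define the
  same map \<open>X \<mapsto> \<Sum> A X A\<^sup>*\<close>: both encode the tensor \<open>\<Sum> A \<otimes> A\<^sup>*\<close>.\<close>

lemma kraus_cong:
  fixes A :: "'i \<Rightarrow> complex ^ 'a ^ 'a" and B :: "'j \<Rightarrow> complex ^ 'a ^ 'a"
  assumes "\<And>Y. (\<Sum>i\<in>S. cscale (hs_inner (A i) Y) (A i)) = (\<Sum>j\<in>S'. c j *\<^sub>R cscale (hs_inner (B j) Y) (B j))"
  shows "(\<Sum>i\<in>S. A i ** X ** (A i)\<^sup>\<dagger>) = (\<Sum>j\<in>S'. c j *\<^sub>R (B j ** X ** (B j)\<^sup>\<dagger>))"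
proof -
  \<comment> \<open>Testing the hypothesis on matrix units reads off all entries of the common
    tensor.\<close>
  have unit: "hs_inner M (\<chi> x y. if x = k \<and> y = l then 1 else 0) = cnj (M $ k $ l)" for M :: "complex ^ 'a ^ 'a" and k l
  proof -
    have "hs_inner M (\<chi> x y. if x = k \<and> y = l then 1 else 0) =
        (\<Sum>x\<in>UNIV. \<Sum>y\<in>UNIV. if x = k then if y = l then cnj (M $ x $ y) else 0 else 0)"
      unfolding hs_inner_entries by (intro sum.cong refl) auto
    also have "\<dots> = (\<Sum>x\<in>UNIV. if x = k then \<Sum>y\<in>UNIV. if y = l then cnj (M $ x $ y) else 0 else 0)"
      by (intro sum.cong refl) auto
    finally show ?thesis by simp
  qed
  have t: "(\<Sum>i\<in>S. cnj (A i $ k $ l) * A i $ p $ q) = (\<Sum>j\<in>S'. c j *\<^sub>R (cnj (B j $ k $ l) * B j $ p $ q))" for k l p q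
    using arg_cong[OF assms[of "\<chi> x y. if x = k \<and> y = l then 1 else 0"], of "\<lambda>M. M $ p $ q"]
    by (simp add: unit cscale_def)
  have conj: "(M ** X ** M\<^sup>\<dagger>) $ p $ k = (\<Sum>l\<in>UNIV. \<Sum>q\<in>UNIV. X $ q $ l * (cnj (M $ k $ l) * M $ p $ q))"
    for M p k
    by (simp add: matrix_matrix_mult_def hadj_def sum_distrib_right sum_distrib_left mult_ac)
  have "(\<Sum>i\<in>S. A i ** X ** (A i)\<^sup>\<dagger>) $ p $ k =
      (\<Sum>l\<in>UNIV. \<Sum>q\<in>UNIV. X $ q $ l * (\<Sum>i\<in>S. cnj (A i $ k $ l) * A i $ p $ q))" for p k
    by (simp only: sum_component conj sum_distrib_left sum.swap[of _ UNIV S])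
  moreover have "(\<Sum>j\<in>S'. c j *\<^sub>R (B j ** X ** (B j)\<^sup>\<dagger>)) $ p $ k =
      (\<Sum>l\<in>UNIV. \<Sum>q\<in>UNIV. X $ q $ l * (\<Sum>j\<in>S'. c j *\<^sub>R (cnj (B j $ k $ l) * B j $ p $ q)))" for p k
    by (simp only: sum_component vector_scaleR_component conj sum_distrib_left scaleR_sum_right
        mult_scaleR_right sum.swap[of _ UNIV S'])
  ultimately show ?thesis by (simp add: vec_eq_iff t)
qed

section \<open>Finite differences and the inverse of the triangular matrix\<close>

lemma sum_alternating_Suc:
  fixes g :: "nat \<Rightarrow> real"
  shows "(\<Sum>i\<le>Suc m. (-1) ^ i * real (Suc m choose i) * g i) =
    (\<Sum>i\<le>m. (-1) ^ i * real (m choose i) * (g i - g (Suc i)))"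
proof -
  have "(\<Sum>i\<le>m. (-1) ^ i * real (m choose i) * g i) =
      (\<Sum>i\<le>Suc m. (-1) ^ i * real (m choose i) * g i)"
    by simp
  also have "\<dots> = g 0 - (\<Sum>i\<le>m. (-1) ^ i * real (m choose Suc i) * g (Suc i))"
    by (simp only: sum.atMost_Suc_shift) (simp add: sum_negf)
  finally have "(\<Sum>i\<le>m. (-1) ^ i * real (m choose i) * g i) =
     g 0 - (\<Sum>i\<le>m. (-1) ^ i * real (m choose Suc i) * g (Suc i))" .
  moreover have "(\<Sum>i\<le>Suc m. (-1) ^ i * real (Suc m choose i) * g i) =
     g 0 + (\<Sum>i\<le>m. - ((-1) ^ i * real (m choose i) * g (Suc i)) - (-1) ^ i * real (m choose Suc i) * g (Suc i))"
    by (simp only: sum.atMost_Suc_shift) (simp add: distrib_left distrib_right left_diff_distrib)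
  ultimately show ?thesis
    by (simp only: sum_subtractf sum_negf right_diff_distrib)
qed

text \<open>An m-th finite difference of a polynomial in i of degree p < m. Pascal's rule lowers m
  and p together; m \<le> N keeps the truncated N - i exact.\<close>

lemma alternating_sum_choose_choose:
  "p < m \<Longrightarrow> m \<le> N \<Longrightarrow> (\<Sum>i\<le>m. (-1) ^ i * real (m choose i) * real ((N - i) choose p)) = 0"
proof (induction m arbitrary: N p)
  case (Suc m)
  have "(\<Sum>i\<le>Suc m. (-1) ^ i * real (Suc m choose i) * real ((N - i) choose p)) =
     (\<Sum>i\<le>m. (-1) ^ i * real (m choose i) * (real ((N - i) choose p) - real ((N - Suc i) choose p)))"
    by (rule sum_alternating_Suc)
  also have "\<dots> = 0"
  proof (cases p)
    case (Suc q)
    have "real ((N - i) choose p) - real ((N - Suc i) choose p) = real ((N - 1 - i) choose q)" if "i \<le> m" for i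
    proof -
      have "N - i = Suc (N - Suc i)" using that Suc.prems by simp
      then show ?thesis using Suc by (simp add: diff_diff_left del: diff_Suc_1)
    qed
    then have "(\<Sum>i\<le>m. (-1) ^ i * real (m choose i) * (real ((N - i) choose p) - real ((N - Suc i) choose p))) =
      (\<Sum>i\<le>m. (-1) ^ i * real (m choose i) * real ((N - 1 - i) choose q))"
      by (intro sum.cong refl) simp
    also have "\<dots> = 0" using Suc Suc.prems by (intro Suc.IH) simp_all
    finally show ?thesis .
  qed simp
  finally show ?case .
qed simp

text \<open>For l < k put m = k - l. The quotient of (n-l-s)! by (n-k-s+1)! is a polynomial in s of
  degree m - 1, and the remaining factors are alternating binomial coefficients of order m up to a
  constant, so an m-th difference kills it. For l = k a single term remains.\<close>

lemma fact_inverse_pair: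
  fixes n k l :: nat
  assumes "l \<le> k" "2 * k \<le> n"
  shows "(\<Sum>s=l..k. (-1) ^ (k - s) * fact (n - l - s) / (fact (k - s) * fact (n - k - s + 1) * fact (s - l)))
    = (if l = k then 1 / (real n - 2 * real k + 1) else 0)"
proof (cases "l = k")
  case True
  have "n - k - k = n - 2 * k" by simp
  moreover have "(fact (Suc (n - 2 * k)) :: real) = (real n - 2 * real k + 1) * fact (n - 2 * k)"
    using assms by (simp add: of_nat_diff algebra_simps)
  ultimately show ?thesis using True by (simp del: fact_Suc)
next
  case False
  define m where "m = k - l"
  define N where "N = n - 2 * l"
  have m: "m \<ge> 1" "k = l + m" "m \<le> N" "2 * m \<le> N" using assms False by (auto simp: m_def N_def)
  have "(\<Sum>s=l..k. (-1) ^ (k - s) * fact (n - l - s) / (fact (k - s) * fact (n - k - s + 1) * fact (s - l))) =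
     (\<Sum>i=0..m. (-1) ^ (m - i) * fact (N - i) / (fact (m - i) * fact (N - m - i + 1) * fact i) :: real)"
  proof (rule sum.reindex_bij_witness[of _ "\<lambda>i. i + l" "\<lambda>s. s - l"])
    fix s assume s: "s \<in> {l..k}"
    then have "k - s = m - (s - l)" "n - l - s = N - (s - l)" "n - k - s + 1 = N - m - (s - l) + 1"
      using m by (auto simp: N_def)
    then show "(-1) ^ (m - (s - l)) * fact (N - (s - l)) / (fact (m - (s - l)) * fact (N - m - (s - l) + 1) * fact (s - l))
       = (-1) ^ (k - s) * fact (n - l - s) / (fact (k - s) * fact (n - k - s + 1) * fact (s - l) :: real)" by simp
  qed (use m in auto)
  also have "\<dots> = (\<Sum>i=0..m. ((-1) ^ m * fact (m - 1) / fact m) * ((-1) ^ i * real (m choose i) * real ((N - i) choose (m - 1))))"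
  proof (rule sum.cong[OF refl])
    fix i assume "i \<in> {0..m}"
    then have i: "i \<le> m" by simp
    have "real (m choose i) = fact m / (fact i * fact (m - i))" by (rule binomial_fact[OF i])
    moreover have "real ((N - i) choose (m - 1)) = fact (N - i) / (fact (m - 1) * fact (N - i - (m - 1)))"
      using i m by (intro binomial_fact) simp
    moreover have "N - i - (m - 1) = N - m - i + 1" using i m by simp
    moreover have "(-1 :: real) ^ (m - i) = (-1) ^ m * (-1) ^ i"
      using i by (auto simp: minus_one_power_iff)
    moreover have "x * y * F / (D * G * H) = (x * e / f) * (y * (f / (H * D)) * (F / (e * G)))"
      if "e \<noteq> 0" "f \<noteq> 0" for x y F D G H e f :: real
      using that by (simp add: mult_ac)
    ultimately show "(-1) ^ (m - i) * fact (N - i) / (fact (m - i) * fact (N - m - i + 1) * fact i) =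
      ((-1) ^ m * fact (m - 1) / fact m) * ((-1) ^ i * real (m choose i) * real ((N - i) choose (m - 1)))"
      by (simp only: fact_nonzero not_False_eq_True)
  qed
  also have "\<dots> = 0"
    using alternating_sum_choose_choose[of "m - 1" m N] m
    by (simp only: sum_distrib_left[symmetric] atLeast0AtMost)
  finally show ?thesis using False by simp
qed

context ext_fermions
begin

section \<open>Orthogonality of the layers and closed forms of the coefficients\<close>

lemma raised_mono: "s \<le> t \<Longrightarrow> t \<le> w \<Longrightarrow> raised s \<subseteq> raised t"
proof (induction t rule: dec_induct)
  case (step t)
  then show ?case using raised_Suc[of t] by fastforce
qed simp

lemma raised_ext_ops: "X \<in> raised t \<Longrightarrow> X \<in> ext_ops"
  by (auto simp: raised_def)

lemma layer_iff_orthogonal: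
  assumes "0 < j" "j \<le> w"
  shows "X \<in> metric_layer j \<longleftrightarrow> X \<in> raised j \<and> (\<forall>Y\<in>raised (j - 1). hs_inner Y X = 0)"
proof -
  have "j - 1 \<le> w" using assms by simp
  then have "metric_layer j = raised j \<inter> hs_complement (raised (j - 1))"
    by (simp only: metric_layer_eq[OF assms(1)] ext_metric_raised assms(2))
  then show ?thesis using raised_ext_ops by (auto simp: hs_complement_def)
qed

lemma layer_subset_raised: "j \<le> w \<Longrightarrow> X \<in> metric_layer j \<Longrightarrow> X \<in> raised j"
  by (simp add: metric_layer_iff)

lemma layers_orthogonal:
  fixes X Y :: "('n, 'v) tensor_op"
  assumes "i < j" "j \<le> w" "X \<in> metric_layer i" "Y \<in> metric_layer j"
  shows "hs_inner X Y = 0" "hs_inner Y X = 0"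
proof -
  have "i \<le> j - 1" "j - 1 \<le> w" "X \<in> raised i" using assms layer_subset_raised[of i X] by auto
  then have "X \<in> raised (j - 1)" using raised_mono[of i "j - 1"] by blast
  then show "hs_inner X Y = 0" using assms layer_iff_orthogonal[of j Y] by auto
  then show "hs_inner Y X = 0" using hs_inner_commute[of Y X] by simp
qed

text \<open>The solution of the triangular system in \<open>Phi_Pi_relation\<close> below.\<close>

definition W_coeff :: "nat \<Rightarrow> nat \<Rightarrow> real" where
  "W_coeff t j = (\<Sum>s\<le>w. (fact (CARD('n) - w - t) / fact (w - t)) *
     (if s \<le> t then (-1) ^ (t - s) * (real CARD('n) - 2 * real t + 1)
       / (fact (t - s) * fact (CARD('n) - t - s + 1)) else 0) * (fact (w - s) / fact s)\<^sup>2 * psi s j)"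

text \<open>A falling factorial times a rising one. Once b exceeds w - j, the factor with i = w - j
  is zero.\<close>

lemma psi_fact:
  assumes "j \<le> w"
  shows "psi b j = (if b \<le> w - j
    then fact (w - j) * fact (CARD('n) - w - j + b) / (fact (w - j - b) * fact (CARD('n) - w - j)) else 0)"
proof (cases "b \<le> w - j")
  case True
  let ?M = "CARD('n) - w - j"
  have M: "real ?M = real CARD('n) - real w - real j" using w_le assms by simp
  have "psi b j = fact (w - j) * fact (?M + b) / (fact (w - j - b) * fact ?M)"
    using True
  proof (induction b)
    case 0
    then show ?case by (simp add: psi_def)
  next
    case (Suc b)
    then have e: "w - j - b = Suc (w - j - Suc b)" by simp
    then have "real w - real j - real b = real (Suc (w - j - Suc b))" using assms by linarith
    moreover have "real CARD('n) - real w - real j + 1 + real b = real (Suc (?M + b))"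
      using M by simp
    ultimately have psi_Suc: "psi (Suc b) j = psi b j * (real (Suc (w - j - Suc b)) * real (Suc (?M + b)))"
      by (simp add: psi_def)
    have psi_b: "psi b j = fact (w - j) * fact (?M + b) / (fact (Suc (w - j - Suc b)) * fact ?M)"
      using Suc e by simp
    have cancel: "p * c / ((x * d) * e) * (x * y) = p * (y * c) / (d * e)" if "x \<noteq> 0" for p c d e x y :: real
      using that by simp
    show ?case unfolding psi_Suc psi_b fact_Suc add_Suc_right by (rule cancel) simp
  qed
  then show ?thesis using True by simp
next
  case False
  then have "w - j \<in> {..<b}"
    "(real w - real j - real (w - j)) * (real CARD('n) - real w - real j + 1 + real (w - j)) = 0"
    using assms by auto
  then have "psi b j = 0"
    unfolding psi_def by (intro prod_zero finite_lessThan bexI[of _ "w - j"])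
  then show ?thesis using False by simp
qed

text \<open>The squared factorials cancel, and \<open>psi (w - s) l\<close> vanishes for s < l, so
  only s in l..k contributes. With the factors independent of s pulled out,
  \<open>fact_inverse_pair\<close> remains.\<close>

lemma coefficient_inverse:
  assumes "k \<le> w" "l \<le> w"
  shows "(\<Sum>s\<le>w. (fact (CARD('n) - w - k) / fact (w - k)) *
     (if s \<le> k then (-1) ^ (k - s) * (real CARD('n) - 2 * real k + 1)
       / (fact (k - s) * fact (CARD('n) - k - s + 1)) else 0) * (fact (w - s) / fact s)\<^sup>2
       * ((fact s / fact (w - s))\<^sup>2 * psi (w - s) l)) = (if k = l then 1 else 0)"
    (is "(\<Sum>s\<le>w. ?f s) = _")
proof -
  let ?C = "(fact (CARD('n) - w - k) / fact (w - k)) * (real CARD('n) - 2 * real k + 1) *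
    (fact (w - l) / fact (CARD('n) - w - l)) :: real"
  let ?g = "\<lambda>s. (-1) ^ (k - s) * fact (CARD('n) - l - s) / (fact (k - s) * fact (CARD('n) - k - s + 1) * fact (s - l)) :: real"
  have "?f s = (if s \<in> {l..k} then ?C * ?g s else 0)" if "s \<le> w" for s
  proof (cases "s \<in> {l..k}")
    case True
    have "w - s \<le> w - l" "w - l - (w - s) = s - l" "CARD('n) - w - l + (w - s) = CARD('n) - l - s"
      using True that assms w_le by auto
    then have psi: "psi (w - s) l = fact (w - l) * fact (CARD('n) - l - s) / (fact (s - l) * fact (CARD('n) - w - l))"
      using psi_fact[OF assms(2), of "w - s"] by simp
    show ?thesis using True unfolding psi by (simp add: field_simps del: fact_Suc)
  next
    case False
    then have "s \<le> k \<Longrightarrow> psi (w - s) l = 0"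
      using psi_fact[OF assms(2), of "w - s"] that assms(2) by auto
    then show ?thesis using False by auto
  qed
  then have "(\<Sum>s\<le>w. ?f s) = (\<Sum>s\<le>w. if s \<in> {l..k} then ?C * ?g s else 0)"
    by (intro sum.cong refl) simp
  also have "\<dots> = (\<Sum>s\<in>{..w} \<inter> {l..k}. ?C * ?g s)"
    by (rule sum.inter_restrict[symmetric]) simp
  also have "{..w} \<inter> {l..k} = {l..k}" using assms by auto
  also have "(\<Sum>s\<in>{l..k}. ?C * ?g s) = ?C * (\<Sum>s=l..k. ?g s)"
    by (simp only: sum_distrib_left)
  also have "\<dots> = (if k = l then 1 else 0)"
  proof (cases "l \<le> k")
    case True
    have "2 * k \<le> CARD('n)" using assms w_le by simp
    from fact_inverse_pair[OF True this]
    have g: "(\<Sum>s=l..k. ?g s) = (if l = k then 1 / (real CARD('n) - 2 * real k + 1) else 0)" .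
    have "real CARD('n) - 2 * real k + 1 \<noteq> 0" using \<open>2 * k \<le> CARD('n)\<close> by linarith
    then show ?thesis unfolding g by auto
  qed auto
  finally show ?thesis .
qed

text \<open>The summation index is reversed, s to t - s. Terms of the original sum with s > w - j
  vanish with \<open>psi\<close>, which produces the lower limit; its truncated subtraction is the
  maximum with 0.\<close>

lemma W_coeff_eq:
  assumes "t \<le> w" "j \<le> w"
  shows "W_coeff t j = (real CARD('n) - 2 * real t + 1) * fact (w - j) * fact (CARD('n) - w - t)
         / (fact (w - t) * fact (CARD('n) - w - j))
       * (\<Sum>s = t + j - w..t. (-1) ^ s *
            (fact (CARD('n) - w + t - j - s) * (fact (s + w - t))\<^sup>2)
            / (fact s * fact (s + w - (t + j)) * fact (s + CARD('n) - 2 * t + 1) * (fact (t - s))\<^sup>2))"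
proof -
  let ?n = "CARD('n)"
  let ?C = "(real ?n - 2 * real t + 1) * fact (w - j) * fact (?n - w - t)
         / (fact (w - t) * fact (?n - w - j)) :: real"
  let ?h = "\<lambda>s. (-1) ^ s * (fact (?n - w + t - j - s) * (fact (s + w - t))\<^sup>2)
            / (fact s * fact (s + w - (t + j)) * fact (s + ?n - 2 * t + 1) * (fact (t - s))\<^sup>2) :: real"
  let ?f = "\<lambda>s. (fact (CARD('n) - w - t) / fact (w - t)) *
     (if s \<le> t then (-1) ^ (t - s) * (real CARD('n) - 2 * real t + 1)
       / (fact (t - s) * fact (CARD('n) - t - s + 1)) else 0) * (fact (w - s) / fact s)\<^sup>2 * psi s j"
  have f: "?f s = (if s \<in> {..min t (w - j)} then ?C * ?h (t - s) else 0)" if "s \<le> w" for s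
  proof (cases "s \<le> min t (w - j)")
    case True
    have "t - (t - s) = s" "?n - w + t - j - (t - s) = ?n - w - j + s" "t - s + w - t = w - s"
      "t - s + w - (t + j) = w - j - s" "t - s + ?n - 2 * t + 1 = ?n - t - s + 1"
      using True assms w_le by auto
    moreover have "psi s j = fact (w - j) * fact (?n - w - j + s) / (fact (w - j - s) * fact (?n - w - j))"
      using psi_fact[OF assms(2), of s] True by simp
    moreover have "s \<le> t" "s \<in> {..min t (w - j)}" using True by auto
    moreover have "(A / b) * (x * z / (D * F)) * (G / H)\<^sup>2 * (P * R / (S * U)) =
      z * P * A / (b * U) * (x * (R * G\<^sup>2) / (D * S * F * H\<^sup>2))" for A b x z D F G H P R S U :: real
      by (simp add: power_divide mult_ac)
    ultimately show ?thesis by (simp only: if_True)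
  next
    case False
    then show ?thesis using psi_fact[OF assms(2), of s] by auto
  qed
  have "W_coeff t j = (\<Sum>s\<le>w. if s \<in> {..min t (w - j)} then ?C * ?h (t - s) else 0)"
    unfolding W_coeff_def by (intro sum.cong refl) (use f in auto)
  also have "\<dots> = (\<Sum>s\<in>{..w} \<inter> {..min t (w - j)}. ?C * ?h (t - s))"
    by (rule sum.inter_restrict[symmetric]) simp
  also have "\<dots> = (\<Sum>s = t + j - w..t. ?C * ?h s)"
    by (rule sum.reindex_bij_witness[of _ "\<lambda>s. t - s" "\<lambda>s. t - s"]) (use assms in auto)
  finally show ?thesis by (simp only: sum_distrib_left)
qed

section \<open>Expansion in arbitrary orthonormal bases of the layers\<close>

context
  fixes B :: "nat \<Rightarrow> ('n, 'v) tensor_op set"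
  assumes B: "\<And>t. t \<le> w \<Longrightarrow> hs_orthonormal_basis (B t) (metric_layer t)"
begin

lemma basis_in_layer: "t \<le> w \<Longrightarrow> E \<in> B t \<Longrightarrow> E \<in> metric_layer t"
  using B[of t] cmat.span_base by (auto simp: hs_orthonormal_basis_def)

lemma Pi_proj_layer:
  assumes "i \<le> w" "j \<le> w" "X \<in> metric_layer j"
  shows "Pi_proj (B i) X = (if i = j then X else 0)"
proof (cases "i = j")
  case True
  then show ?thesis using Pi_proj_id[OF B[OF assms(1)]] assms by simp
next
  case False
  have "hs_inner E X = 0" if "E \<in> B i" for E
    using basis_in_layer[OF assms(1) that] assms False layers_orthogonal[of i j E X] layers_orthogonal[of j i X E]
    by (cases "i < j") auto
  then show ?thesis using False by (simp add: Pi_proj_0)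
qed

text \<open>By induction \<open>raised t\<close> is the sum of the layers up to t. Removing from Y
  its components there leaves an element of \<open>raised (Suc t)\<close> orthogonal to
  \<open>raised t\<close>, which is an element of the next layer.\<close>

lemma layer_resolution:
  "t \<le> w \<Longrightarrow> Y \<in> raised t \<Longrightarrow> Y = (\<Sum>j\<le>t. Pi_proj (B j) Y)"
proof (induction t arbitrary: Y)
  case 0
  have "metric_layer 0 = raised 0"
    using ext_metric_raised[of 0] by (simp add: metric_layer_def ext_metric_def)
  then show ?case using 0 Pi_proj_id[OF B[of 0], of Y] by simp
next
  case (Suc t)
  define Y' where "Y' = (\<Sum>j\<le>t. Pi_proj (B j) Y)"
  have Pi_raised: "Pi_proj (B j) Z \<in> raised t" if "j \<le> t" for j Z
    using that Suc.prems(1) Pi_proj_in[OF B[of j], of Z] layer_subset_raised[of j] raised_mono[of j t] by auto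
  have Y': "Y' \<in> raised t"
    unfolding Y'_def using Pi_raised by (intro cmat.subspace_sum raised_subspace) auto
  have PiY': "Pi_proj (B j) Y' = (if j \<le> t then Pi_proj (B j) Y else 0)" if "j \<le> w" for j
  proof -
    have "Pi_proj (B j) Y' = (\<Sum>i\<le>t. Pi_proj (B j) (Pi_proj (B i) Y))"
      unfolding Y'_def by (induction t) (simp_all add: Pi_proj_add)
    also have "\<dots> = (\<Sum>i\<le>t. if j = i then Pi_proj (B i) Y else 0)"
      using that Suc.prems(1) by (intro sum.cong refl Pi_proj_layer Pi_proj_in B) auto
    finally show ?thesis by simp
  qed
  have "hs_inner F (Y - Y') = 0" if F: "F \<in> raised t" for F
  proof -
    have "F = (\<Sum>j\<le>t. Pi_proj (B j) F)" using Suc.IH Suc.prems F by simp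
    moreover have "hs_inner (Pi_proj (B j) F) (Y - Y') = 0" if "j \<le> t" for j
    proof -
      have j: "j \<le> w" using that Suc.prems by simp
      have "Pi_proj (B j) (Y - Y') = 0" using PiY'[OF j] that by (simp add: Pi_proj_diff)
      moreover have "hs_inner E (Pi_proj (B j) (Y - Y')) = hs_inner E (Y - Y')" if "E \<in> B j" for E
      proof -
        have "hs_inner E (Pi_proj (B j) (Y - Y')) = (\<Sum>F\<in>B j. if E = F then hs_inner F (Y - Y') else 0)"
          unfolding Pi_proj_def hs_inner_simps(6) hs_inner_simps(3) using B[OF j] that
          by (intro sum.cong refl) (auto simp: hs_orthonormal_basis_def)
        then show ?thesis using B[OF j] that by (simp add: hs_orthonormal_basis_def)
      qed
      ultimately have "hs_inner E (Y - Y') = 0" if "E \<in> B j" for E using that by simp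
      moreover have "Pi_proj (B j) F \<in> cmat.span (B j)"
        using Pi_proj_in[OF B[OF j], of F] B[OF j] by (simp add: hs_orthonormal_basis_def)
      ultimately show ?thesis by (rule hs_inner_span_0)
    qed
    ultimately show ?thesis by (metis (no_types, lifting) atMost_iff hs_inner_simps(12) sum.neutral)
  qed
  moreover have "Y - Y' \<in> raised (Suc t)"
    using Suc.prems Y' raised_mono[of t "Suc t"] by (intro cmat.subspace_diff raised_subspace) auto
  ultimately have "Y - Y' \<in> metric_layer (Suc t)"
    using Suc.prems by (simp add: layer_iff_orthogonal)
  then have "Y - Y' = Pi_proj (B (Suc t)) (Y - Y')"
    using Pi_proj_layer[of "Suc t" "Suc t"] Suc.prems by simp
  also have "\<dots> = Pi_proj (B (Suc t)) Y" using PiY'[of "Suc t"] Suc.prems by (simp add: Pi_proj_diff)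
  finally show ?case by (simp add: Y'_def algebra_simps)
qed

text \<open>U^b D^b is diagonal along the layers, which exhaust \<open>ext_ops\<close>. A general Y
  may be replaced by its compression: elements of the layers have the same inner product with
  both.\<close>

lemma lift_eigen_sum:
  assumes "b \<le> w"
  shows "lift ((up ^^ b) ((down ^^ b) (compress Y))) = (\<Sum>j\<le>w. psi b j *\<^sub>R Pi_proj (B j) Y)"
proof -
  let ?Y = "lift (compress Y)"
  have Pi: "Pi_proj (B j) ?Y = Pi_proj (B j) Y" if "j \<le> w" for j
  proof -
    have "hs_inner E ?Y = hs_inner E Y" if "E \<in> B j" for E
    proof -
      have "E \<in> ext_ops" using basis_in_layer[OF \<open>j \<le> w\<close> that] layer_subset_raised[OF \<open>j \<le> w\<close>] raised_ext_ops by blast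
      then have "lift (compress E) = E" by (simp add: lift_compress ext_ops_def)
      moreover have "hs_inner E ?Y = hs_inner (lift (compress E)) Y"
        using hs_inner_commute[of E ?Y] hs_inner_commute[of "compress E" "compress Y"]
        by (simp add: hs_inner_lift)
      ultimately show ?thesis by simp
    qed
    then show ?thesis by (simp add: Pi_proj_def)
  qed
  have "?Y = (\<Sum>j\<le>w. Pi_proj (B j) ?Y)"
    by (rule layer_resolution) (simp_all add: raised_w)
  then have "compress ?Y = (\<Sum>j\<le>w. compress (Pi_proj (B j) ?Y))"
    by (metis compress_linear(3))
  also have "\<dots> = (\<Sum>j\<le>w. compress (Pi_proj (B j) Y))"
    by (intro sum.cong refl) (simp add: Pi)
  finally have "compress Y = (\<Sum>j\<le>w. compress (Pi_proj (B j) Y))"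
    by (simp add: compress_lift_sec compress_sec)
  moreover have "(down ^^ b) (sum f S) = (\<Sum>i\<in>S. (down ^^ b) (f i))" for f and S :: "nat set"
    by (induction S rule: infinite_finite_induct) (simp_all add: down_pow_linear)
  ultimately have "lift ((up ^^ b) ((down ^^ b) (compress Y))) =
     (\<Sum>j\<le>w. lift ((up ^^ b) ((down ^^ b) (compress (Pi_proj (B j) Y)))))"
    by (simp only: lift_linear(4) up_pow_linear(6))
  also have "\<dots> = (\<Sum>j\<le>w. psi b j *\<^sub>R lift (compress (Pi_proj (B j) Y)))"
    using assms by (intro sum.cong refl) (simp add: layer_eigen Pi_proj_in B lift_linear)
  also have "\<dots> = (\<Sum>j\<le>w. psi b j *\<^sub>R Pi_proj (B j) Y)"
  proof (intro sum.cong refl)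
    fix j assume "j \<in> {..w}"
    then have "Pi_proj (B j) Y \<in> ext_ops"
      using Pi_proj_in[OF B[of j], of Y] layer_subset_raised[of j] raised_ext_ops by auto
    then show "psi b j *\<^sub>R lift (compress (Pi_proj (B j) Y)) = psi b j *\<^sub>R Pi_proj (B j) Y"
      by (simp add: lift_compress ext_ops_def)
  qed
  finally show ?thesis .
qed

text \<open>The operators \<open>hop I J\<close> and the bases \<open>B k\<close>, the latter
  weighted by multiples of \<open>psi (w - t) k\<close>, have equal rank-one sums by
  \<open>project_hops\<close> and \<open>lift_eigen_sum\<close>. \<open>kraus_cong\<close> turns
  this into an equality of Kraus maps, and \<open>kraus_hops\<close> identifies the map of the
  \<open>hop I J\<close> as U^t D^t.\<close>

lemma Phi_Pi_relation:
  assumes "t \<le> w"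
  shows "(\<Sum>k\<le>w. ((fact t / fact (w - t))\<^sup>2 * psi (w - t) k) *\<^sub>R Phi (B k) X) =
    (\<Sum>j\<le>w. psi t j *\<^sub>R Pi_proj (B j) X)"
proof -
  let ?c = "(fact t / fact (w - t))\<^sup>2 :: real"
  \<comment> \<open>A dependent sum instead of a union, so that the weight is a function of the
    layer index.\<close>
  let ?S = "words t \<times> words t" and ?S' = "SIGMA k:{..w}. B k"
  have fin: "\<forall>k\<in>{..w}. finite (B k)" using B by (auto simp: hs_orthonormal_basis_def)
  have sig: "(\<Sum>k\<le>w. \<Sum>E\<in>B k. (?c * psi (w - t) k) *\<^sub>R f E) =
     (\<Sum>p\<in>?S'. (?c * psi (w - t) (fst p)) *\<^sub>R f (snd p))" for f :: "_ \<Rightarrow> ('n, 'v) tensor_op"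
    using sum.Sigma[OF _ fin, of "\<lambda>k E. (?c * psi (w - t) k) *\<^sub>R f E"] by (simp add: case_prod_beta')
  have "(\<Sum>p\<in>?S. cscale (hs_inner (hop (fst p) (snd p)) Y) (hop (fst p) (snd p))) =
     (\<Sum>p\<in>?S'. (?c * psi (w - t) (fst p)) *\<^sub>R cscale (hs_inner (snd p) Y) (snd p))" for Y
  proof -
    have "(\<Sum>p\<in>?S. cscale (hs_inner (hop (fst p) (snd p)) Y) (hop (fst p) (snd p))) =
      (\<Sum>I\<in>words t. \<Sum>J\<in>words t. cscale (hs_inner (hop I J) Y) (hop I J))"
      by (simp add: sum.cartesian_product case_prod_beta')
    also have "\<dots> = ?c *\<^sub>R (\<Sum>k\<le>w. psi (w - t) k *\<^sub>R Pi_proj (B k) Y)"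
      using project_hops[of t "w - t" Y] lift_eigen_sum[of "w - t" Y] assms by simp
    also have "\<dots> = (\<Sum>k\<le>w. \<Sum>E\<in>B k. (?c * psi (w - t) k) *\<^sub>R cscale (hs_inner E Y) E)"
      by (simp add: Pi_proj_def scaleR_sum_right)
    finally show ?thesis unfolding sig .
  qed
  note k = kraus_cong[OF this, of X]
  have "(\<Sum>j\<le>w. psi t j *\<^sub>R Pi_proj (B j) X) = lift ((up ^^ t) ((down ^^ t) (compress X)))"
    using lift_eigen_sum[OF assms] by simp
  also have "\<dots> = (\<Sum>I\<in>words t. \<Sum>J\<in>words t. hop I J ** X ** (hop I J)\<^sup>\<dagger>)"
    by (simp add: kraus_hops)
  also have "\<dots> = (\<Sum>p\<in>?S. hop (fst p) (snd p) ** X ** (hop (fst p) (snd p))\<^sup>\<dagger>)"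
    by (simp add: sum.cartesian_product case_prod_beta')
  also have "\<dots> = (\<Sum>p\<in>?S'. (?c * psi (w - t) (fst p)) *\<^sub>R (snd p ** X ** (snd p)\<^sup>\<dagger>))"
    by (rule k)
  also have "\<dots> = (\<Sum>k\<le>w. (?c * psi (w - t) k) *\<^sub>R Phi (B k) X)"
    by (simp only: Phi_def adjoint_mat_eq_hadj scaleR_sum_right sig)
  finally show ?thesis by simp
qed

lemma Phi_expansion:
  assumes "t \<le> w"
  shows "Phi (B t) X = (\<Sum>j\<le>w. W_coeff t j *\<^sub>R Pi_proj (B j) X)"
proof -
  \<comment> \<open>Row t of the inverse of the triangular matrix; \<open>W_coeff\<close> is this
    row applied to \<open>psi\<close>.\<close>
  define v where "v s = (fact (CARD('n) - w - t) / fact (w - t)) *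
     (if s \<le> t then (-1) ^ (t - s) * (real CARD('n) - 2 * real t + 1)
       / (fact (t - s) * fact (CARD('n) - t - s + 1)) else 0) * (fact (w - s) / fact s)\<^sup>2" for s
  have "(\<Sum>s\<le>w. v s *\<^sub>R (\<Sum>k\<le>w. ((fact s / fact (w - s))\<^sup>2 * psi (w - s) k) *\<^sub>R Phi (B k) X)) =
     (\<Sum>s\<le>w. \<Sum>k\<le>w. (v s * ((fact s / fact (w - s))\<^sup>2 * psi (w - s) k)) *\<^sub>R Phi (B k) X)"
    by (simp only: scaleR_sum_right scaleR_scaleR)
  also have "\<dots> = (\<Sum>k\<le>w. \<Sum>s\<le>w. (v s * ((fact s / fact (w - s))\<^sup>2 * psi (w - s) k)) *\<^sub>R Phi (B k) X)"
    by (rule sum.swap)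
  also have "\<dots> = (\<Sum>k\<le>w. (\<Sum>s\<le>w. v s * ((fact s / fact (w - s))\<^sup>2 * psi (w - s) k)) *\<^sub>R Phi (B k) X)"
    by (simp only: scaleR_sum_left)
  also have "\<dots> = (\<Sum>k\<le>w. (if t = k then 1 else 0) *\<^sub>R Phi (B k) X)"
    unfolding v_def using assms by (intro sum.cong refl arg_cong2[where f = "(*\<^sub>R)"] coefficient_inverse) auto
  also have "\<dots> = (\<Sum>k\<le>w. if t = k then Phi (B k) X else 0)"
    by (intro sum.cong refl) auto
  also have "\<dots> = Phi (B t) X" using assms by simp
  finally have "Phi (B t) X = (\<Sum>s\<le>w. v s *\<^sub>R (\<Sum>k\<le>w. ((fact s / fact (w - s))\<^sup>2 * psi (w - s) k) *\<^sub>R Phi (B k) X))"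
    by (rule sym)
  also have "\<dots> = (\<Sum>s\<le>w. v s *\<^sub>R (\<Sum>j\<le>w. psi s j *\<^sub>R Pi_proj (B j) X))"
    by (intro sum.cong refl) (simp add: Phi_Pi_relation)
  also have "\<dots> = (\<Sum>s\<le>w. \<Sum>j\<le>w. (v s * psi s j) *\<^sub>R Pi_proj (B j) X)"
    by (simp only: scaleR_sum_right scaleR_scaleR)
  also have "\<dots> = (\<Sum>j\<le>w. \<Sum>s\<le>w. (v s * psi s j) *\<^sub>R Pi_proj (B j) X)"
    by (rule sum.swap)
  also have "\<dots> = (\<Sum>j\<le>w. W_coeff t j *\<^sub>R Pi_proj (B j) X)"
    by (simp only: scaleR_sum_left W_coeff_def v_def)
  finally show ?thesis .
qed

text \<open>Every operator is a complex combination of two self-adjoint ones, so the hypothesis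
  extends to all of \<open>ext_ops\<close>. A nonzero element of layer j then isolates
  \<open>c j\<close>.\<close>

lemma coefficients_zero:
  assumes "\<And>X. X \<in> selfadjoint_ext_ops \<Longrightarrow> (\<Sum>j\<le>w. c j *\<^sub>R Pi_proj (B j) X) = 0" and "j \<le> w"
  shows "c j = 0"
proof -
  have all: "(\<Sum>j\<le>w. c j *\<^sub>R Pi_proj (B j) X) = 0" if X: "X \<in> ext_ops" for X
  proof -
    define S where "S = X + X\<^sup>\<dagger>"
    define D where "D = cscale \<i> (X - X\<^sup>\<dagger>)"
    have "ext_id\<^sup>\<dagger> = (ext_id :: ('n, 'v) tensor_op)"
      using adjoint_antisymmetrizer by (simp add: adjoint_mat_eq_hadj)
    then have "(ext_id ** X ** ext_id)\<^sup>\<dagger> = ext_id ** X\<^sup>\<dagger> ** ext_id"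
      by (simp add: matrix_mult_assoc)
    then have "X\<^sup>\<dagger> \<in> ext_ops" using X by (simp add: ext_ops_def del: hadj_mult)
    then have "S \<in> selfadjoint_ext_ops" "D \<in> selfadjoint_ext_ops"
      using X ext_ops_subspace
      by (auto simp: selfadjoint_ext_ops_def S_def D_def adjoint_mat_eq_hadj cmat.scale_right_diff_distrib
          intro!: cmat.subspace_add cmat.subspace_scale cmat.subspace_diff)
    note z = this[THEN assms(1)]
    have "X = cscale (1/2) S + cscale (- \<i> / 2) D"
      by (simp add: S_def D_def vec_eq_iff cscale_def field_simps)
    then have "Pi_proj (B j) X = cscale (1/2) (Pi_proj (B j) S) + cscale (- \<i> / 2) (Pi_proj (B j) D)" for j
      by (simp only: Pi_proj_add Pi_proj_cscale)
    then have "(\<Sum>j\<le>w. c j *\<^sub>R Pi_proj (B j) X) =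
       cscale (1/2) (\<Sum>j\<le>w. c j *\<^sub>R Pi_proj (B j) S) + cscale (- \<i> / 2) (\<Sum>j\<le>w. c j *\<^sub>R Pi_proj (B j) D)"
      by (simp only: scaleR_add_right sum.distrib cscale_sum cscale_scaleR)
    then show ?thesis using z by simp
  qed
  obtain X :: "('n, 'v) tensor_op" where X: "X \<in> metric_layer j" "X \<noteq> 0" using metric_layer_nonzero[OF assms(2)] by blast
  have "X \<in> ext_ops" using X(1) layer_subset_raised[OF assms(2)] raised_ext_ops by blast
  then have "0 = (\<Sum>i\<le>w. c i *\<^sub>R Pi_proj (B i) X)" by (simp add: all)
  also have "\<dots> = (\<Sum>i\<le>w. if i = j then c j *\<^sub>R X else 0)"
    using assms(2) X(1) by (intro sum.cong refl) (simp add: Pi_proj_layer)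
  also have "\<dots> = c j *\<^sub>R X" using assms(2) by simp
  finally show ?thesis using X(2) by simp
qed

end

theorem is_W_coefficients_iff:
  "is_W_coefficients TYPE(('n, 'v) tensor_op) w W \<longleftrightarrow> (\<forall>t\<le>w. \<forall>j\<le>w. W t j = W_coeff t j)"
proof
  assume W: "\<forall>t\<le>w. \<forall>j\<le>w. W t j = W_coeff t j"
  show "is_W_coefficients TYPE(('n, 'v) tensor_op) w W"
    unfolding is_W_coefficients_def
  proof (intro allI impI ballI)
    fix B :: "nat \<Rightarrow> ('n, 'v) tensor_op set" and t X
    assume B: "\<forall>t\<le>w. hs_orthonormal_basis (B t) (metric_layer t)" and t: "t \<le> w"
    show "Phi (B t) X = (\<Sum>j\<le>w. W t j *\<^sub>R Pi_proj (B j) X)"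
      using Phi_expansion[of B t X] B t W by simp
  qed
next
  assume W: "is_W_coefficients TYPE(('n, 'v) tensor_op) w W"
  have "\<forall>t. \<exists>B. hs_orthonormal_basis B (metric_layer t :: ('n, 'v) tensor_op set)"
    using hs_orthonormal_basis_exists metric_layer_subspace by blast
  then obtain B :: "nat \<Rightarrow> ('n, 'v) tensor_op set" where B: "\<And>t. hs_orthonormal_basis (B t) (metric_layer t)" by metis
  show "\<forall>t\<le>w. \<forall>j\<le>w. W t j = W_coeff t j"
  proof (intro allI impI)
    fix t j assume t: "t \<le> w" and j: "j \<le> w"
    have "(\<Sum>j\<le>w. (W t j - W_coeff t j) *\<^sub>R Pi_proj (B j) X) = 0" if "X \<in> selfadjoint_ext_ops" for X
    proof -
      have "Phi (B t) X = (\<Sum>j\<le>w. W t j *\<^sub>R Pi_proj (B j) X)"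
        using W B t that unfolding is_W_coefficients_def by blast
      then show ?thesis
        using Phi_expansion[of B t X] B t by (simp add: scaleR_diff_left sum_subtractf)
    qed
    from coefficients_zero[of B "\<lambda>j. W t j - W_coeff t j", OF B this j] show "W t j = W_coeff t j" by simp
  qed
qed

end

section \<open>Fock space on subsets\<close>

text \<open>The Jordan--Wigner signs need some linear order on \<open>'n\<close>; the one induced by \<open>to_nat\<close> is used.\<close>

definition jw_sign :: "'n::finite \<Rightarrow> 'n set \<Rightarrow> complex" where
  "jw_sign i S = (-1) ^ card {k \<in> S. to_nat k < to_nat i}"

text \<open>Rows come first: the basis vector of \<open>insert i S\<close> is sent to that of S, up
  to sign.\<close>

definition annihil :: "'n::finite \<Rightarrow> complex ^ ('n set) ^ ('n set)" where
  "annihil i = (\<chi> S R. if i \<notin> S \<and> R = insert i S then jw_sign i S else 0)"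

definition sector :: "nat \<Rightarrow> complex ^ ('n::finite set) ^ ('n set)" where
  "sector k = (\<chi> S R. if S = R \<and> card S = k then 1 else 0)"

lemma matrix_mult_entry: "(A ** B) $ i $ j = (\<Sum>k\<in>UNIV. A $ i $ k * B $ k $ j)"
  by (simp add: matrix_matrix_mult_def)

lemma annihil_entry: "annihil i $ S $ R = (if i \<notin> S \<and> R = insert i S then jw_sign i S else 0)"
  by (simp add: annihil_def)

lemma sector_entry: "sector k $ S $ R = (if S = R \<and> card S = k then 1 else 0)"
  by (simp add: sector_def)

lemma jw_sign_insert_self [simp]: "jw_sign i (insert i S) = jw_sign i S"
  by (simp add: jw_sign_def, intro arg_cong[where f = "(^) (-1)"] arg_cong[where f = card]) auto

lemma jw_sign_insert:
  assumes "j \<notin> S" "j \<noteq> i"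
  shows "jw_sign i (insert j S) = (if to_nat j < to_nat i then - jw_sign i S else jw_sign i S)"
proof (cases "to_nat j < to_nat i")
  case True
  then have "{k \<in> insert j S. to_nat k < to_nat i} = insert j {k \<in> S. to_nat k < to_nat i}" by auto
  then show ?thesis using assms True by (simp add: jw_sign_def)
next
  case False
  then have "{k \<in> insert j S. to_nat k < to_nat i} = {k \<in> S. to_nat k < to_nat i}" by auto
  then show ?thesis using False by (simp add: jw_sign_def)
qed

lemma jw_sign_remove_self [simp]: "jw_sign i (S - {i}) = jw_sign i S"
  by (metis jw_sign_insert_self insert_Diff_single)

lemma jw_sign_square [simp]: "jw_sign i S * jw_sign i S = 1" "cnj (jw_sign i S) = jw_sign i S"
  by (simp_all add: jw_sign_def flip: power_mult_distrib)

lemma annihil_mult: "(annihil i ** X) $ S $ R = (if i \<in> S then 0 else jw_sign i S * X $ insert i S $ R)"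
proof -
  have "(annihil i ** X) $ S $ R = (\<Sum>U\<in>UNIV. if U = insert i S then if i \<in> S then 0 else jw_sign i S * X $ insert i S $ R else 0)"
    unfolding matrix_mult_entry by (intro sum.cong refl) (auto simp: annihil_entry)
  then show ?thesis by simp
qed

lemma hadj_annihil: "(annihil i)\<^sup>\<dagger> $ S $ R = (if i \<in> S \<and> R = S - {i} then jw_sign i S else 0)"
proof -
  have "(i \<notin> R \<and> S = insert i R) \<longleftrightarrow> (i \<in> S \<and> R = S - {i})" by auto
  then show ?thesis by (auto simp: hadj_def annihil_def)
qed

lemma hadj_annihil_mult: "((annihil i)\<^sup>\<dagger> ** X) $ S $ R = (if i \<in> S then jw_sign i S * X $ (S - {i}) $ R else 0)"
proof -
  have "((annihil i)\<^sup>\<dagger> ** X) $ S $ R = (\<Sum>U\<in>UNIV. if U = S - {i} then if i \<in> S then jw_sign i S * X $ (S - {i}) $ R else 0 else 0)"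
    unfolding matrix_mult_entry by (intro sum.cong refl) (auto simp: hadj_annihil)
  then show ?thesis by simp
qed

lemma sector_mult: "(sector k ** X) $ S $ R = (if card S = k then X $ S $ R else 0)"
proof -
  have "(sector k ** X) $ S $ R = (\<Sum>U\<in>UNIV. if U = S then if card S = k then X $ S $ R else 0 else 0)"
    unfolding matrix_mult_entry by (intro sum.cong refl) (auto simp: sector_entry)
  then show ?thesis by simp
qed

lemma mult_sector: "(X ** sector k) $ S $ R = (if card R = k then X $ S $ R else 0)"
proof -
  have "(X ** sector k) $ S $ R = (\<Sum>U\<in>UNIV. if U = R then if card R = k then X $ S $ R else 0 else 0)"
    unfolding matrix_mult_entry by (intro sum.cong refl) (auto simp: sector_entry)
  then show ?thesis by simp
qed

text \<open>For distinct modes, inserting the smaller one flips the sign of the larger but not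
  conversely, so the two orders differ by one sign.\<close>

lemma annihil_anticomm: "annihil i ** annihil j = - (annihil j ** annihil i)"
proof -
  have "(annihil i ** annihil j) $ S $ R = - (annihil j ** annihil i) $ S $ R" for S R
  proof (cases "i = j \<or> i \<in> S \<or> j \<in> S")
    case False
    then have "to_nat i < to_nat j \<or> to_nat j < to_nat i"
      by (metis linorder_neqE_nat to_nat_split)
    then show ?thesis using False
      by (auto simp: annihil_mult annihil_entry jw_sign_insert insert_commute)
  qed (auto simp: annihil_mult annihil_entry)
  then show ?thesis by (simp add: vec_eq_iff)
qed

lemma annihil_car:
  "annihil i ** (annihil j)\<^sup>\<dagger> = (if i = j then mat 1 else 0) - (annihil j)\<^sup>\<dagger> ** annihil i"
proof -
  have "(annihil i ** (annihil j)\<^sup>\<dagger>) $ S $ R =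
    (if i = j then mat 1 else 0) $ S $ R - ((annihil j)\<^sup>\<dagger> ** annihil i) $ S $ R" for S R
  proof (cases "i = j")
    case True
    then show ?thesis
      by (auto simp: annihil_mult hadj_annihil_mult hadj_annihil annihil_entry mat_def insert_absorb)
  next
    case False
    show ?thesis
    proof (cases "i \<notin> S \<and> j \<in> S")
      case True
      define V where "V = S - {j}"
      have V: "S = insert j V" "i \<notin> V" "j \<notin> V" using True by (auto simp: V_def)
      have "to_nat i < to_nat j \<or> to_nat j < to_nat i"
        using False by (metis linorder_neqE_nat to_nat_split)
      moreover have "insert i (insert j V) - {j} = insert i V" "insert j V - {j} = V" using V False by auto
      ultimately show ?thesis using V False
        by (auto simp: annihil_mult hadj_annihil_mult hadj_annihil annihil_entry jw_sign_insert)
    qed (use False in \<open>auto simp: annihil_mult hadj_annihil_mult hadj_annihil annihil_entry\<close>)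
  qed
  then show ?thesis by (simp add: vec_eq_iff)
qed

lemma hadj_sector [simp]: "(sector k)\<^sup>\<dagger> = sector k"
  by (auto simp: hadj_def sector_def vec_eq_iff)

lemma sector_idem [simp]: "sector k ** sector k = sector k"
  by (simp add: vec_eq_iff sector_mult) (simp add: sector_entry)

lemma annihil_lower: "annihil i ** sector (Suc k) = sector k ** annihil i"
  by (auto simp: vec_eq_iff annihil_mult sector_mult) (auto simp: sector_entry annihil_entry)

lemma annihil_lower_0: "annihil i ** sector 0 = 0"
  by (auto simp: vec_eq_iff annihil_mult) (auto simp: sector_entry)

lemma number_sector:
  "(\<Sum>i\<in>UNIV. (annihil i)\<^sup>\<dagger> ** annihil i) ** sector k = real k *\<^sub>R (sector k :: complex ^ ('n::finite set) ^ ('n set))"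
proof -
  have e: "((annihil i)\<^sup>\<dagger> ** annihil i) $ S $ R = (if i \<in> S then if R = S then 1 else 0 else 0)" for i :: 'n and S R
    by (auto simp: hadj_annihil_mult annihil_entry insert_absorb)
  have "(\<Sum>i\<in>UNIV. if i \<in> S then if R = S then 1 else 0 else 0) = (if R = S then of_nat (card S) else (0 :: complex))" for S R :: "'n set"
    using sum.inter_restrict[of UNIV "\<lambda>_. if R = S then 1 else (0 :: complex)" S] by (simp split: if_splits)
  then show ?thesis
    by (simp add: vec_eq_iff mult_sector e) (auto simp: sector_entry scaleR_conv_of_real)
qed

text \<open>Stated for any sector consisting of a single set, since it serves both vacua: the empty
  set for particles and the full set for holes.\<close>

lemma sector_rank_one:
  fixes V :: "'n::finite set" and X :: "complex ^ ('n set) ^ ('n set)"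
  assumes "\<And>S :: 'n set. card S = k \<longleftrightarrow> S = V"
  shows "sector k ** X ** sector k = cscale (trace (sector k ** X)) (sector k)"
proof -
  have "trace (sector k ** X) = (\<Sum>S\<in>UNIV. if S = V then X $ V $ V else 0)"
    unfolding trace_def by (intro sum.cong) (auto simp: sector_mult assms)
  then have "trace (sector k ** X) = X $ V $ V" by simp
  moreover have "(sector k ** X ** sector k) $ S $ R = X $ V $ V * sector k $ S $ R" for S R
    by (cases "S = V"; cases "R = V") (simp_all add: mult_sector sector_mult sector_entry assms)
  ultimately show ?thesis by (simp add: vec_eq_iff cscale_def)
qed

lemma sector_0_entry: "sector 0 $ {} $ {} = 1"
  by (simp add: sector_entry)

interpretation fock: fermions annihil sector
proof
  show "sector 0 ** X ** sector 0 = cscale (trace (sector 0 ** X)) (sector 0)" for X :: "complex ^ ('n::finite set) ^ ('n set)"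
    by (rule sector_rank_one[where V = "{}"]) simp
  show "sector 0 \<noteq> (0 :: complex ^ ('n::finite set) ^ ('n set))"
    using sector_0_entry by (metis zero_index zero_neq_one)
qed (fact annihil_anticomm annihil_car hadj_sector sector_idem annihil_lower annihil_lower_0 number_sector)+

text \<open>k holes are n - k particles. Beyond n the value is 0, as truncated subtraction would
  repeat \<open>sector 0\<close>.\<close>

definition hole_sector :: "nat \<Rightarrow> complex ^ ('n::finite set) ^ ('n set)" where
  "hole_sector k = (if k \<le> CARD('n) then sector (CARD('n) - k) else 0)"

lemma sector_above: "CARD('n::finite) < k \<Longrightarrow> sector k = (0 :: complex ^ ('n::finite set) ^ ('n set))"
proof -
  have "card S \<le> CARD('n)" for S :: "'n set" by (rule card_mono) auto
  then show "CARD('n) < k \<Longrightarrow> ?thesis" by (auto simp: sector_entry vec_eq_iff dest: leD)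
qed

lemma fermions_holes: "fermions (\<lambda>i. (annihil i)\<^sup>\<dagger>) (hole_sector :: nat \<Rightarrow> complex ^ ('n::finite set) ^ ('n set))"
proof
  fix i j :: 'n and k :: nat and X :: "complex ^ ('n set) ^ ('n set)"
  let ?h = "hole_sector :: nat \<Rightarrow> complex ^ ('n::finite set) ^ ('n set)"
  show "(annihil i)\<^sup>\<dagger> ** (annihil j)\<^sup>\<dagger> = - ((annihil j)\<^sup>\<dagger> ** (annihil i)\<^sup>\<dagger>)"
    using arg_cong[OF annihil_anticomm[of j i], of hadj] by simp
  show "(annihil i)\<^sup>\<dagger> ** ((annihil j)\<^sup>\<dagger>)\<^sup>\<dagger> = (if i = j then mat 1 else 0) - ((annihil j)\<^sup>\<dagger>)\<^sup>\<dagger> ** (annihil i)\<^sup>\<dagger>"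
    using annihil_car[of j i] by (auto simp: algebra_simps)
  show "(?h k)\<^sup>\<dagger> = ?h k" "?h k ** ?h k = ?h k"
    by (simp_all add: hole_sector_def)
  show "(annihil i)\<^sup>\<dagger> ** ?h (Suc k) = ?h k ** (annihil i)\<^sup>\<dagger>"
  proof (cases "k < CARD('n)")
    case True
    then have "CARD('n) - k = Suc (CARD('n) - Suc k)" by simp
    then show ?thesis using True fock.raise[of i "CARD('n) - Suc k"] by (simp add: hole_sector_def)
  next
    case False
    then show ?thesis using fock.raise_0[of i] by (cases "k = CARD('n)") (auto simp: hole_sector_def)
  qed
  show "(annihil i)\<^sup>\<dagger> ** ?h 0 = 0"
    using fock.raise[of i "CARD('n)"] by (simp add: hole_sector_def sector_above)
  show "(\<Sum>i\<in>UNIV. ((annihil i)\<^sup>\<dagger>)\<^sup>\<dagger> ** (annihil i)\<^sup>\<dagger>) ** ?h k = real k *\<^sub>R ?h k"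
  proof (cases "k \<le> CARD('n)")
    case True
    \<comment> \<open>The number of holes is n minus the number of particles.\<close>
    have "(\<Sum>i\<in>UNIV. annihil i ** (annihil i)\<^sup>\<dagger>) = real CARD('n) *\<^sub>R mat 1 - (\<Sum>i\<in>(UNIV :: 'n set). (annihil i)\<^sup>\<dagger> ** annihil i)"
      by (simp add: annihil_car sum_subtractf sum_constant_scaleR del: sum_constant)
    then show ?thesis using True
      by (simp add: hole_sector_def matrix_mult_distrib number_sector of_nat_diff scaleR_diff_left[symmetric])
  qed (simp add: hole_sector_def)
  have "card S = CARD('n) \<longleftrightarrow> S = UNIV" for S :: "'n set"
    by (metis card_subset_eq finite subset_UNIV)
  then show "?h 0 ** X ** ?h 0 = cscale (trace (?h 0 ** X)) (?h 0)"
    unfolding hole_sector_def by (simp add: sector_rank_one[where V = UNIV])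
  have "?h 0 $ UNIV $ UNIV = 1" by (simp add: hole_sector_def sector_entry)
  then show "?h 0 \<noteq> 0" by (metis zero_index zero_neq_one)
qed

section \<open>The embedding of a sector into the tensors\<close>

definition factors :: "'w::finite list" where
  "factors = (SOME ws. distinct ws \<and> set ws = UNIV)"

lemma factors: "distinct (factors :: 'w::finite list)" "set (factors :: 'w list) = UNIV"
proof -
  have "\<exists>ws :: 'w list. distinct ws \<and> set ws = UNIV"
    using finite_distinct_list[of "UNIV :: 'w set"] by auto
  then have "distinct (factors :: 'w list) \<and> set (factors :: 'w list) = UNIV"
    unfolding factors_def by (rule someI_ex)
  then show "distinct (factors :: 'w list)" "set (factors :: 'w list) = UNIV" by simp_all
qed

lemma length_factors: "length (factors :: 'w::finite list) = CARD('w)"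
  using factors distinct_card by metis

text \<open>Its row \<open>{}\<close> holds the amplitudes that become, after normalization, the
  coordinates at the multi-index x. \<open>factors\<close> fixes an order of the tensor factors;
  another choice changes only an overall sign.\<close>

definition tuple_word :: "('w::finite \<Rightarrow> 'n::finite) \<Rightarrow> complex ^ ('n set) ^ ('n set)" where
  "tuple_word x = fock.word (map x factors)"

text \<open>The isometry from the \<open>w\<close>-particle sector of Fock space onto the exterior power.\<close>

definition fock_embed :: "complex ^ ('n::finite set) ^ ('w::finite \<Rightarrow> 'n)" where
  "fock_embed = (\<chi> x S. tuple_word x $ {} $ S / of_real (sqrt (fact CARD('w))))"

lemma fock_embed_mult:
  "((fock_embed :: complex ^ ('n::finite set) ^ ('w::finite \<Rightarrow> 'n)) ** X) $ x $ R
    = (tuple_word x ** X) $ {} $ R / of_real (sqrt (fact CARD('w)))"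
  by (simp add: matrix_matrix_mult_def fock_embed_def sum_divide_distrib)

lemma sqrt_fact_square: "complex_of_real (sqrt (fact k)) * complex_of_real (sqrt (fact k)) = fact k"
  by (simp flip: of_real_mult)

lemma tuple_word_sector:
  "tuple_word (x :: 'w::finite \<Rightarrow> 'n::finite) ** sector CARD('w) = sector 0 ** tuple_word x"
  using fock.word_lower[of "map x factors" 0] by (simp add: tuple_word_def length_factors)

lemma fock_embed_sector:
  "fock_embed ** sector CARD('w) = (fock_embed :: complex ^ ('n::finite set) ^ ('w::finite \<Rightarrow> 'n))"
proof -
  have "(fock_embed ** sector CARD('w)) $ x $ S = (fock_embed :: complex ^ ('n::finite set) ^ ('w::finite \<Rightarrow> 'n)) $ x $ S" for x S
    by (simp only: fock_embed_mult tuple_word_sector sector_mult) (simp add: fock_embed_def)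
  then show ?thesis by (simp add: vec_eq_iff)
qed

lemma bij_betw_tuples:
  "bij_betw (\<lambda>x :: 'w::finite \<Rightarrow> 'n::finite. map x factors) UNIV (fock.words CARD('w))"
proof (rule bij_betw_byWitness[where f' = "\<lambda>I l. I ! (the_inv_into {..<CARD('w)} ((!) factors) l)"])
  have bij: "bij_betw ((!) (factors :: 'w list)) {..<CARD('w)} UNIV"
    using bij_betw_nth[OF factors(1) refl factors(2)[symmetric]] by (simp add: length_factors)
  show "\<forall>x\<in>UNIV. (\<lambda>l. map x factors ! the_inv_into {..<CARD('w)} ((!) factors) l) = (x :: 'w \<Rightarrow> 'n)"
  proof (intro ballI ext)
    fix x :: "'w \<Rightarrow> 'n" and l :: 'w
    have "the_inv_into {..<CARD('w)} ((!) factors) l \<in> {..<CARD('w)}"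
      using bij_betw_the_inv_into[OF bij] by (rule bij_betw_apply) simp
    then show "map x factors ! the_inv_into {..<CARD('w)} ((!) factors) l = x l"
      using f_the_inv_into_f_bij_betw[OF bij, of l] by (simp add: length_factors)
  qed
  show "\<forall>I\<in>fock.words CARD('w). map (\<lambda>l. I ! the_inv_into {..<CARD('w)} ((!) factors) l) (factors :: 'w list) = (I :: 'n list)"
  proof
    fix I :: "'n list" assume "I \<in> fock.words CARD('w)"
    then have I: "length I = CARD('w)" by (simp add: fock.words_def)
    have "the_inv_into {..<CARD('w)} ((!) factors) ((factors :: 'w list) ! l) = l" if "l < CARD('w)" for l
      using bij that by (intro the_inv_into_f_f) (auto simp: bij_betw_def)
    then show "map (\<lambda>l. I ! the_inv_into {..<CARD('w)} ((!) factors) l) (factors :: 'w list) = I"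
      using I by (intro nth_equalityI) (auto simp: length_factors)
  qed
qed (auto simp: fock.words_def length_factors)

text \<open>A sum over all multi-indices is a sum over all words of length w, which by
  \<open>vacuum_resolution\<close> is w! times the projection. This explains the square root of w!
  in \<open>fock_embed\<close>.\<close>

lemma hadj_fock_embed_mult:
  "(fock_embed :: complex ^ ('n::finite set) ^ ('w::finite \<Rightarrow> 'n))\<^sup>\<dagger> ** fock_embed = sector CARD('w)"
proof -
  let ?T = "fock_embed :: complex ^ ('n::finite set) ^ ('w::finite \<Rightarrow> 'n)"
  have row: "((fock.word I)\<^sup>\<dagger> ** sector 0 ** fock.word I) $ S $ R = cnj (fock.word I $ {} $ S) * fock.word I $ {} $ R"
    for I :: "'n list" and S R
  proof -
    have "((fock.word I)\<^sup>\<dagger> ** (sector 0 ** fock.word I)) $ S $ R =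
      (\<Sum>U\<in>(UNIV :: 'n set set). if U = {} then cnj (fock.word I $ {} $ S) * fock.word I $ {} $ R else 0)"
      unfolding matrix_mult_entry[of "(fock.word I)\<^sup>\<dagger>"] by (rule sum.cong[OF refl]) (auto simp: sector_mult hadj_def)
    then show ?thesis by (simp add: matrix_mult_assoc)
  qed
  have "(?T\<^sup>\<dagger> ** ?T) $ S $ R = sector CARD('w) $ S $ R" for S R
  proof -
    have "(?T\<^sup>\<dagger> ** ?T) $ S $ R = (\<Sum>x\<in>UNIV. cnj (?T $ x $ S) * ?T $ x $ R)"
      by (simp add: matrix_matrix_mult_def hadj_def)
    also have "\<dots> = (\<Sum>x\<in>UNIV. ((fock.word (map x (factors :: 'w list)))\<^sup>\<dagger> ** sector 0 ** fock.word (map x factors)) $ S $ R) / fact CARD('w)"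
      by (simp add: row fock_embed_def tuple_word_def sum_divide_distrib sqrt_fact_square)
    also have "\<dots> = (\<Sum>I\<in>fock.words CARD('w). ((fock.word I)\<^sup>\<dagger> ** sector 0 ** fock.word I) $ S $ R) / fact CARD('w)"
      using sum.reindex_bij_betw[OF bij_betw_tuples, of "\<lambda>I. ((fock.word I)\<^sup>\<dagger> ** sector 0 ** fock.word I) $ S $ R"] by simp
    also have "\<dots> = sector CARD('w) $ S $ R"
      unfolding fock.vacuum_resolution[of "CARD('w)"] by (simp add: scaleR_cscale cscale_def)
    finally show ?thesis .
  qed
  then show ?thesis by (simp add: vec_eq_iff)
qed

text \<open>Moving u and v across B costs the same sign twice, and exchanging them with each other
  one more.\<close>

lemma word_swap: "fock.word (A @ u # B @ v # C) = - fock.word (A @ v # B @ u # C)"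
proof -
  have move: "annihil i ** fock.word B = (-1) ^ length B *\<^sub>R (fock.word B ** annihil i)" for i
  proof (induction B)
    case (Cons j B)
    have "annihil i ** fock.word (j # B) = - (annihil j ** (annihil i ** fock.word B))"
      using annihil_anticomm[of i j] by (simp add: matrix_mul_assoc)
    then show ?case using Cons by (simp add: matrix_mult_assoc)
  qed simp
  have "annihil u ** (fock.word B ** annihil v) = - (annihil v ** (fock.word B ** annihil u))"
    using move[of u] move[of v] annihil_anticomm[of u v]
    by (simp add: matrix_mul_assoc) (simp add: matrix_mult_assoc)
  then have "annihil u ** (fock.word B ** (annihil v ** fock.word C)) =
     - (annihil v ** (fock.word B ** (annihil u ** fock.word C)))"
    by (metis (no_types, lifting) matrix_mult_assoc matrix_mult_uminus(2))
  then show ?thesis by (simp add: fock.word_append)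
qed

lemma tuple_word_transpose:
  fixes x :: "'w::finite \<Rightarrow> 'n::finite"
  assumes "b \<noteq> c"
  shows "tuple_word (x \<circ> Transposition.transpose b c) = - tuple_word x"
proof -
  let ?t = "Transposition.transpose b c"
  have *: "tuple_word (x \<circ> ?t) = - tuple_word x"
    if f: "factors = A @ b' # B @ c' # C" and bc: "{b', c'} = {b, c}" for A B C b' c'
  proof -
    have d: "distinct (A @ b' # B @ c' # C)" using factors(1) f by metis
    have "?t l = l" if "l \<in> set A \<union> set B \<union> set C" for l
    proof -
      have "l \<noteq> b'" "l \<noteq> c'" using that d by auto
      then show ?thesis using bc by (auto simp: Transposition.transpose_def doubleton_eq_iff)
    qed
    then have "map (x \<circ> ?t) A = map x A" "map (x \<circ> ?t) B = map x B" "map (x \<circ> ?t) C = map x C"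
      by auto
    moreover have "?t b' = c'" "?t c' = b'" using bc assms by (auto simp: doubleton_eq_iff)
    ultimately have "map (x \<circ> ?t) factors = map x A @ x c' # map x B @ x b' # map x C"
      by (simp add: f)
    then show ?thesis
      by (simp only: tuple_word_def, subst word_swap) (simp add: f)
  qed
  have "b \<in> set factors" "c \<in> set factors" using factors(2) by auto
  then obtain A D where AD: "factors = A @ b # D" by (meson split_list)
  have "c \<in> set (A @ b # D)" using factors(2) AD by (metis UNIV_I)
  then have "c \<in> set A \<or> c \<in> set D" using assms by auto
  then show ?thesis
  proof
    assume "c \<in> set D"
    then obtain B C where "D = B @ c # C" by (meson split_list)
    then show ?thesis using * AD by blast
  next
    assume "c \<in> set A"
    then obtain B C where "A = B @ c # C" by (meson split_list)
    then show ?thesis using *[of B c C b D] AD by (auto simp: insert_commute)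
  qed
qed

lemma tuple_word_permute:
  assumes "p permutes (UNIV :: 'w::finite set)"
  shows "tuple_word (x \<circ> p) = cscale (of_int (sign p)) (tuple_word (x :: 'w \<Rightarrow> 'n::finite))"
  using assms finite
proof (induction arbitrary: x rule: permutes_induct)
  case id
  then show ?case by (simp add: cscale_def vec_eq_iff)
next
  case (swap b c p)
  have "sign (Transposition.transpose b c \<circ> p) = - sign p"
    using swap.hyps by (simp add: sign_compose sign_swap_id permutation_swap_id permutes_imp_permutation)
  moreover have "tuple_word (x \<circ> (Transposition.transpose b c \<circ> p)) = cscale (of_int (sign p)) (- tuple_word x)"
    using swap.IH[of "x \<circ> Transposition.transpose b c"] tuple_word_transpose[OF swap.hyps(3), of x]
    by (simp only: o_assoc)
  ultimately show ?case by (simp only: of_int_minus cmat.scale_minus_left cscale_uminus)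
qed

lemma antisymmetrizer_permute:
  fixes i k :: "'w::finite \<Rightarrow> 'n::finite"
  assumes "p permutes (UNIV :: 'w set)"
  shows "antisymmetrizer $ (i \<circ> p) $ k = of_int (sign p) * antisymmetrizer $ i $ k"
proof -
  have "(antisymmetrizer *v axis k 1) $ j = antisymmetrizer $ j $ k" for j :: "'w \<Rightarrow> 'n"
    by (simp add: matrix_vector_mult_def axis_def if_distrib cong: if_cong)
  then show ?thesis
    using antisymmetrizer_in[of "axis k 1"] assms unfolding exterior_power_def by auto
qed

lemma fock_embed_hadj_entry:
  "((fock_embed :: complex ^ ('n::finite set) ^ ('w::finite \<Rightarrow> 'n)) ** (fock_embed :: complex ^ ('n set) ^ ('w \<Rightarrow> 'n))\<^sup>\<dagger>) $ x $ y =
    (tuple_word x ** (tuple_word y)\<^sup>\<dagger>) $ {} $ {} / fact CARD('w)"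
  by (simp add: matrix_matrix_mult_def hadj_def fock_embed_def sum_divide_distrib sqrt_fact_square)

lemma word_support: "fock.word I $ R $ S \<noteq> 0 \<Longrightarrow> S = R \<union> set I"
proof (induction I arbitrary: R)
  case Nil
  then show ?case by (auto simp: mat_def split: if_splits)
next
  case (Cons i I)
  then show ?case by (auto simp: annihil_mult split: if_splits)
qed

text \<open>Both matrices acquire the sign of p when the row index is permuted, so rows of
  non-injective tuples vanish. If x is a rearrangement of y, the claim reduces to a diagonal entry 1
  / w!. Otherwise both entries are zero, on the Fock side because y has a repetition or occupies a
  different set of modes.\<close>

lemma fock_embed_hadj:
  "(fock_embed :: complex ^ ('n::finite set) ^ ('w::finite \<Rightarrow> 'n)) ** fock_embed\<^sup>\<dagger> = antisymmetrizer"
proof -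
  let ?T = "fock_embed :: complex ^ ('n::finite set) ^ ('w::finite \<Rightarrow> 'n)"
  let ?R = "?T ** ?T\<^sup>\<dagger>" and ?P = "antisymmetrizer :: ('n, 'w) tensor_op"
  have R_permute: "?R $ (x \<circ> p) $ y = of_int (sign p) * ?R $ x $ y" if "p permutes UNIV" for p x y
    by (simp add: fock_embed_hadj_entry tuple_word_permute[OF that]) (simp add: cscale_def)
  have zero: "tuple_word x = 0" if not_inj: "\<not> inj x" for x :: "'w \<Rightarrow> 'n"
  proof -
    obtain b c where bc: "b \<noteq> c" "x b = x c" using not_inj by (metis injI)
    then have "x \<circ> Transposition.transpose b c = x" by (auto simp: Transposition.transpose_def)
    then have "tuple_word x = - tuple_word x" using tuple_word_transpose[OF bc(1), of x] by simp
    then show ?thesis by (simp add: vec_eq_iff)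
  qed
  have "?R $ x $ y = ?P $ x $ y" for x y
  proof (cases "inj x")
    case False
    then obtain b c where bc: "b \<noteq> c" "x b = x c" by (metis injI)
    have "x \<circ> Transposition.transpose b c = x" using bc by (auto simp: Transposition.transpose_def)
    then have "?P $ x $ y = - ?P $ x $ y"
      using antisymmetrizer_permute[of "Transposition.transpose b c" x y] bc
      by (simp add: permutes_swap_id sign_swap_id)
    moreover have "?R $ x $ y = 0" using zero[OF False] by (simp add: fock_embed_hadj_entry)
    ultimately show ?thesis by simp
  next
    case x: True
    show ?thesis
    proof (cases "\<exists>q. q permutes UNIV \<and> x = y \<circ> q")
      case True
      then obtain q where q: "q permutes UNIV" "x = y \<circ> q" by blast
      have "y = x \<circ> inv q" using q by (simp add: comp_assoc permutes_inv_o(1))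
      then have y: "inj y" using x permutes_inj[OF permutes_inv[OF q(1)]] by (simp add: inj_compose)
      have "y = y \<circ> p \<longleftrightarrow> p = id" for p using y by (auto simp: fun_eq_iff inj_eq)
      then have "(\<Sum>p | p permutes (UNIV :: 'w set). if y = y \<circ> p then of_int (sign p) else 0) =
          (\<Sum>p | p permutes (UNIV :: 'w set). if p = id then 1 else (0 :: complex))"
        by (intro sum.cong[OF refl]) (simp add: sign_id)
      then have P: "?P $ y $ y = 1 / fact CARD('w)" by (simp add: antisymmetrizer_def permutes_id)
      have "distinct (map y factors)" using y by (simp add: distinct_map factors)
      from fock.word_word_vacuum[OF this]
      have "(tuple_word y ** (tuple_word y)\<^sup>\<dagger> ** sector 0) $ {} $ {} = 1"
        by (simp add: tuple_word_def matrix_mult_assoc sector_0_entry)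
      then have "?R $ y $ y = 1 / fact CARD('w)"
        by (simp add: fock_embed_hadj_entry mult_sector)
      then show ?thesis
        unfolding q(2) R_permute[OF q(1)] antisymmetrizer_permute[OF q(1)] P by simp
    next
      case False
      have "y \<noteq> x \<circ> p" if "p permutes UNIV" for p
      proof
        assume "y = x \<circ> p"
        then have "x = y \<circ> inv p" using that by (simp add: comp_assoc permutes_inv_o(1))
        then show False using False permutes_inv[OF that] by blast
      qed
      then have P: "?P $ x $ y = 0" by (simp add: antisymmetrizer_def)
      have "?R $ x $ y = 0"
      proof (cases "inj y")
        case y: True
        have ran: "range x \<noteq> range y"
        proof
          assume r: "range x = range y"
          define q where "q l = inv y (x l)" for l
          have "y (inv y (x l)) = x l" for l using r by (intro f_inv_into_f) auto
          then have yq: "x = y \<circ> q" by (simp add: q_def fun_eq_iff)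
          then have "inj q" using x by (metis inj_on_imageI2)
          then have "q permutes UNIV"
            by (intro bij_imp_permutes finite_UNIV_inj_surj bijI) auto
          then show False using False yq by blast
        qed
        \<comment> \<open>By \<open>word_support\<close> the rows \<open>{}\<close> live on the sets
          \<open>range x\<close> and \<open>range y\<close> respectively.\<close>
        have "tuple_word x $ {} $ S * cnj (tuple_word y $ {} $ S) = 0" for S
          using word_support[of "map x factors" "{}" S] word_support[of "map y factors" "{}" S] ran
          by (auto simp: tuple_word_def factors)
        then have "(tuple_word x ** (tuple_word y)\<^sup>\<dagger>) $ {} $ {} = 0"
          by (simp only: matrix_mult_entry hadj_def vec_lambda_beta sum.neutral_const)
        then show ?thesis by (simp only: fock_embed_hadj_entry div_0)
      qed (simp add: fock_embed_hadj_entry zero)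
      then show ?thesis using P by simp
    qed
  qed
  then show ?thesis by (simp add: vec_eq_iff)
qed

section \<open>The action of su(n) and the error space in terms of fermions\<close>

lemma second_quant_linear:
  "fock.second_quant (A + B) = fock.second_quant A + fock.second_quant B"
  "fock.second_quant (cscale c A) = cscale c (fock.second_quant A)"
  by (simp_all add: fock.second_quant_def cmat.scale_left_distrib sum.distrib cscale_sum)
     (simp add: cscale_def)

lemma second_quant_mat_1: "fock.second_quant (mat 1) = (\<Sum>i\<in>(UNIV :: 'n::finite set). (annihil i)\<^sup>\<dagger> ** annihil i)"
proof -
  have "(\<Sum>k\<in>UNIV. cscale ((mat 1 :: complex ^ 'n ^ 'n) $ i $ k) ((annihil i)\<^sup>\<dagger> ** annihil k)) =
     (\<Sum>k\<in>UNIV. if k = i then (annihil i)\<^sup>\<dagger> ** annihil k else 0)" for i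
    by (intro sum.cong refl) (auto simp: mat_def cmat.scale_zero_left)
  then show ?thesis by (simp add: fock.second_quant_def)
qed

lemma tensor_action_mult:
  fixes A :: "complex ^ 'n::finite ^ 'n" and X :: "complex ^ 'b ^ ('w::finite \<Rightarrow> 'n)"
  shows "(tensor_action A ** X) $ x $ b = (\<Sum>k\<in>UNIV. \<Sum>c\<in>UNIV. A $ x k $ c * X $ (x(k := c)) $ b)"
proof -
  have "(\<Sum>y\<in>UNIV. if \<forall>l. l \<noteq> k \<longrightarrow> x l = y l then A $ x k $ y k * X $ y $ b else 0) =
     (\<Sum>c\<in>UNIV. A $ x k $ c * X $ (x(k := c)) $ b)" for k
  proof -
    have upd: "x(k := y k) = y" if "\<forall>l. l \<noteq> k \<longrightarrow> x l = y l" for y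
      using that by auto
    have "(\<Sum>y\<in>UNIV. if \<forall>l. l \<noteq> k \<longrightarrow> x l = y l then A $ x k $ y k * X $ y $ b else 0) =
       (\<Sum>y | \<forall>l. l \<noteq> k \<longrightarrow> x l = y l. A $ x k $ y k * X $ y $ b)"
      using sum.inter_filter[of UNIV "\<lambda>y. A $ x k $ y k * X $ y $ b" "\<lambda>y. \<forall>l. l \<noteq> k \<longrightarrow> x l = y l"] by simp
    also have "\<dots> = (\<Sum>c\<in>UNIV. A $ x k $ c * X $ (x(k := c)) $ b)"
      by (rule sum.reindex_bij_witness[of _ "\<lambda>c. x(k := c)" "\<lambda>y. y k"]) (auto simp: upd)
    finally show ?thesis .
  qed
  moreover have "(tensor_action A ** X) $ x $ b =
      (\<Sum>k\<in>UNIV. \<Sum>y\<in>UNIV. if \<forall>l. l \<noteq> k \<longrightarrow> x l = y l then A $ x k $ y k * X $ y $ b else 0)"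
    by (subst sum.swap) (simp add: matrix_mult_entry tensor_action_def sum_distrib_right if_distrib if_distribR cong: if_cong)
  ultimately show ?thesis by simp
qed

text \<open>The embedding intertwines the two actions: the letter-by-letter terms of
  \<open>word_second_quant\<close> are the tensor action on coordinates.\<close>

lemma tensor_action_embed:
  fixes A :: "complex ^ 'n::finite ^ 'n"
  shows "tensor_action A ** fock_embed = (fock_embed :: complex ^ ('n set) ^ ('w::finite \<Rightarrow> 'n)) ** fock.second_quant A"
proof -
  let ?T = "fock_embed :: complex ^ ('n set) ^ ('w::finite \<Rightarrow> 'n)"
  have "(tensor_action A ** ?T) $ x $ S = (?T ** fock.second_quant A) $ x $ S" for x S
  proof -
    let ?s = "complex_of_real (sqrt (fact CARD('w)))"
    let ?f = "factors :: 'w list"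
    \<comment> \<open>The remaining term of the Leibniz rule begins with a creation operator, so its
      vacuum row is zero.\<close>
    have vac: "(fock.second_quant A ** Y) $ {} $ S = 0" for Y :: "complex ^ ('n set) ^ ('n set)"
      by (simp add: fock.second_quant_def matrix_sum_mult matrix_mult_assoc hadj_annihil_mult)
         (simp add: cscale_def hadj_annihil_mult)
    have upd: "(map x ?f)[l := c] = map (x(?f ! l := c)) ?f" if "l < CARD('w)" for l c
      using that by (intro nth_equalityI) (auto simp: length_factors nth_list_update nth_eq_iff_index_eq factors)
    have bij: "bij_betw ((!) ?f) {..<CARD('w)} UNIV"
      using bij_betw_nth[of ?f "{..<CARD('w)}" UNIV] by (simp add: length_factors factors)
    have "(?T ** fock.second_quant A) $ x $ S = (fock.word (map x ?f) ** fock.second_quant A) $ {} $ S / ?s"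
      by (simp add: fock_embed_mult tuple_word_def)
    also have "\<dots> = (\<Sum>l<CARD('w). \<Sum>c\<in>UNIV. A $ (x (?f ! l)) $ c * tuple_word (x(?f ! l := c)) $ {} $ S) / ?s"
      unfolding fock.word_second_quant by (simp add: vac length_factors upd tuple_word_def cscale_def)
    also have "(\<Sum>l<CARD('w). \<Sum>c\<in>UNIV. A $ (x (?f ! l)) $ c * tuple_word (x(?f ! l := c)) $ {} $ S) =
       (\<Sum>k\<in>UNIV. \<Sum>c\<in>UNIV. A $ x k $ c * tuple_word (x(k := c)) $ {} $ S)"
      by (rule sum.reindex_bij_betw[OF bij])
    also have "\<dots> / ?s = (tensor_action A ** ?T) $ x $ S"
      by (simp add: tensor_action_mult fock_embed_def sum_divide_distrib)
    finally show ?thesis by simp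
  qed
  then show ?thesis by (simp add: vec_eq_iff)
qed

lemma ext_action_second_quant:
  "ext_action A = (fock_embed :: complex ^ ('n::finite set) ^ ('w::finite \<Rightarrow> 'n)) ** fock.second_quant A ** fock_embed\<^sup>\<dagger>"
  unfolding ext_action_def fock_embed_hadj[symmetric] by (simp add: matrix_mul_assoc tensor_action_embed)

lemma ext_action_linear:
  "ext_action (A + B) = ext_action A + (ext_action B :: ('n::finite, 'w::finite) tensor_op)"
  "ext_action (cscale c A) = cscale c (ext_action A :: ('n::finite, 'w::finite) tensor_op)"
  by (simp_all add: ext_action_second_quant second_quant_linear matrix_mult_distrib conj_cscale)

text \<open>The identity matrix is not traceless, but it acts as the particle number, a multiple of
  \<open>ext_id\<close>; so \<open>error_space\<close> contains the action of all matrices.\<close>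

lemma ext_action_mat_1: "ext_action (mat 1) = real CARD('w) *\<^sub>R (ext_id :: ('n::finite, 'w::finite) tensor_op)"
proof -
  let ?T = "fock_embed :: complex ^ ('n set) ^ ('w \<Rightarrow> 'n)"
  have T: "sector CARD('w) ** ?T\<^sup>\<dagger> = ?T\<^sup>\<dagger>"
    using arg_cong[OF fock_embed_sector[where 'n = 'n and 'w = 'w], of hadj] by simp
  have "fock.second_quant (mat 1) ** ?T\<^sup>\<dagger> = (fock.second_quant (mat 1) ** sector CARD('w)) ** ?T\<^sup>\<dagger>"
    by (simp add: matrix_mult_assoc T)
  also have "\<dots> = real CARD('w) *\<^sub>R ?T\<^sup>\<dagger>"
    by (simp only: second_quant_mat_1 number_sector matrix_mult_scaleR T)
  finally show ?thesis
    by (simp add: ext_action_second_quant matrix_mult_assoc fock_embed_hadj)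
qed

text \<open>With the trace split off, the rest is S - \<open>\<i>\<close> D with S and D both
  anti-Hermitian and traceless: su(n) and the identity span all matrices over the complex
  numbers.\<close>

lemma ext_action_in_error_space:
  "ext_action A \<in> (error_space :: ('n::finite, 'w::finite) tensor_op set)"
proof -
  define c where "c = trace A / of_nat CARD('n)"
  define M where "M = A - cscale c (mat 1)"
  define S where "S = cscale (1/2) (M - M\<^sup>\<dagger>)"
  define D where "D = cscale (\<i>/2) (M + M\<^sup>\<dagger>)"
  have "trace (mat 1 :: complex ^ 'n ^ 'n) = of_nat CARD('n)" by (simp add: trace_def mat_def)
  then have "trace M = 0" by (simp add: M_def c_def trace_simps)
  then have "trace S = 0" "trace D = 0" by (simp_all add: S_def D_def trace_simps)
  moreover have "S\<^sup>\<dagger> = - S" "D\<^sup>\<dagger> = - D"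
    by (simp_all add: S_def D_def cscale_def vec_eq_iff hadj_def algebra_simps)
  ultimately have "S \<in> su" "D \<in> su"
    by (simp_all add: su_def adjoint_mat_eq_hadj)
  then have "ext_action S \<in> (error_space :: ('n, 'w) tensor_op set)" "ext_action D \<in> (error_space :: ('n, 'w) tensor_op set)"
    "ext_id \<in> (error_space :: ('n, 'w) tensor_op set)"
    by (auto simp: error_space_def intro!: cmat.span_base)
  moreover have "A = (S + cscale (- \<i>) D) + cscale c (mat 1)"
    by (simp add: S_def D_def M_def cscale_def vec_eq_iff field_simps)
  then have "ext_action A = (ext_action S + cscale (- \<i>) (ext_action D))
      + cscale c (real CARD('w) *\<^sub>R (ext_id :: ('n, 'w) tensor_op))"
    by (metis ext_action_linear ext_action_mat_1)
  ultimately show ?thesis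
    unfolding error_space_def scaleR_cscale by (auto intro!: cmat.span_add cmat.span_diff cmat.span_scale)
qed

lemma error_space_particles:
  "error_space = cmat.span (insert ext_id {fock_embed ** ((annihil i)\<^sup>\<dagger> ** annihil j) ** fock_embed\<^sup>\<dagger> | i j. True}
     :: ('n::finite, 'w::finite) tensor_op set)" (is "_ = cmat.span ?G")
proof
  show "error_space \<subseteq> cmat.span ?G"
    unfolding error_space_def
  proof (rule cmat.span_minimal)
    show "insert ext_id (ext_action ` su) \<subseteq> cmat.span ?G"
    proof (safe)
      fix A :: "complex ^ 'n ^ 'n"
      have "ext_action A = (\<Sum>i\<in>UNIV. \<Sum>j\<in>UNIV. cscale (A $ i $ j)
         ((fock_embed :: complex ^ ('n set) ^ ('w \<Rightarrow> 'n)) ** ((annihil i)\<^sup>\<dagger> ** annihil j) ** fock_embed\<^sup>\<dagger>))"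
        by (simp add: ext_action_second_quant fock.second_quant_def matrix_mult_sum matrix_sum_mult conj_cscale)
      also have "\<dots> \<in> cmat.span ?G"
        by (intro cmat.span_sum cmat.span_scale cmat.span_base) auto
      finally show "ext_action A \<in> cmat.span ?G" .
    qed (auto intro: cmat.span_base)
  qed simp
  have "fock_embed ** ((annihil i)\<^sup>\<dagger> ** annihil j) ** fock_embed\<^sup>\<dagger> \<in> (error_space :: ('n, 'w) tensor_op set)" for i j
  proof -
    define A :: "complex ^ 'n ^ 'n" where "A = (\<chi> x y. if x = i \<and> y = j then 1 else 0)"
    have "fock.second_quant A = (\<Sum>x\<in>UNIV. \<Sum>y\<in>UNIV. if x = i then if y = j then (annihil x)\<^sup>\<dagger> ** annihil y else 0 else 0)"
      unfolding fock.second_quant_def A_def by (intro sum.cong refl) (auto simp: cmat.scale_zero_left)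
    also have "\<dots> = (\<Sum>x\<in>UNIV. if x = i then \<Sum>y\<in>UNIV. if y = j then (annihil x)\<^sup>\<dagger> ** annihil y else 0 else 0)"
      by (intro sum.cong refl) auto
    finally have "fock.second_quant A = (annihil i)\<^sup>\<dagger> ** annihil j" by simp
    then show ?thesis using ext_action_in_error_space[of A] by (simp add: ext_action_second_quant)
  qed
  then show "cmat.span ?G \<subseteq> error_space"
    by (intro cmat.span_minimal) (auto simp: error_space_def intro: cmat.span_base)
qed

text \<open>Reversing the order of a creation and an annihilation operator costs a sign and a
  multiple of the identity, which is among the generators.\<close>

lemma error_space_holes:
  "error_space = cmat.span (insert ext_id {fock_embed ** (((annihil i)\<^sup>\<dagger>)\<^sup>\<dagger> ** (annihil j)\<^sup>\<dagger>) ** fock_embed\<^sup>\<dagger> | i j. True}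
     :: ('n::finite, 'w::finite) tensor_op set)" (is "_ = cmat.span ?H")
proof -
  let ?T = "fock_embed :: complex ^ ('n set) ^ ('w \<Rightarrow> 'n)"
  let ?p = "\<lambda>i j. ?T ** ((annihil i)\<^sup>\<dagger> ** annihil j) ** ?T\<^sup>\<dagger>"
  let ?h = "\<lambda>i j. ?T ** (((annihil i)\<^sup>\<dagger>)\<^sup>\<dagger> ** (annihil j)\<^sup>\<dagger>) ** ?T\<^sup>\<dagger>"
  have h: "?h i j = (if i = j then ext_id else 0) - ?p j i" for i j
    by (simp add: annihil_car matrix_mult_distrib fock_embed_hadj)
  have p: "?p i j = (if i = j then ext_id else 0) - ?h j i" for i j
    unfolding h by simp
  have hG: "?h i j \<in> cmat.span (insert ext_id {?p i j | i j. True})" for i j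
    unfolding h by (auto intro!: cmat.span_diff cmat.span_neg intro: cmat.span_base)
  have pH: "?p i j \<in> cmat.span (insert ext_id {?h i j | i j. True})" for i j
    by (subst p) (auto intro!: cmat.span_diff cmat.span_neg intro: cmat.span_base simp del: hadj_simps(1))
  show ?thesis
    unfolding error_space_particles
  proof
    show "cmat.span (insert ext_id {?p i j | i j. True}) \<subseteq> cmat.span ?H"
      using pH by (intro cmat.span_minimal cmat.subspace_span) (auto intro: cmat.span_base simp del: hadj_simps(1))
    show "cmat.span ?H \<subseteq> cmat.span (insert ext_id {?p i j | i j. True})"
      using hG by (intro cmat.span_minimal cmat.subspace_span) (auto intro: cmat.span_base simp del: hadj_simps(1))
  qed
qed

section \<open>The particle and hole instances\<close>

lemma ext_fermions_particles:
  assumes "2 * CARD('w) \<le> CARD('n)"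
  shows "ext_fermions annihil sector (fock_embed :: complex ^ ('n::finite set) ^ ('w::finite \<Rightarrow> 'n)) CARD('w)"
  by unfold_locales (use assms in \<open>simp_all add: fock_embed_hadj hadj_fock_embed_mult fock_embed_sector error_space_particles\<close>)

text \<open>The sector with n - w holes is the one with w particles, so the same isometry serves;
  only the number entering the bound changes.\<close>

lemma ext_fermions_holes:
  assumes "CARD('w) < CARD('n)" "2 * (CARD('n) - CARD('w)) \<le> CARD('n)"
  shows "ext_fermions (\<lambda>i. (annihil i)\<^sup>\<dagger>) hole_sector
    (fock_embed :: complex ^ ('n::finite set) ^ ('w::finite \<Rightarrow> 'n)) (CARD('n) - CARD('w))"
proof -
  interpret fermions "\<lambda>i :: 'n. (annihil i)\<^sup>\<dagger>" hole_sector by (rule fermions_holes)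
  have "hole_sector (CARD('n) - CARD('w)) = (sector CARD('w) :: complex ^ ('n set) ^ ('n set))"
    using assms by (simp add: hole_sector_def)
  then show ?thesis
    using assms error_space_holes[where 'n = 'n and 'w = 'w]
    by unfold_locales (simp_all add: fock_embed_hadj hadj_fock_embed_mult fock_embed_sector)
qed

theorem proposition3p6p7:
  fixes n w r :: nat and W :: "nat \<Rightarrow> nat \<Rightarrow> real"
  assumes "n = CARD('n::finite)" and "w = CARD('w::finite)"
    and "2 \<le> n" and "1 \<le> w" and "w \<le> n - 1" and "r = min w (n - w)"
  shows "is_W_coefficients TYPE(('n, 'w) tensor_op) r W \<longleftrightarrow>
    (\<forall>t\<le>r. \<forall>j\<le>r. W t j =
       (real n - 2 * real t + 1) * fact (r - j) * fact (n - r - t)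
         / (fact (r - t) * fact (n - r - j))
       * (\<Sum>s = t + j - r..t. (-1) ^ s *
            (fact (n - r + t - j - s) * (fact (s + r - t))\<^sup>2)
            / (fact s * fact (s + r - (t + j)) * fact (s + n - 2 * t + 1) * (fact (t - s))\<^sup>2)))"
proof (cases "2 * w \<le> n")
  case True
  interpret ext_fermions annihil sector "fock_embed :: complex ^ ('n set) ^ ('w \<Rightarrow> 'n)" r
    using ext_fermions_particles[where 'n = 'n and 'w = 'w] True assms by simp
  show ?thesis
    unfolding is_W_coefficients_iff by (simp add: W_coeff_eq assms(1))
next
  case False
  then have r: "r = n - w" using assms by simp
  \<comment> \<open>The number of particles of the locale is here the number r of holes, so
    \<open>W_coeff_eq\<close> again yields the formula in terms of r.\<close>
  interpret ext_fermions "\<lambda>i. (annihil i)\<^sup>\<dagger>" hole_sector "fock_embed :: complex ^ ('n set) ^ ('w \<Rightarrow> 'n)" r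
    unfolding r using ext_fermions_holes[where 'n = 'n and 'w = 'w] False assms(1-5) by simp
  show ?thesis
    unfolding is_W_coefficients_iff by (simp add: W_coeff_eq assms(1))
qed

end
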